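(* Let $G$ be a generalised Heisenberg group. Then there exists an automorphism $\psi$ of $G$ such that for every finite generating set $S$ of $G$ the twisted conjugacy growth series $\sum_{n\ge0}\mathrm{Gr}^S_{\psi,G}(n)x^n$ is transcendental.
   Context: A generalised Heisenberg group is a finitely generated $2$-step nilpotent group (i.e. $[G,G]\subset Z(G)$) whose derived subgroup $[G,G]$ is infinite cyclic. For a finite generating set $S$ of $G$, $\|g\|_S$ is the word norm with respect to $S\cup S^{-1}$. For an automorphism $\psi$ of $G$, $x\sim_\psi y$ means $gx\psi(g)^{-1}=y$ for some $g\in G$; $[x]_\psi$ is the class of $x$; $\mathrm{Gr}^S_{\psi,G}(n)=\#\{[g]_\psi: g\in G,\|g\|_S\le n\}$. Transcendental means: not algebraic over the field $\mathbb Q(x)$. *)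

theory Defs
  imports
    "HOL-Algebra.Elementary_Groups"
    "HOL-Computational_Algebra.Computational_Algebra"
begin

section \<open>Generalised Heisenberg groups\<close>

definition group_center :: "('a, 'b) monoid_scheme \<Rightarrow> 'a set" where
  "group_center G = {z \<in> carrier G. \<forall>g \<in> carrier G. z \<otimes>\<^bsub>G\<^esub> g = g \<otimes>\<^bsub>G\<^esub> z}"

definition finite_generating_set :: "('a, 'b) monoid_scheme \<Rightarrow> 'a set \<Rightarrow> bool" where
  "finite_generating_set G S \<longleftrightarrow> finite S \<and> S \<subseteq> carrier G \<and> generate G S = carrier G"

definition generalised_Heisenberg_group :: "('a, 'b) monoid_scheme \<Rightarrow> bool" where
  "generalised_Heisenberg_group G \<longleftrightarrow>
     group G \<and>
     (\<exists>S. finite_generating_set G S) \<and>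
     derived G (carrier G) \<subseteq> group_center G \<and>
     cyclic_group (G\<lparr>carrier := derived G (carrier G)\<rparr>) \<and>
     infinite (derived G (carrier G))"


section \<open>Twisted conjugacy growth\<close>

text \<open>The least length of a word over \<open>S\<close> and its inverses that represents \<open>g\<close>;
  the value is meaningful only for \<open>g\<close> in the subgroup generated by \<open>S\<close>.\<close>

definition word_norm :: "('a, 'b) monoid_scheme \<Rightarrow> 'a set \<Rightarrow> 'a \<Rightarrow> nat" where
  "word_norm G S g =
     (LEAST n. \<exists>ws. length ws = n \<and> set ws \<subseteq> S \<union> (\<lambda>s. inv\<^bsub>G\<^esub> s) ` S \<and>
                    foldr (\<lambda>a b. a \<otimes>\<^bsub>G\<^esub> b) ws \<one>\<^bsub>G\<^esub> = g)"

definition twisted_conjugate ::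
    "('a, 'b) monoid_scheme \<Rightarrow> ('a \<Rightarrow> 'a) \<Rightarrow> 'a \<Rightarrow> 'a \<Rightarrow> bool" where
  "twisted_conjugate G \<psi> x y \<longleftrightarrow>
     (\<exists>g \<in> carrier G. g \<otimes>\<^bsub>G\<^esub> x \<otimes>\<^bsub>G\<^esub> inv\<^bsub>G\<^esub> (\<psi> g) = y)"

definition twisted_class :: "('a, 'b) monoid_scheme \<Rightarrow> ('a \<Rightarrow> 'a) \<Rightarrow> 'a \<Rightarrow> 'a set" where
  "twisted_class G \<psi> x = {y \<in> carrier G. twisted_conjugate G \<psi> x y}"

definition twisted_growth ::
    "('a, 'b) monoid_scheme \<Rightarrow> ('a \<Rightarrow> 'a) \<Rightarrow> 'a set \<Rightarrow> nat \<Rightarrow> nat" where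
  "twisted_growth G \<psi> S n =
     card {twisted_class G \<psi> g | g. g \<in> carrier G \<and> word_norm G S g \<le> n}"

definition twisted_growth_series ::
    "('a, 'b) monoid_scheme \<Rightarrow> ('a \<Rightarrow> 'a) \<Rightarrow> 'a set \<Rightarrow> rat fps" where
  "twisted_growth_series G \<psi> S = Abs_fps (\<lambda>n. of_nat (twisted_growth G \<psi> S n))"


section \<open>Transcendental power series\<close>

text \<open>The constant \<open>algebraic\<close> of the polynomial library only covers algebraicity over the
  integers (equivalently, over the prime field), so algebraicity over a subfield \<open>K\<close> is
  defined here.\<close>

definition algebraic_over :: "'a::field set \<Rightarrow> 'a \<Rightarrow> bool" where
  "algebraic_over K a \<longleftrightarrow>
     (\<exists>P :: 'a poly. P \<noteq> 0 \<and> (\<forall>i. poly.coeff P i \<in> K) \<and> poly P a = 0)"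

text \<open>The field \<open>k(x)\<close>, realised as a subfield of the field \<open>k((x))\<close> of formal Laurent series.\<close>

definition rational_functions :: "'a::field fls set" where
  "rational_functions =
     {fps_to_fls (fps_of_poly p) / fps_to_fls (fps_of_poly q) | p q. q \<noteq> 0}"

definition transcendental_series :: "rat fps \<Rightarrow> bool" where
  "transcendental_series f \<longleftrightarrow> \<not> algebraic_over rational_functions (fps_to_fls f)"

end

theory Submission
  imports
    Defs
    "HOL-Algebra.FiniteProduct"
    "HOL-Analysis.FPS_Convergence"
    "HOL-Analysis.Harmonic_Numbers"
    "HOL-Number_Theory.Totient"
begin

text \<open>
  Let \<open>z\<close> generate \<open>[G, G]\<close> and write \<open>x y = y x z\<^bsup>\<omega>(x, y)\<^esup>\<close>. The alternating form \<open>\<omega>\<close> takes the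
  value \<open>1\<close>, say at \<open>(a, b)\<close>, and \<open>G\<close> is the central product of \<open>\<langle>a, b\<rangle>\<close> and the subgroup \<open>C\<close>
  orthogonal to \<open>a\<close> and \<open>b\<close>. Take \<open>\<psi>\<close> to be the identity on \<open>\<langle>a, b\<rangle>\<close> and, modulo torsion,
  inversion on \<open>C / \<langle>z\<rangle>\<close>. Then the twisted classes are, up to finitely many choices,
  parametrised by the exponents \<open>i, j\<close> of \<open>a, b\<close> and a power of \<open>z\<close> that matters only modulo
  \<open>gcd(i, j)\<close>, so that the growth is squeezed between multiples of
  \<open>\<Sum>\<^bsub>i, j \<le> n\<^esub> gcd(i, j)\<close>, which is of order \<open>n\<^sup>2 log n\<close> for every generating set. As \<open>t = 1 - x\<close>
  decreases to \<open>0\<close>, the series is therefore \<open>L / t\<^sup>3\<close> with \<open>L\<close> unbounded but smaller than any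
  negative power of \<open>t\<close>. In a polynomial relation over \<open>\<rat>(x)\<close> the terms \<open>t\<^sup>k L\<^sup>j\<close> then have
  pairwise different orders of magnitude, and the dominant one cannot be cancelled.
\<close>

section \<open>Series with slowly growing factors are transcendental\<close>

text \<open>The delicate point is the exponent of \<open>z\<close>. Twisted conjugation by g with
  \<psi>(g) = g carries h to h z^\<omega>(g, h), and these shifts produce the gcd. An element with
  \<psi>(g) = g z^k and k \<noteq> 0 would add a shift of its own and could destroy the lower bound,
  so \<psi> is built to exclude this. Literal inversion on C is out of reach: it is no homomorphism
  when C is not abelian, and it would move \<open>z\<close>. Inverting one free generator of C
  modulo torsion at a time works, because two sign changes leave \<omega> unchanged; starting from
  the identity on the torsion avoids unwanted shifts there. Inverting is useful because g
  \<psi>(g)^-1 is then g^2 up to torsion and powers of \<open>z\<close>, so that C contributes only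
  finitely many labels. Over i = j = 0 conjugation by the plane identifies no powers of
  \<open>z\<close>, as gcd(0, 0) = 0; a separate invariant, \<open>tau\<close>, and a quadratic
  bound for it show that this one fibre adds only O(n^2) classes.\<close>

lemma algebraic_over_rational_functionsE:
  fixes f :: "rat fps"
  assumes "algebraic_over rational_functions (fps_to_fls f)"
  obtains p :: "nat \<Rightarrow> rat poly" and d j where "j \<le> d" "p j \<noteq> 0" "(\<Sum>j\<le>d. fps_of_poly (p j) * f ^ j) = 0"
proof -
  from assms obtain P :: "rat fls poly"
    where P: "P \<noteq> 0" "\<forall>i. poly.coeff P i \<in> rational_functions" "poly P (fps_to_fls f) = 0"
    unfolding algebraic_over_def by auto
  then have "\<forall>i. \<exists>n q. q \<noteq> 0 \<and> poly.coeff P i = fps_to_fls (fps_of_poly n) / fps_to_fls (fps_of_poly q)"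
    unfolding rational_functions_def by blast
  then obtain n q where nq: "\<And>i. q i \<noteq> (0 :: rat poly)"
      "\<And>i. poly.coeff P i = fps_to_fls (fps_of_poly (n i)) / fps_to_fls (fps_of_poly (q i))"
    by metis
  define d where "d = degree P"
  \<comment> \<open>Clearing denominators without dividing: coefficient i is multiplied by all
    \<open>q k\<close>, and the factor for k = i cancels its own denominator.\<close>
  define p where "p i = n i * (\<Prod>k\<in>{..d} - {i}. q k)" for i
  let ?F = "\<lambda>r :: rat poly. fps_to_fls (fps_of_poly r)"
  have hom: "?F (r * s) = ?F r * ?F s" for r s
    by (simp add: fps_of_poly_mult fls_times_fps_to_fls)
  have eq: "?F (p i) = ?F (\<Prod>k\<le>d. q k) * poly.coeff P i" if "i \<le> d" for i
  proof -
    have "(\<Prod>k\<le>d. q k) = q i * (\<Prod>k\<in>{..d} - {i}. q k)"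
      using that by (simp add: prod.remove)
    moreover have "?F (q i) \<noteq> 0" using nq(1)[of i] by simp
    ultimately show ?thesis
      unfolding p_def nq(2) hom by (simp add: hom)
  qed
  have fls_sum: "fps_to_fls (sum g A) = (\<Sum>j\<in>A. fps_to_fls (g j))" for g :: "nat \<Rightarrow> rat fps" and A
    by (induction A rule: infinite_finite_induct) auto
  have "fps_to_fls (\<Sum>j\<le>d. fps_of_poly (p j) * f ^ j) = (\<Sum>j\<le>d. ?F (p j) * fps_to_fls f ^ j)"
    by (simp add: fls_sum fls_times_fps_to_fls fps_to_fls_power)
  also have "\<dots> = ?F (\<Prod>k\<le>d. q k) * poly P (fps_to_fls f)"
    by (simp add: eq poly_altdef d_def sum_distrib_left mult.assoc)
  finally have "(\<Sum>j\<le>d. fps_of_poly (p j) * f ^ j) = 0"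
    using P(3) by simp
  moreover have "p d \<noteq> 0"
  proof -
    have "?F (\<Prod>k\<le>d. q k) \<noteq> 0" using nq(1) by simp
    moreover have "poly.coeff P d \<noteq> 0" using P(1) by (simp add: d_def)
    ultimately have "?F (p d) \<noteq> 0" by (simp add: eq)
    then show ?thesis by auto
  qed
  ultimately show ?thesis by (intro that[of d d p]) auto
qed

text \<open>Mapping coefficients from the rationals to the reals is a ring homomorphism, so the
  formal relation persists over the reals. Evaluation respects sums and products only inside the
  disc of convergence, which is where \<open>conv\<close> enters.\<close>

lemma eval_poly_relation:
  fixes a :: "nat \<Rightarrow> nat" and p :: "nat \<Rightarrow> rat poly"
  assumes rel: "(\<Sum>j\<le>d. fps_of_poly (p j) * Abs_fps (\<lambda>n. of_nat (a n)) ^ j) = 0"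
    and conv: "fps_conv_radius (Abs_fps (\<lambda>n. real (a n))) \<ge> 1" and x: "\<bar>x\<bar> < 1"
  shows "(\<Sum>j\<le>d. poly (map_poly of_rat (p j)) x * (\<Sum>n. real (a n) * x ^ n) ^ j) = 0"
proof -
  define R :: "rat fps \<Rightarrow> real fps" where "R g = Abs_fps (\<lambda>n. of_rat (fps_nth g n))" for g
  define F where "F = Abs_fps (\<lambda>n. real (a n))"
  have R_mult: "R (g * h) = R g * R h" for g h
    by (simp add: R_def fps_eq_iff fps_mult_nth of_rat_sum of_rat_mult)
  have R_add: "R (g + h) = R g + R h" for g h
    by (simp add: R_def fps_eq_iff of_rat_add)
  have R_0: "R 0 = 0" and R_1: "R 1 = 1"
    by (simp_all add: R_def fps_eq_iff)
  have R_sum: "R (\<Sum>j\<in>A. g j) = (\<Sum>j\<in>A. R (g j))" for g :: "nat \<Rightarrow> _" and A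
    by (induction A rule: infinite_finite_induct) (auto simp: R_0 R_add)
  have R_power: "R (g ^ j) = R g ^ j" for g j
    by (induction j) (auto simp: R_1 R_mult)
  have R_poly: "R (fps_of_poly q) = fps_of_poly (map_poly of_rat q)" for q
    by (simp add: R_def fps_eq_iff coeff_map_poly)
  have R_F: "R (Abs_fps (\<lambda>n. of_nat (a n))) = F"
    by (simp add: R_def F_def)
  have "(\<Sum>j\<le>d. fps_of_poly (map_poly of_rat (p j)) * F ^ j) = 0"
    using arg_cong[OF rel, of R] by (simp add: R_sum R_mult R_power R_poly R_F R_0)
  then have "eval_fps (\<Sum>j\<le>d. fps_of_poly (map_poly of_rat (p j)) * F ^ j) x = 0"
    by simp
  moreover have "eval_fps (\<Sum>j\<le>d. fps_of_poly (map_poly of_rat (p j)) * F ^ j) x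
      = (\<Sum>j\<le>d. poly (map_poly of_rat (p j)) x * eval_fps F x ^ j)"
  proof -
    have x1: "ereal (norm x) < R" if "R \<ge> 1" for R
      using x that by (intro less_le_trans[OF _ that]) simp
    have pw: "fps_conv_radius (F ^ j) \<ge> 1" for j
      using fps_conv_radius_power[of F j] conv unfolding F_def by (rule order_trans[rotated])
    have summand: "fps_conv_radius (fps_of_poly r * F ^ j) \<ge> 1" for r j
      using fps_conv_radius_mult[of "fps_of_poly r" "F ^ j"] pw[of j]
      by (simp add: min_def split: if_splits) 
    \<comment> \<open>The bound on the radius travels with the value: evaluating the sum of the
      first k terms plus the next one requires both to converge at \<open>x\<close>.\<close>
    have "fps_conv_radius (\<Sum>j<k. fps_of_poly (map_poly of_rat (p j)) * F ^ j) \<ge> 1 \<and>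
        eval_fps (\<Sum>j<k. fps_of_poly (map_poly of_rat (p j)) * F ^ j) x
      = (\<Sum>j<k. poly (map_poly of_rat (p j)) x * eval_fps F x ^ j)" for k
    proof (induction k)
      case (Suc k)
      let ?S = "\<Sum>j<k. fps_of_poly (map_poly of_rat (p j)) * F ^ j"
      let ?T = "fps_of_poly (map_poly of_rat (p k)) * F ^ k"
      have "1 \<le> min (fps_conv_radius ?S) (fps_conv_radius ?T)"
        using Suc summand by simp
      then have "fps_conv_radius (?S + ?T) \<ge> 1"
        using fps_conv_radius_add[of ?S ?T] by (rule order_trans)
      moreover have "eval_fps (?S + ?T) x = eval_fps ?S x + eval_fps ?T x"
        using Suc summand[of "map_poly of_rat (p k)" k] by (intro eval_fps_add x1) auto
      moreover have "eval_fps ?T x = poly (map_poly of_rat (p k)) x * eval_fps F x ^ k"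
        using pw[of k] pw[of 1] by (subst eval_fps_mult) (auto intro!: x1 eval_fps_power simp del: real_norm_def)
      ultimately show ?case using Suc by simp
    qed auto
    from this[of "Suc d"] show ?thesis by (simp add: lessThan_Suc_atMost)
  qed
  ultimately show ?thesis
    by (simp add: F_def eval_fps_def)
qed

lemma poly_order_at_0:
  fixes p :: "real poly"
  assumes "p \<noteq> 0"
  obtains k u where "\<And>t. poly p t = t ^ k * poly u t" "poly u 0 \<noteq> 0"
proof -
  from order_decomp[OF assms, of 0] obtain u where u: "p = [:- 0, 1:] ^ order 0 p * u" "\<not> [:- 0, 1:] dvd u"
    by blast
  have "poly p t = t ^ order 0 p * poly u t" for t
    by (subst u(1)) (simp add: poly_power)
  moreover have "poly u 0 \<noteq> 0" using u(2) by (simp add: poly_eq_0_iff_dvd)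
  ultimately show ?thesis using that by blast
qed

text \<open>Times t^(3d), the term for j has the order of t^(s j) L^j with s j = k j + 3 (d - j),
  where k j is the order of \<open>p j\<close> at 0. A smaller exponent of t wins because L stays
  below every negative power of t; among equal exponents the larger power of L wins because L tends
  to infinity. So the dominant term is unique and has a nonzero limit after normalisation.\<close>

lemma slow_factor_nonalgebraic:
  fixes L :: "real \<Rightarrow> real" and p :: "nat \<Rightarrow> real poly"
  assumes L_top: "filterlim L at_top (at_right 0)"
    and L_slow: "\<And>j. ((\<lambda>t. t * L t ^ j) \<longlongrightarrow> 0) (at_right 0)"
    and nz: "j0 \<le> d" "p j0 \<noteq> 0"
  shows "\<exists>\<^sub>F t in at_right 0. (\<Sum>j\<le>d. poly (p j) t * (L t / t ^ 3) ^ j) \<noteq> 0"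
proof (rule ccontr)
  assume "\<not> ?thesis"
  then have ev0: "\<forall>\<^sub>F t in at_right 0. (\<Sum>j\<le>d. poly (p j) t * (L t / t ^ 3) ^ j) = 0"
    by (simp add: frequently_def)
  define J where "J = {j. j \<le> d \<and> p j \<noteq> 0}"
  have J: "finite J" "J \<noteq> {}" "\<And>j. j \<in> J \<Longrightarrow> j \<le> d" using nz by (auto simp: J_def)
  have "\<exists>k u. (\<forall>t. poly (p j) t = t ^ k * poly u t) \<and> poly u 0 \<noteq> 0" if "j \<in> J" for j
    by (rule poly_order_at_0[of "p j"]) (use that in \<open>auto simp: J_def\<close>)
  then obtain k u where ku: "\<And>j t. j \<in> J \<Longrightarrow> poly (p j) t = t ^ k j * poly (u j) t"
      "\<And>j. j \<in> J \<Longrightarrow> poly (u j) 0 \<noteq> 0"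
    by metis
  define s where "s j = k j + 3 * (d - j)" for j
  define m where "m = Min (s ` J)"
  define J0 where "J0 = {j\<in>J. s j = m}"
  have "m \<in> s ` J" unfolding m_def using J by (intro Min_in) auto
  then have J0: "finite J0" "J0 \<noteq> {}" using J by (auto simp: J0_def)
  \<comment> \<open>The index of the dominant term: least exponent of t, then greatest exponent of
    L.\<close>
  define i where "i = Max J0"
  have i: "i \<in> J0" "\<And>j. j \<in> J0 \<Longrightarrow> j \<le> i" unfolding i_def using J0 by auto
  have sm: "s j \<ge> m" if "j \<in> J" for j unfolding m_def using J that by auto
  \<comment> \<open>The scaled j-th term divided by the size t^m L^i of the dominant one.\<close>
  define T where "T j t = t ^ (s j - m) * (L t ^ j / L t ^ i) * poly (u j) t" for j t
  have pos: "\<forall>\<^sub>F t in at_right 0. (t::real) > 0" by (rule eventually_at_right_less)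
  have L1: "\<forall>\<^sub>F t in at_right 0. L t \<ge> 1" using L_top by (simp add: filterlim_at_top)
  have poly_lim: "((\<lambda>t. poly (u j) t) \<longlongrightarrow> poly (u j) 0) (at_right 0)" for j
    by (intro tendsto_intros)
  have lim: "(T j \<longlongrightarrow> (if j = i then poly (u i) 0 else 0)) (at_right 0)" if jJ: "j \<in> J" for j
  proof -
    consider "j = i" | "j \<noteq> i" "s j = m" | "s j > m"
      using sm[OF jJ] by linarith
    then show ?thesis
    proof cases
      case 1
      have "\<forall>\<^sub>F t in at_right 0. poly (u i) t = T i t"
        using L1 by eventually_elim (use i(1) in \<open>auto simp: T_def J0_def\<close>)
      from tendsto_cong[OF this] poly_lim[of i] show ?thesis by (simp add: 1)
    next
      case 2
      then have "j < i" using i(2)[of j] jJ by (auto simp: J0_def)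
      have "filterlim (\<lambda>t. L t ^ (i - j)) at_top (at_right 0)"
        using L_top \<open>j < i\<close> by (intro filterlim_pow_at_top) auto
      then have "((\<lambda>t. inverse (L t ^ (i - j)) * poly (u j) t) \<longlongrightarrow> 0 * poly (u j) 0) (at_right 0)"
        by (intro tendsto_mult poly_lim tendsto_inverse_0_at_top)
      moreover have "\<forall>\<^sub>F t in at_right 0. inverse (L t ^ (i - j)) * poly (u j) t = T j t"
        using L1 by eventually_elim (use 2 \<open>j < i\<close> in \<open>auto simp: T_def power_diff field_simps\<close>)
      ultimately show ?thesis using 2 by (simp add: tendsto_cong)
    next
      \<comment> \<open>A single surplus factor t outweighs L^j; the denominator L^i is at least 1
        and is dropped.\<close>
      case 3
      then have "i \<noteq> j" using i(1) by (auto simp: J0_def)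
      have "((\<lambda>t. (t * L t ^ j) * \<bar>poly (u j) t\<bar>) \<longlongrightarrow> 0 * \<bar>poly (u j) 0\<bar>) (at_right 0)"
        by (intro tendsto_mult L_slow tendsto_rabs poly_lim)
      then have "((\<lambda>t. (t * L t ^ j) * \<bar>poly (u j) t\<bar>) \<longlongrightarrow> 0) (at_right 0)" by simp
      moreover have "\<forall>\<^sub>F t in at_right 0. t < (1::real)"
        by (intro eventually_at_right_field[THEN iffD2]) (auto intro: exI[of _ 1])
      then have "\<forall>\<^sub>F t in at_right 0. norm (T j t) \<le> (t * L t ^ j) * \<bar>poly (u j) t\<bar>"
        using L1 pos
      proof eventually_elim
        case (elim t)
        have "t ^ (s j - m) \<le> t ^ 1" using elim 3 by (intro power_decreasing) auto
        moreover have "L t ^ j / L t ^ i \<le> L t ^ j / 1" using elim by (intro divide_left_mono) auto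
        ultimately have "t ^ (s j - m) * (L t ^ j / L t ^ i) \<le> t * L t ^ j"
          using elim by (intro mult_mono) auto
        from mult_right_mono[OF this, of "\<bar>poly (u j) t\<bar>"] show ?case
          using elim by (simp add: T_def abs_mult power_abs)
      qed
      ultimately have "(T j \<longlongrightarrow> 0) (at_right 0)" by (rule Lim_null_comparison[rotated])
      then show ?thesis using \<open>i \<noteq> j\<close> by simp
    qed
  qed
  have "((\<lambda>t. \<Sum>j\<in>J. T j t) \<longlongrightarrow> (\<Sum>j\<in>J. if j = i then poly (u i) 0 else 0)) (at_right 0)"
    by (intro tendsto_sum lim)
  also have "(\<Sum>j\<in>J. if j = i then poly (u i) 0 else 0) = poly (u i) 0"
    using J i(1) by (simp add: J0_def)
  finally have lim_u: "((\<lambda>t. \<Sum>j\<in>J. T j t) \<longlongrightarrow> poly (u i) 0) (at_right 0)" .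
  have "\<forall>\<^sub>F t in at_right 0. (\<Sum>j\<in>J. T j t) = 0"
    using ev0 pos L1
  proof eventually_elim
    case (elim t)
    have "t ^ m * L t ^ i * (\<Sum>j\<in>J. T j t) = (\<Sum>j\<in>J. t ^ s j * L t ^ j * poly (u j) t)"
      unfolding sum_distrib_left
    proof (intro sum.cong refl)
      fix j assume "j \<in> J"
      have "t ^ s j = t ^ m * t ^ (s j - m)" using sm[OF \<open>j \<in> J\<close>] by (simp flip: power_add)
      then show "t ^ m * L t ^ i * T j t = t ^ s j * L t ^ j * poly (u j) t"
        using elim by (simp add: T_def)
    qed
    also have "\<dots> = (\<Sum>j\<in>J. t ^ (3 * d) * (poly (p j) t * (L t / t ^ 3) ^ j))"
    proof (intro sum.cong refl)
      fix j assume j: "j \<in> J"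
      have "t ^ (3 * d) = t ^ (3 * (d - j)) * (t ^ 3) ^ j"
        using J(3)[OF j] by (simp flip: power_mult power_add distrib_left)
      then show "t ^ s j * L t ^ j * poly (u j) t = t ^ (3 * d) * (poly (p j) t * (L t / t ^ 3) ^ j)"
        using elim by (simp add: ku(1)[OF j] s_def power_add power_divide)
    qed
    also have "\<dots> = t ^ (3 * d) * (\<Sum>j\<le>d. poly (p j) t * (L t / t ^ 3) ^ j)"
      unfolding sum_distrib_left by (intro sum.mono_neutral_left) (auto simp: J_def)
    finally show ?case using elim by simp
  qed
  then have "((\<lambda>t. \<Sum>j\<in>J. T j t) \<longlongrightarrow> 0) (at_right 0)" by (rule tendsto_eventually)
  with lim_u have "poly (u i) 0 = 0" by (intro tendsto_unique) auto
  with ku(2) i(1) show False by (auto simp: J0_def)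
qed

section \<open>Comparison series with polynomial coefficients\<close>

lemma binomial_series_sums:
  fixes x :: real
  assumes "\<bar>x\<bar> < 1"
  shows "(\<lambda>n. real ((n + k) choose k) * x ^ n) sums (1 / (1 - x) ^ Suc k)"
  using assms
proof (induction k arbitrary: x)
  case 0
  from geometric_sums[of x] 0 show ?case by simp
next
  case (Suc k)
  have "summable (\<lambda>n. norm (x ^ n))"
    using Suc.prems by (simp add: norm_power summable_geometric power_abs)
  moreover have "summable (\<lambda>n. norm (real ((n + k) choose k) * x ^ n))"
    using sums_summable[OF Suc.IH[of "\<bar>x\<bar>"]] Suc.prems by (simp add: abs_mult power_abs)
  \<comment> \<open>One more factor 1/(1 - x) is a Cauchy product with the geometric series; on
    coefficients it is the hockey-stick sum of binomials.\<close>
  ultimately have "(\<lambda>n. \<Sum>i\<le>n. (real ((i + k) choose k) * x ^ i) * x ^ (n - i))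
      sums ((\<Sum>n. real ((n + k) choose k) * x ^ n) * (\<Sum>n. x ^ n))"
    by (intro Cauchy_product_sums)
  moreover have "(\<Sum>i\<le>n. (real ((i + k) choose k) * x ^ i) * x ^ (n - i))
      = real ((n + Suc k) choose Suc k) * x ^ n" for n
  proof -
    have "(\<Sum>i\<le>n. (real ((i + k) choose k) * x ^ i) * x ^ (n - i))
        = (\<Sum>i\<le>n. real ((k + i) choose k) * x ^ n)"
      by (intro sum.cong) (auto simp: mult.assoc add.commute simp flip: power_add)
    also have "\<dots> = real (\<Sum>i\<le>n. (k + i) choose k) * x ^ n"
      by (simp add: sum_distrib_right)
    finally show ?thesis
      by (simp only: choose_rising_sum(1)) (simp add: add_ac)
  qed
  ultimately show ?case
    using sums_unique[OF Suc.IH[OF Suc.prems], symmetric] suminf_geometric[of x] Suc.prems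
    by (simp del: binomial_Suc_Suc add: mult.commute)
qed

lemma real_choose_2: "real ((n + 2) choose 2) = (real n + 1) * (real n + 2) / 2"
  by (induction n) (simp_all add: numeral_2_eq_2 field_simps)

lemma real_choose_3: "real ((n + 3) choose 3) = (real n + 1) * (real n + 2) * (real n + 3) / 6"
proof (induction n)
  case (Suc n)
  have "(Suc n + 3) choose 3 = ((n + 3) choose 3) + ((Suc n + 2) choose 2)"
    by (simp add: eval_nat_numeral)
  then have "real ((Suc n + 3) choose 3) = real ((n + 3) choose 3) + real ((Suc n + 2) choose 2)"
    by simp
  then show ?case
    unfolding Suc real_choose_2 by (simp add: field_simps)
qed simp

text \<open>Binomial coefficients take the place of powers of n because their generating functions
  are exactly 1/t^3 and 1/t^4. The additive constant in \<open>lower\<close> contributes only order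
  1/t, which is negligible against 1/t^3.\<close>

lemma transcendental_series_criterion:
  fixes a :: "nat \<Rightarrow> nat"
  assumes lower: "\<And>M. \<exists>M'. \<forall>n. M * real ((n + 2) choose 2) - M' \<le> real (a n)"
    and upper: "\<And>n. real (a n) \<le> C * (real n + 1) ^ 2 * (1 + ln (real n + 1))"
  shows "transcendental_series (Abs_fps (\<lambda>n. of_nat (a n)))"
proof -
  define f where "f x = (\<Sum>n. real (a n) * x ^ n)" for x :: real
  define L where "L t = t ^ 3 * f (1 - t)" for t
  have C: "C \<ge> 0" using upper[of 0] by simp
  have choose2: "(real n + 1) ^ 2 \<le> 2 * real ((n + 2) choose 2)" for n
    unfolding real_choose_2 by (simp add: power2_eq_square algebra_simps)
  have choose3: "(real n + 1) ^ 3 \<le> 6 * real ((n + 3) choose 3)" for n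
    unfolding real_choose_3 by (simp add: power3_eq_cube algebra_simps)
  \<comment> \<open>As ln (n + 1) = ln (t (n + 1)) - ln t and ln u \<le> u, the logarithm is at most
    t (n + 1) - ln t. The cubic coefficients created in this way carry a factor t, so their series t
    / t^4 is again of order 1/t^3.\<close>
  have bound: "real (a n) \<le> C * (2 * (1 - ln t)) * real ((n + 2) choose 2) + 6 * C * t * real ((n + 3) choose 3)"
    if "0 < t" "t \<le> 1" for n t
  proof -
    have "ln (t * (real n + 1)) \<le> t * (real n + 1)"
      using that ln_le_minus_one[of "t * (real n + 1)"] by simp
    then have "1 + ln (real n + 1) \<le> (1 - ln t) + t * (real n + 1)"
      using that by (simp add: ln_mult)
    then have "real (a n) \<le> C * (real n + 1) ^ 2 * ((1 - ln t) + t * (real n + 1))"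
      using C by (intro order_trans[OF upper] mult_left_mono) auto
    also have "\<dots> = C * (1 - ln t) * (real n + 1) ^ 2 + C * t * (real n + 1) ^ 3"
      by (simp add: algebra_simps power2_eq_square power3_eq_cube)
    also have "\<dots> \<le> C * (1 - ln t) * (2 * real ((n + 2) choose 2)) + C * t * (6 * real ((n + 3) choose 3))"
      using that C by (intro add_mono mult_left_mono choose2 choose3 mult_nonneg_nonneg)
        (auto intro: order_trans[OF ln_le_minus_one])
    finally show ?thesis by (simp only: mult_ac)
  qed
  have major: "(\<lambda>n. (C * (2 * (1 - ln t)) * real ((n + 2) choose 2) + 6 * C * t * real ((n + 3) choose 3)) * (1 - t) ^ n)
       sums (C * (2 * (1 - ln t)) * (1 / t ^ 3) + 6 * C * t * (1 / t ^ 4))" if "0 < t" "t \<le> 1" for t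
    using sums_add[OF sums_mult[OF binomial_series_sums[of "1 - t" 2], of "C * (2 * (1 - ln t))"]
        sums_mult[OF binomial_series_sums[of "1 - t" 3], of "6 * C * t"]] that
    by (simp add: algebra_simps eval_nat_numeral)
  have summable: "summable (\<lambda>n. real (a n) * (1 - t) ^ n)" if "0 < t" "t \<le> 1" for t
  proof (rule summable_comparison_test'[OF sums_summable[OF major[OF that]]])
    fix n
    have "norm (real (a n) * (1 - t) ^ n) = real (a n) * (1 - t) ^ n"
      using that by simp
    then show "norm (real (a n) * (1 - t) ^ n)
        \<le> (C * (2 * (1 - ln t)) * real ((n + 2) choose 2) + 6 * C * t * real ((n + 3) choose 3)) * (1 - t) ^ n"
      using that mult_right_mono[OF bound[OF that]] by (simp del: binomial_Suc_Suc)
  qed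
  have L_le: "L t \<le> C * (8 - 2 * ln t)" if "0 < t" "t \<le> 1" for t
  proof -
    have "f (1 - t) \<le> C * (2 * (1 - ln t)) * (1 / t ^ 3) + 6 * C * t * (1 / t ^ 4)"
      unfolding f_def sums_unique[OF major[OF that]]
      using that by (intro suminf_le summable sums_summable[OF major] mult_right_mono bound) auto
    then have "L t \<le> t ^ 3 * (C * (2 * (1 - ln t)) * (1 / t ^ 3) + 6 * C * t * (1 / t ^ 4))"
      unfolding L_def using that by (intro mult_left_mono) auto
    also have "\<dots> = C * (8 - 2 * ln t)"
      using that by (simp add: field_simps eval_nat_numeral)
    finally show ?thesis .
  qed
  have L_ge0: "L t \<ge> 0" if "0 < t" "t \<le> 1" for t
    unfolding L_def f_def using that by (intro mult_nonneg_nonneg suminf_nonneg summable) auto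
  have small: "\<forall>\<^sub>F t in at_right (0::real). 0 < t \<and> t < 1"
    by (intro eventually_at_right_field[THEN iffD2]) (auto intro: exI[of _ 1])
  have L_slow: "((\<lambda>t. t * L t ^ j) \<longlongrightarrow> 0) (at_right 0)" for j
  proof (rule Lim_null_comparison)
    show "\<forall>\<^sub>F t in at_right 0. norm (t * L t ^ j) \<le> t * (C * (8 - 2 * ln t)) ^ j"
      using small
      by eventually_elim (use L_le L_ge0 in \<open>auto simp: abs_mult intro!: power_mono\<close>)
    \<comment> \<open>With s = - ln t the factor t is exp (- s), which beats s^j. The 3 comes from 8
      - 2 ln t \<le> 3 (- ln t), valid once - ln t \<ge> 8.\<close>
    have "((\<lambda>s::real. 3 ^ j * (s ^ j / exp s)) \<longlongrightarrow> 3 ^ j * 0) at_top"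
      by (intro tendsto_mult tendsto_const tendsto_power_div_exp_0)
    note lim = this
    have s_top: "filterlim (\<lambda>t::real. - ln t) at_top (at_right 0)"
      using ln_at_0 by (simp add: filterlim_uminus_at_top)
    have *: "((\<lambda>t::real. 3 ^ j * ((- ln t) ^ j / exp (- ln t))) \<longlongrightarrow> 0) (at_right 0)"
      using filterlim_compose[OF lim s_top] by (simp only: mult_zero_right)
    have "\<forall>\<^sub>F t in at_right (0::real). - ln t \<ge> 8"
      using s_top by (simp add: filterlim_at_top)
    then have "\<forall>\<^sub>F t in at_right (0::real). norm (t * (8 - 2 * ln t) ^ j) \<le> 3 ^ j * ((- ln t) ^ j / exp (- ln t))"
      using small
    proof eventually_elim
      case (elim t)
      then have "(8 - 2 * ln t) ^ j \<le> (3 * - ln t) ^ j" by (intro power_mono) auto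
      then have "t * (8 - 2 * ln t) ^ j \<le> t * (3 * - ln t) ^ j"
        using elim by (intro mult_left_mono) auto
      moreover have "norm (t * (8 - 2 * ln t) ^ j) = t * (8 - 2 * ln t) ^ j"
        using elim by (simp add: abs_mult)
      moreover have "exp (- ln t) = 1 / t" using elim by (simp add: exp_minus field_simps)
      ultimately show ?case by (simp only: power_mult_distrib) (simp add: mult_ac)
    qed
    from Lim_null_comparison[OF this *]
    have "((\<lambda>t::real. t * (8 - 2 * ln t) ^ j) \<longlongrightarrow> 0) (at_right 0)" .
    from tendsto_mult_left[OF this, of "C ^ j"]
    show "((\<lambda>t. t * (C * (8 - 2 * ln t)) ^ j) \<longlongrightarrow> 0) (at_right 0)"
      by (simp add: power_mult_distrib mult_ac)
  qed
  have L_top: "filterlim L at_top (at_right 0)"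
    unfolding filterlim_at_top
  proof
    fix M :: real
    \<comment> \<open>Asking for M + 1 leaves room for the error M' t^2, which eventually drops
      below 1.\<close>
    obtain M' where M': "\<And>n. (M + 1) * real ((n + 2) choose 2) - M' \<le> real (a n)"
      using lower[of "M + 1"] by blast
    have "M + 1 - M' * t ^ 2 \<le> L t" if "0 < t" "t < 1" for t
    proof -
      have s: "(\<lambda>n. ((M + 1) * real ((n + 2) choose 2) - M') * (1 - t) ^ n) sums ((M + 1) * (1 / t ^ 3) - M' * (1 / t))"
        using sums_diff[OF sums_mult[OF binomial_series_sums[of "1 - t" 2], of "M + 1"]
            sums_mult[OF geometric_sums[of "1 - t"], of "M'"]] that
        by (simp add: algebra_simps eval_nat_numeral)
      have "(M + 1) * (1 / t ^ 3) - M' * (1 / t) \<le> f (1 - t)"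
        unfolding f_def sums_unique[OF s] using that
        by (intro suminf_le summable sums_summable[OF s] mult_right_mono M') auto
      then have "t ^ 3 * ((M + 1) * (1 / t ^ 3) - M' * (1 / t)) \<le> L t"
        unfolding L_def using that by (intro mult_left_mono) auto
      moreover have "t ^ 3 * ((M + 1) * (1 / t ^ 3) - M' * (1 / t)) = M + 1 - M' * t ^ 2"
        using that by (simp add: right_diff_distrib power3_eq_cube power2_eq_square)
      ultimately show ?thesis by simp
    qed
    then have "\<forall>\<^sub>F t in at_right 0. M + 1 - M' * t ^ 2 \<le> L t"
      using small by (auto elim: eventually_mono)
    moreover have "((\<lambda>t::real. M + 1 - M' * t ^ 2) \<longlongrightarrow> M + 1 - M' * 0 ^ 2) (at_right 0)"
      by (intro tendsto_intros)
    then have "\<forall>\<^sub>F t in at_right (0::real). M < M + 1 - M' * t ^ 2"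
      by (rule order_tendstoD) simp
    ultimately show "\<forall>\<^sub>F t in at_right 0. M \<le> L t"
      by eventually_elim simp
  qed
  show ?thesis
    unfolding transcendental_series_def
  proof
    assume "algebraic_over rational_functions (fps_to_fls (Abs_fps (\<lambda>n. of_nat (a n) :: rat)))"
    then obtain p :: "nat \<Rightarrow> rat poly" and d j
      where j: "j \<le> d" "p j \<noteq> 0"
        and rel: "(\<Sum>j\<le>d. fps_of_poly (p j) * Abs_fps (\<lambda>n. of_nat (a n)) ^ j) = 0"
      by (rule algebraic_over_rational_functionsE)
    have conv: "fps_conv_radius (Abs_fps (\<lambda>n. real (a n))) \<ge> 1"
      unfolding fps_conv_radius_def
    proof (rule conv_radius_geI_ex)
      fix r :: real assume r: "0 < r" "ereal r < 1"
      then show "\<exists>z. norm z = r \<and> summable (\<lambda>n. fps_nth (Abs_fps (\<lambda>n. real (a n))) n * z ^ n)"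
        using summable[of "1 - r"] by (intro exI[of _ r]) auto
    qed
    \<comment> \<open>The substitution x = 1 - t moves the singular point x = 1 to t = 0, where the
      orders of vanishing are compared.\<close>
    define q :: "nat \<Rightarrow> real poly" where "q j = pcompose (map_poly of_rat (p j)) [:1, -1:]" for j
    have "q j \<noteq> 0"
      using j(2) by (simp add: q_def pcompose_eq_0_iff map_poly_eq_0_iff)
    from slow_factor_nonalgebraic[where p = q, OF L_top L_slow j(1) this]
    have "\<exists>\<^sub>F t in at_right 0. (\<Sum>j\<le>d. poly (q j) t * (L t / t ^ 3) ^ j) \<noteq> 0 \<and> 0 < t \<and> t < 1"
      using small by (rule frequently_eventually_frequently)
    then obtain t where t: "(\<Sum>j\<le>d. poly (q j) t * (L t / t ^ 3) ^ j) \<noteq> 0" "0 < t" "t < 1"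
      by (auto dest: frequently_ex)
    have "L t / t ^ 3 = f (1 - t)" using t by (simp add: L_def)
    moreover have "(\<Sum>j\<le>d. poly (map_poly of_rat (p j)) (1 - t) * f (1 - t) ^ j) = 0"
      unfolding f_def using t by (intro eval_poly_relation[OF rel conv]) auto
    ultimately show False using t(1) by (simp add: q_def poly_pcompose)
  qed
qed

section \<open>Sums of greatest common divisors\<close>

definition gcd_sum :: "nat \<Rightarrow> nat" where
  "gcd_sum m = (\<Sum>i=1..m. \<Sum>j=1..m. gcd i j)"

lemma card_multiples: "d > 0 \<Longrightarrow> card {i\<in>{1..m::nat}. d dvd i} = m div d"
proof -
  assume d: "d > 0"
  have "{i\<in>{1..m}. d dvd i} = (\<lambda>k. d * k) ` {1..m div d}"
    using d by (auto simp: less_eq_div_iff_mult_less_eq mult.commute elim!: dvdE)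
  then show ?thesis
    using d by (simp add: card_image inj_on_def)
qed

text \<open>Summing over d last, the pairs of multiples of d number (m div d)^2. Used with h =
  \<open>totient\<close>, where the inner sum is the gcd itself, and with h d = d, where it bounds
  the gcd from above.\<close>

lemma sum_over_common_divisors:
  fixes h :: "nat \<Rightarrow> nat"
  shows "(\<Sum>i=1..m. \<Sum>j=1..m. \<Sum>d | d dvd gcd i j. h d) = (\<Sum>d=1..m. h d * (m div d)\<^sup>2)"
proof -
  have "(\<Sum>d | d dvd gcd i j. h d) = (\<Sum>d=1..m. h d * (of_bool (d dvd i) * of_bool (d dvd j)))"
    if "i \<in> {1..m}" "j \<in> {1..m}" for i j
  proof -
    have "{d. d dvd gcd i j} = {d\<in>{1..m}. d dvd i \<and> d dvd j}"
      using that by (auto intro: Suc_leI dvd_pos_nat dest: dvd_imp_le)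
    then have "(\<Sum>d | d dvd gcd i j. h d) = (\<Sum>d=1..m. if d dvd i \<and> d dvd j then h d else 0)"
      by (simp only:) (intro sum.inter_filter, simp)
    also have "\<dots> = (\<Sum>d=1..m. h d * (of_bool (d dvd i) * of_bool (d dvd j)))"
      by (intro sum.cong) auto
    finally show ?thesis .
  qed
  then have "(\<Sum>i=1..m. \<Sum>j=1..m. \<Sum>d | d dvd gcd i j. h d)
      = (\<Sum>i=1..m. \<Sum>j=1..m. \<Sum>d=1..m. h d * (of_bool (d dvd i) * of_bool (d dvd j)))"
    by (intro sum.cong[OF refl] sum.cong[OF refl, of "{1..m}"])
  also have "\<dots> = (\<Sum>i=1..m. \<Sum>d=1..m. \<Sum>j=1..m. h d * (of_bool (d dvd i) * of_bool (d dvd j)))"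
    by (intro sum.cong refl sum.swap)
  also have "\<dots> = (\<Sum>d=1..m. \<Sum>i=1..m. \<Sum>j=1..m. h d * (of_bool (d dvd i) * of_bool (d dvd j)))"
    by (rule sum.swap)
  also have "\<dots> = (\<Sum>d=1..m. h d * ((\<Sum>i=1..m. of_bool (d dvd i)) * (\<Sum>j=1..m. of_bool (d dvd j))))"
    unfolding sum_product by (simp only: sum_distrib_left)
  also have "\<dots> = (\<Sum>d=1..m. h d * (m div d)\<^sup>2)"
  proof (intro sum.cong refl)
    fix d assume "d \<in> {1..m}"
    then have "(\<Sum>i=1..m. of_bool (d dvd i)) = m div d"
      using card_multiples[of d m] by (simp add: sum.inter_filter[symmetric] of_bool_def)
    then show "h d * ((\<Sum>i=1..m. of_bool (d dvd i)) * (\<Sum>j=1..m. of_bool (d dvd j))) = h d * (m div d)\<^sup>2"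
      by (simp add: power2_eq_square)
  qed
  finally show ?thesis .
qed

text \<open>The gcd is one of its own divisors, hence at most their sum; with weight d the squares
  (m/d)^2 then turn into the harmonic sum.\<close>

lemma gcd_sum_le_harm: "real (gcd_sum m) \<le> real m ^ 2 * harm m"
proof -
  have "gcd_sum m \<le> (\<Sum>i=1..m. \<Sum>j=1..m. \<Sum>d | d dvd gcd i j. d)"
    unfolding gcd_sum_def
    by (intro sum_mono member_le_sum) auto
  also have "\<dots> = (\<Sum>d=1..m. d * (m div d)\<^sup>2)"
    by (rule sum_over_common_divisors)
  finally have "real (gcd_sum m) \<le> real (\<Sum>d=1..m. d * (m div d)\<^sup>2)"
    by (rule of_nat_mono)
  also have "\<dots> = (\<Sum>d=1..m. real d * real (m div d) ^ 2)"
    by simp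
  also have "\<dots> \<le> (\<Sum>d=1..m. real d * (real m / real d) ^ 2)"
    by (intro sum_mono mult_left_mono power_mono of_nat_div_le_of_nat) auto
  also have "\<dots> = real m ^ 2 * harm m"
    unfolding harm_def sum_distrib_left by (intro sum.cong) (auto simp: field_simps power2_eq_square)
  finally show ?thesis .
qed

lemma harm_le_ln: "harm n \<le> 1 + ln (real n + 1)"
proof (cases n)
  case (Suc k)
  have "harm (Suc k) \<le> 1 + ln (real (Suc k))" for k :: nat
  proof (induction k)
    case (Suc k)
    \<comment> \<open>In this step the logarithm gains at least as much as the harmonic sum.\<close>
    have "ln (real (Suc k) / real (Suc (Suc k))) \<le> real (Suc k) / real (Suc (Suc k)) - 1"
      by (intro ln_le_minus_one) auto
    also have "\<dots> = - inverse (real (Suc (Suc k)))"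
      by (simp add: field_simps)
    finally show ?case
      using Suc by (simp add: harm_Suc[of "Suc k"] ln_div del: of_nat_Suc)
  qed (simp add: harm_expand)
  from this[of k] show ?thesis
    using Suc by (smt (verit) ln_mono of_nat_0_less_iff zero_less_Suc)
qed (simp add: harm_expand)

lemma sum_inverse_squares_le: "(\<Sum>k=1..m. 1 / real k ^ 2) \<le> 2"
proof -
  \<comment> \<open>The correction term makes the induction telescope, since 1/k^2 \<le> 1/(k - 1) -
    1/k.\<close>
  have "(\<Sum>k=1..Suc m. 1 / real k ^ 2) \<le> 2 - 1 / real (Suc m)" for m
  proof (induction m)
    case (Suc m)
    have "1 / real (Suc (Suc m)) ^ 2 \<le> 1 / real (Suc m) - 1 / real (Suc (Suc m))"
      by (simp add: divide_simps power2_eq_square)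
    with Suc show ?case by (simp del: of_nat_Suc)
  qed simp
  then show ?thesis
    by (cases m) (simp, smt (verit) divide_nonneg_nonneg of_nat_0_le_iff)
qed

text \<open>Multiplying by \<open>\<Sum> 1/m\<^sup>2 \<le> 2\<close> and collecting the terms with \<open>d m = k\<close> gives the harmonic sum,
  because \<open>\<Sum>\<^bsub>d | k\<^esub> \<phi>(d) = k\<close>.\<close>

lemma sum_totient_div_square_ge: "harm n / 2 \<le> (\<Sum>d=1..n. real (totient d) / real d ^ 2)"
proof -
  have "harm n = (\<Sum>k=1..n. \<Sum>d | d dvd k. real (totient d) / real k ^ 2)"
    unfolding harm_def
  proof (intro sum.cong refl)
    fix k assume "k \<in> {1..n}"
    have "(\<Sum>d | d dvd k. real (totient d) / real k ^ 2) = real (\<Sum>d | d dvd k. totient d) / real k ^ 2"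
      by (simp add: sum_divide_distrib)
    with \<open>k \<in> {1..n}\<close> show "inverse (real k) = (\<Sum>d | d dvd k. real (totient d) / real k ^ 2)"
      by (simp add: totient_divisor_sum power2_eq_square field_simps)
  qed
  also have "\<dots> = (\<Sum>(k, d) \<in> (SIGMA k:{1..n}. {d. d dvd k}). real (totient d) / real k ^ 2)"
    by (intro sum.Sigma) auto
  also have "\<dots> = (\<Sum>(d, m) \<in> (\<lambda>(k, d). (d, k div d)) ` (SIGMA k:{1..n}. {d. d dvd k}).
                      real (totient d) / real d ^ 2 * (1 / real m ^ 2))"
    by (subst sum.reindex)
       (auto simp: inj_on_def real_of_nat_div power_divide power_mult_distrib elim!: dvdE intro!: sum.cong)
  also have "\<dots> \<le> (\<Sum>(d, m) \<in> {1..n} \<times> {1..n}. real (totient d) / real d ^ 2 * (1 / real m ^ 2))"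
  proof (rule sum_mono2)
    show "(\<lambda>(k, d). (d, k div d)) ` (SIGMA k:{1..n}. {d. d dvd k}) \<subseteq> {1..n} \<times> {1..n}"
    proof
      fix p assume "p \<in> (\<lambda>(k, d). (d, k div d)) ` (SIGMA k:{1..n}. {d. d dvd k})"
      then obtain k d where p: "p = (d, k div d)" and k: "k \<in> {1..n}" and d: "d dvd k"
        by auto
      from k d have "d \<le> k" "d > 0" by (auto dest: dvd_imp_le intro: dvd_pos_nat)
      with k show "p \<in> {1..n} \<times> {1..n}"
        using le_trans[OF div_le_dividend[of k d]] by (auto simp: p Suc_le_eq div_greater_zero_iff)
    qed
  qed auto
  also have "\<dots> = (\<Sum>d=1..n. real (totient d) / real d ^ 2) * (\<Sum>m=1..n. 1 / real m ^ 2)"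
    by (simp add: sum_product sum.cartesian_product)
  also have "\<dots> \<le> (\<Sum>d=1..n. real (totient d) / real d ^ 2) * 2"
    by (intro mult_left_mono sum_inverse_squares_le sum_nonneg) auto
  finally show ?thesis by simp
qed

text \<open>The 8 is 4 * 2: rounding costs a factor 2 through m div d \<ge> m / (2 d) for d \<le> m,
  which is then squared, and \<open>sum_totient_div_square_ge\<close> costs another 2.\<close>

lemma gcd_sum_ge_harm: "real m ^ 2 * harm m / 8 \<le> real (gcd_sum m)"
proof -
  have "gcd_sum m = (\<Sum>i=1..m. \<Sum>j=1..m. \<Sum>d | d dvd gcd i j. totient d)"
    unfolding gcd_sum_def by (simp only: totient_divisor_sum)
  also have "\<dots> = (\<Sum>d=1..m. totient d * (m div d)\<^sup>2)"
    by (rule sum_over_common_divisors)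
  finally have eq: "real (gcd_sum m) = (\<Sum>d=1..m. real (totient d) * real (m div d) ^ 2)"
    by simp
  have "real m ^ 2 / 4 * (harm m / 2) \<le> real m ^ 2 / 4 * (\<Sum>d=1..m. real (totient d) / real d ^ 2)"
    by (intro mult_left_mono sum_totient_div_square_ge) auto
  also have "\<dots> = (\<Sum>d=1..m. real (totient d) * (real m / (2 * real d)) ^ 2)"
    unfolding sum_distrib_left by (intro sum.cong) (auto simp: power_divide power_mult_distrib)
  also have "\<dots> \<le> real (gcd_sum m)"
    unfolding eq
  proof (intro sum_mono mult_left_mono power_mono)
    fix d assume d: "d \<in> {1..m}"
    then have "m div d \<ge> 1" by (simp add: Suc_le_eq div_greater_zero_iff)
    then have "1 * d \<le> m div d * d" by (rule mult_le_mono1)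
    moreover have "m < d + m div d * d"
      using d by (intro dividend_less_div_times) auto
    ultimately have "m \<le> 2 * (m div d) * d"
      by linarith
    then have "real m \<le> 2 * real (m div d) * real d"
      by (metis of_nat_le_iff of_nat_mult of_nat_numeral)
    with d show "real m / (2 * real d) \<le> real (m div d)"
      by (simp add: field_simps)
  qed auto
  finally show ?thesis by simp
qed

section \<open>Torsion-free finitely generated abelian groups\<close>

context comm_group
begin

text \<open>The generators form a family over a fixed index set rather than a set of elements: a
  change of generators then alters \<open>Y\<close> and leaves \<open>I\<close> alone, even if two
  members become equal.\<close>

definition int_comb :: "'i set \<Rightarrow> ('i \<Rightarrow> 'a) \<Rightarrow> ('i \<Rightarrow> int) \<Rightarrow> 'a" where
  "int_comb I Y e = (\<Otimes>i\<in>I. Y i [^] e i)"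

lemma int_comb_closed [simp]: "Y \<in> I \<rightarrow> carrier G \<Longrightarrow> int_comb I Y e \<in> carrier G"
  unfolding int_comb_def by (intro finprod_closed) auto

lemma int_comb_add:
  "Y \<in> I \<rightarrow> carrier G \<Longrightarrow> int_comb I Y (\<lambda>i. e i + f i) = int_comb I Y e \<otimes> int_comb I Y f"
proof -
  assume Y: "Y \<in> I \<rightarrow> carrier G"
  have "int_comb I Y (\<lambda>i. e i + f i) = (\<Otimes>i\<in>I. Y i [^] e i \<otimes> Y i [^] f i)"
    unfolding int_comb_def using Y by (intro finprod_cong') (auto intro!: int_pow_mult)
  also have "\<dots> = int_comb I Y e \<otimes> int_comb I Y f"
    unfolding int_comb_def using Y by (intro finprod_multf) auto
  finally show ?thesis .
qed

lemma int_comb_remove: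
  "finite I \<Longrightarrow> i \<in> I \<Longrightarrow> Y \<in> I \<rightarrow> carrier G \<Longrightarrow>
     int_comb I Y e = Y i [^] e i \<otimes> int_comb (I - {i}) Y e"
proof -
  assume *: "finite I" "i \<in> I" "Y \<in> I \<rightarrow> carrier G"
  have "int_comb (insert i (I - {i})) Y e = Y i [^] e i \<otimes> int_comb (I - {i}) Y e"
    unfolding int_comb_def using * by (intro finprod_insert) auto
  then show ?thesis using * by (simp add: insert_absorb)
qed

lemma int_comb_cong:
  "I = J \<Longrightarrow> Y \<in> J \<rightarrow> carrier G \<Longrightarrow> (\<And>i. i \<in> J \<Longrightarrow> Z i = Y i) \<Longrightarrow> (\<And>i. i \<in> J \<Longrightarrow> e i = f i)
     \<Longrightarrow> int_comb I Z e = int_comb J Y f"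
  unfolding int_comb_def by (intro finprod_cong') auto

lemma int_comb_eq_one: "(\<And>i. i \<in> I \<Longrightarrow> Y i [^] e i = \<one>) \<Longrightarrow> int_comb I Y e = \<one>"
  unfolding int_comb_def by (intro finprod_one_eqI) auto

lemma int_comb_single:
  assumes "finite I" "i \<in> I" "Y \<in> I \<rightarrow> carrier G"
  shows "int_comb I Y (\<lambda>j. if j = i then k else 0) = Y i [^] k"
proof -
  have "int_comb (I - {i}) Y (\<lambda>j. if j = i then k else 0) = \<one>"
    by (intro int_comb_eq_one) auto
  moreover have "Y i \<in> carrier G" using assms by auto
  ultimately show ?thesis
    by (subst int_comb_remove[OF assms]) simp
qed

lemma int_comb_neg:
  assumes "Y \<in> I \<rightarrow> carrier G"
  shows "int_comb I Y (\<lambda>i. - e i) = inv (int_comb I Y e)"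
proof (rule inv_equality[symmetric])
  have "int_comb I Y (\<lambda>i. - e i + e i) = \<one>"
    by (intro int_comb_eq_one) auto
  then show "int_comb I Y (\<lambda>i. - e i) \<otimes> int_comb I Y e = \<one>"
    by (simp only: int_comb_add[OF assms])
qed (use assms in auto)

lemma generate_int_comb:
  assumes S: "finite S" "S \<subseteq> carrier G" and x: "x \<in> generate G S"
  obtains e where "x = int_comb S (\<lambda>s. s) e"
proof -
  have id: "(\<lambda>s. s) \<in> S \<rightarrow> carrier G" using S by auto
  have "\<exists>e. x = int_comb S (\<lambda>s. s) e"
    using x
  proof (induction rule: generate.induct)
    case one
    have "int_comb S (\<lambda>s. s) (\<lambda>_. 0) = \<one>" by (intro int_comb_eq_one) auto
    from this[symmetric] show ?case by blast
  next
    case (incl h)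
    then have "int_comb S (\<lambda>s. s) (\<lambda>j. if j = h then 1 else 0) = h"
      using S int_comb_single[OF S(1) incl id, of 1] by auto
    from this[symmetric] show ?case by blast
  next
    case (inv h)
    then have "int_comb S (\<lambda>s. s) (\<lambda>j. if j = h then -1 else 0) = inv h"
      using S int_comb_single[OF S(1) inv id, of "-1"] by (auto simp: int_pow_neg)
    from this[symmetric] show ?case by blast
  next
    case (eng g h)
    then obtain e f where "g = int_comb S (\<lambda>s. s) e" "h = int_comb S (\<lambda>s. s) f" by blast
    then have "g \<otimes> h = int_comb S (\<lambda>s. s) (\<lambda>i. e i + f i)"
      by (simp only: int_comb_add[OF id])
    then show ?case by blast
  qed
  then show ?thesis using that by blast
qed

text \<open>Expanding the power of the new j-th generator hands its Y i-part over to coordinate i.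
  The change of exponents is undone by subtracting c * v j first, so a spanning family stays
  spanning.\<close>

lemma int_comb_nielsen_move:
  assumes I: "finite I" "i \<in> I" "j \<in> I" "i \<noteq> j" and Y: "Y \<in> I \<rightarrow> carrier G"
  shows "int_comb I (Y(j := Y j \<otimes> Y i [^] c)) v = int_comb I Y (v(i := v i + c * v j))"
proof -
  let ?Y = "Y(j := Y j \<otimes> Y i [^] c)"
  have Yc: "Y i \<in> carrier G" "Y j \<in> carrier G" using I Y by auto
  then have Y': "?Y \<in> I \<rightarrow> carrier G" using Y by auto
  have rest: "int_comb (I - {j}) ?Y v = int_comb (I - {j}) Y v"
    using Y by (intro int_comb_cong) auto
  have "v(i := v i + c * v j) = (\<lambda>k. v k + (if k = i then c * v j else 0))" by auto
  then have "int_comb I Y (v(i := v i + c * v j)) = int_comb I Y v \<otimes> Y i [^] (c * v j)"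
    using int_comb_single[OF I(1,2) Y] by (simp only: int_comb_add[OF Y])
  also have "int_comb I Y v = Y j [^] v j \<otimes> int_comb (I - {j}) Y v"
    using I Y by (intro int_comb_remove) auto
  also have "Y j [^] v j \<otimes> int_comb (I - {j}) Y v \<otimes> Y i [^] (c * v j)
      = (Y j [^] v j \<otimes> Y i [^] (c * v j)) \<otimes> int_comb (I - {j}) Y v"
  proof -
    have "Y j [^] v j \<in> carrier G" "Y i [^] (c * v j) \<in> carrier G" "int_comb (I - {j}) Y v \<in> carrier G"
      using Yc Y by (auto intro: int_comb_closed)
    then show ?thesis by (simp add: m_ac)
  qed
  also have "Y j [^] v j \<otimes> Y i [^] (c * v j) = ?Y j [^] v j"
    using Yc by (simp add: int_pow_distrib int_pow_pow mult.commute)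
  also have "?Y j [^] v j \<otimes> int_comb (I - {j}) Y v = int_comb I ?Y v"
    using rest int_comb_remove[OF I(1,3) Y'] by simp
  finally show ?thesis ..
qed

text \<open>With the number of generators minimal, a nontrivial relation could be shortened by Nielsen
  moves until it says that a power of a single generator is trivial; torsion-freeness
  then makes that generator superfluous.\<close>

lemma torsion_free_basis:
  assumes S: "finite S" "S \<subseteq> carrier G" "generate G S = carrier G"
    and tf: "\<forall>x\<in>carrier G. \<forall>n::int. x [^] n = \<one> \<longrightarrow> n \<noteq> 0 \<longrightarrow> x = \<one>"
  obtains I :: "'a set" and Y where "finite I" "Y \<in> I \<rightarrow> carrier G"
    "\<forall>x\<in>carrier G. \<exists>e. x = int_comb I Y e"
    "\<forall>e. int_comb I Y e = \<one> \<longrightarrow> (\<forall>i\<in>I. e i = 0)"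
proof -
  define spans where "spans I Y \<longleftrightarrow> finite I \<and> Y \<in> I \<rightarrow> carrier G \<and> (\<forall>x\<in>carrier G. \<exists>e. x = int_comb I Y e)"
    for I :: "'a set" and Y
  have "spans S (\<lambda>s. s)"
    unfolding spans_def
  proof (intro conjI ballI)
    fix x assume "x \<in> carrier G"
    then show "\<exists>e. x = int_comb S (\<lambda>s. s) e"
      using generate_int_comb[OF S(1,2), of x] S(3) by blast
  qed (use S in auto)
  then have ex: "\<exists>n I Y. spans I Y \<and> card I = n" by blast
  define n where "n = (LEAST n. \<exists>I Y. spans I Y \<and> card I = n)"
  from LeastI_ex[OF ex] obtain I Y where IY: "spans I Y" "card I = n"
    unfolding n_def by blast
  have min: "card I \<le> card J" if "spans J Z" for J Z
    unfolding IY(2) n_def by (rule Least_le) (use that in blast)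
  have I: "finite I" using IY by (auto simp: spans_def)
  have "\<forall>i\<in>I. e i = 0" if "spans I Y" "int_comb I Y e = \<one>" for Y e
    using that
  proof (induction "\<Sum>i\<in>I. nat \<bar>e i\<bar>" arbitrary: Y e rule: less_induct)
    case less
    note Y = less.prems(1)[unfolded spans_def]
    show ?case
    proof (rule ccontr)
      assume "\<not> ?case"
      then obtain k where k: "k \<in> I" "e k \<noteq> 0" by auto
      show False
      proof (cases "\<exists>l\<in>I. l \<noteq> k \<and> e l \<noteq> 0")
        case False
        have Yk: "Y k \<in> carrier G" using Y k by auto
        have "int_comb I Y e = int_comb I Y (\<lambda>j. if j = k then e k else 0)"
          using False Y by (intro int_comb_cong) auto
        also have "\<dots> = Y k [^] e k" using Y k by (intro int_comb_single) auto
        finally have "Y k [^] e k = \<one>" using less.prems(2) by (simp only:)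
        then have "Y k = \<one>" using tf Yk k(2) by blast
        then have "int_comb I Y v = int_comb (I - {k}) Y v" for v
        proof -
          have "Y \<in> I - {k} \<rightarrow> carrier G" using Y by auto
          then show ?thesis
            using int_comb_remove[of I k Y v] Y k \<open>Y k = \<one>\<close> int_comb_closed[of Y "I - {k}" v]
            by (simp only: int_pow_one l_one)
        qed
        then have "spans (I - {k}) Y"
          unfolding spans_def using Y by (metis Diff_subset Pi_anti_mono finite_Diff subsetD)
        from min[OF this] show False using I k by (metis card_Diff1_less leD)
      next
        case True
        then obtain l where l: "l \<in> I" "l \<noteq> k" "e l \<noteq> 0" by auto
        obtain i j where ij: "i \<in> I" "j \<in> I" "i \<noteq> j" "e i \<noteq> 0" "e j \<noteq> 0" "\<bar>e j\<bar> \<le> \<bar>e i\<bar>"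
        proof (cases "\<bar>e l\<bar> \<le> \<bar>e k\<bar>")
          case True
          then show ?thesis using that[of k l] k l by simp
        next
          case False
          then show ?thesis using that[of l k] k l by simp
        qed
        \<comment> \<open>The sign makes c * e j agree in sign with e i, so subtracting the entry
          that is not larger brings e i closer to 0.\<close>
        define c where "c = sgn (e i) * sgn (e j)"
        define Y' where "Y' = Y(j := Y j \<otimes> Y i [^] c)"
        define e' where "e' = e(i := e i - c * e j)"
        have move: "int_comb I Y' v = int_comb I Y (v(i := v i + c * v j))" for v
          unfolding Y'_def using I ij(1-3) Y by (intro int_comb_nielsen_move) simp_all
        have "Y k \<in> carrier G" if "k \<in> I" for k using Y that by auto
        then have "Y' \<in> I \<rightarrow> carrier G" unfolding Y'_def using ij(1,2) by simp
        moreover have "\<exists>v. x = int_comb I Y' v" if "x \<in> carrier G" for x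
        proof -
          from Y that have "\<exists>v. x = int_comb I Y v" by (elim conjE) (rule bspec)
          then obtain v where v: "x = int_comb I Y v" ..
          have "int_comb I Y' (v(i := v i - c * v j)) = int_comb I Y v"
            unfolding move using ij(3) by simp
          with v have "x = int_comb I Y' (v(i := v i - c * v j))" by (simp only:)
          then show ?thesis by (rule exI[of _ "v(i := v i - c * v j)"])
        qed
        ultimately have "spans I Y'" using I unfolding spans_def by blast
        moreover have "int_comb I Y' e' = \<one>"
          unfolding move e'_def using ij(3) less.prems(2) by simp
        moreover have "(\<Sum>i\<in>I. nat \<bar>e' i\<bar>) < (\<Sum>i\<in>I. nat \<bar>e i\<bar>)"
        proof (rule sum_strict_mono_ex1[OF I])
          have "\<bar>e i - c * e j\<bar> < \<bar>e i\<bar>"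
            using ij by (auto simp: c_def sgn_if split: if_splits)
          then have "nat \<bar>e' i\<bar> < nat \<bar>e i\<bar>" by (simp add: e'_def)
          then show "\<exists>a\<in>I. nat \<bar>e' a\<bar> < nat \<bar>e a\<bar>" "\<forall>a\<in>I. nat \<bar>e' a\<bar> \<le> nat \<bar>e a\<bar>"
            using ij by (auto simp: e'_def)
        qed
        ultimately have "\<forall>i\<in>I. e' i = 0" by (intro less.hyps)
        \<comment> \<open>The move changed only coordinate i, so the nonzero entry at j survives: a
          contradiction.\<close>
        then have "e' j = 0" using ij by blast
        then show False using ij by (auto simp: e'_def)
      qed
    qed
  qed
  note indep = this
  show ?thesis
  proof (rule that[of I Y])
    show "finite I" by (rule I)
    show "Y \<in> I \<rightarrow> carrier G" "\<forall>x\<in>carrier G. \<exists>e. x = int_comb I Y e"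
      using IY(1) unfolding spans_def by blast+
    show "\<forall>e. int_comb I Y e = \<one> \<longrightarrow> (\<forall>i\<in>I. e i = 0)"
      using indep[OF IY(1)] by blast
  qed
qed

text \<open>Independence makes the exponent vector of an element unique, so any choice of it is
  automatically additive.\<close>

lemma torsion_free_coordinates:
  assumes S: "finite S" "S \<subseteq> carrier G" "generate G S = carrier G"
    and tf: "\<forall>x\<in>carrier G. \<forall>n::int. x [^] n = \<one> \<longrightarrow> n \<noteq> 0 \<longrightarrow> x = \<one>"
  obtains I :: "'a set" and Y and l :: "'a \<Rightarrow> 'a \<Rightarrow> int" where "finite I" "Y \<in> I \<rightarrow> carrier G"
    "\<forall>i\<in>I. \<forall>x\<in>carrier G. \<forall>y\<in>carrier G. l i (x \<otimes> y) = l i x + l i y"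
    "\<forall>i\<in>I. \<forall>j\<in>I. l i (Y j) = (if i = j then 1 else 0)"
    "\<forall>x\<in>carrier G. (\<forall>i\<in>I. l i x = 0) \<longrightarrow> x = \<one>"
proof -
  obtain I :: "'a set" and Y where I: "finite I" and Y: "Y \<in> I \<rightarrow> carrier G"
    and span: "\<forall>x\<in>carrier G. \<exists>e. x = int_comb I Y e"
    and indep: "\<forall>e. int_comb I Y e = \<one> \<longrightarrow> (\<forall>i\<in>I. e i = 0)"
    by (rule torsion_free_basis[OF S tf])
  define co where "co x = (SOME e. x = int_comb I Y e)" for x
  have co: "x = int_comb I Y (co x)" if "x \<in> carrier G" for x
    unfolding co_def by (rule someI_ex[OF bspec[OF span that]])
  have co_unique: "co x i = e i" if "x = int_comb I Y e" "i \<in> I" for x e i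
  proof -
    have "x \<in> carrier G" unfolding that(1) by (rule int_comb_closed[OF Y])
    have "int_comb I Y (\<lambda>i. co x i + - e i) = x \<otimes> inv x"
      unfolding int_comb_add[OF Y] int_comb_neg[OF Y]
        co[OF \<open>x \<in> carrier G\<close>, symmetric] that(1)[symmetric] ..
    then have "int_comb I Y (\<lambda>i. co x i + - e i) = \<one>" using \<open>x \<in> carrier G\<close> by simp
    with indep that(2) have "co x i + - e i = 0" by blast
    then show ?thesis by simp
  qed
  show ?thesis
  proof (rule that[of I Y "\<lambda>i x. co x i", OF I Y]; intro ballI impI)
    fix i x y assume xy: "i \<in> I" "x \<in> carrier G" "y \<in> carrier G"
    have "x \<otimes> y = int_comb I Y (\<lambda>i. co x i + co y i)"
      unfolding int_comb_add[OF Y] co[OF xy(2), symmetric] co[OF xy(3), symmetric] ..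
    from co_unique[OF this xy(1)] show "co (x \<otimes> y) i = co x i + co y i" .
  next
    fix i j assume ij: "i \<in> I" "j \<in> I"
    then have "Y j \<in> carrier G" using Y by auto
    then have "Y j = int_comb I Y (\<lambda>i. if i = j then 1 else 0)"
      unfolding int_comb_single[OF I ij(2) Y] by simp
    from co_unique[OF this ij(1)] show "co (Y j) i = (if i = j then 1 else 0)" .
  next
    fix x assume x: "x \<in> carrier G" "\<forall>i\<in>I. co x i = 0"
    have "int_comb I Y (co x) = \<one>" by (intro int_comb_eq_one) (simp add: x)
    with co[OF x(1)] show "x = \<one>" by (rule trans)
  qed
qed

end

section \<open>Groups with infinite cyclic central commutators\<close>

text \<open>Commutators are only asked to be powers of \<open>z\<close>; that \<open>z\<close>
  generates the derived subgroup enters later, as the hypothesis of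
  \<open>exists_unit_pair\<close>.\<close>

locale central_commutators = group +
  fixes z
  assumes z_closed: "z \<in> carrier G"
    and z_central: "x \<in> carrier G \<Longrightarrow> z \<otimes> x = x \<otimes> z"
    and z_infinite: "z [^] (k::int) = \<one> \<Longrightarrow> k = 0"
    and commutes_mod_z: "x \<in> carrier G \<Longrightarrow> y \<in> carrier G \<Longrightarrow> \<exists>k::int. x \<otimes> y = y \<otimes> x \<otimes> z [^] k"
begin

text \<open>Shifts by powers of \<open>z\<close> are an operation of their own so that rewriting can
  pull all central factors outward and add their exponents as integers.\<close>

definition sh :: "'a \<Rightarrow> int \<Rightarrow> 'a" where "sh x k = x \<otimes> z [^] k"

lemma zpow_central: "x \<in> carrier G \<Longrightarrow> z [^] (k::int) \<otimes> x = x \<otimes> z [^] k"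
proof -
  assume x: "x \<in> carrier G"
  have nat: "z [^] n \<otimes> x = x \<otimes> z [^] n" for n :: nat
  proof (induction n)
    case (Suc n)
    have zn: "z [^] n \<in> carrier G" using z_closed by simp
    have "z [^] Suc n \<otimes> x = z [^] n \<otimes> (z \<otimes> x)"
      using x z_closed zn by (simp add: m_assoc)
    also have "\<dots> = (z [^] n \<otimes> x) \<otimes> z"
      unfolding z_central[OF x] using x z_closed zn by (simp only: m_assoc)
    also have "\<dots> = x \<otimes> z [^] Suc n"
      unfolding Suc nat_pow_Suc using x z_closed zn by (simp only: m_assoc)
    finally show ?case .
  qed (use x in simp)
  show ?thesis
  proof (cases "k \<ge> 0")
    case True
    then show ?thesis using nat[of "nat k"] unfolding int_pow_def2 by (simp del: pow_nat)
  next
    case False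
    define u where "u = z [^] nat (- k)"
    have u: "u \<in> carrier G" "u \<otimes> x = x \<otimes> u"
      using nat z_closed by (simp_all add: u_def)
    have "inv u \<otimes> x = inv u \<otimes> (x \<otimes> u) \<otimes> inv u"
      using x u(1) by (simp add: m_assoc)
    also have "\<dots> = x \<otimes> inv u"
      unfolding u(2)[symmetric] using x u(1) by (simp add: m_assoc[symmetric])
    finally show ?thesis using False unfolding int_pow_def2 u_def by (simp del: pow_nat)
  qed
qed

lemma sh_closed [simp]: "x \<in> carrier G \<Longrightarrow> sh x k \<in> carrier G"
  using z_closed by (simp add: sh_def)

lemma sh_mult_left [simp]: "x \<in> carrier G \<Longrightarrow> y \<in> carrier G \<Longrightarrow> sh x k \<otimes> y = sh (x \<otimes> y) k"
  using z_closed by (simp add: sh_def m_assoc zpow_central[of y])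

lemma sh_mult_right [simp]: "x \<in> carrier G \<Longrightarrow> y \<in> carrier G \<Longrightarrow> x \<otimes> sh y k = sh (x \<otimes> y) k"
  using z_closed by (simp add: sh_def m_assoc)

lemma sh_sh [simp]: "x \<in> carrier G \<Longrightarrow> sh (sh x k) l = sh x (k + l)"
  using z_closed by (simp add: sh_def m_assoc int_pow_mult)

lemma sh_0 [simp]: "x \<in> carrier G \<Longrightarrow> sh x 0 = x"
  by (simp add: sh_def)

lemma sh_inj [simp]: "x \<in> carrier G \<Longrightarrow> sh x k = sh x l \<longleftrightarrow> k = l"
proof
  assume x: "x \<in> carrier G" "sh x k = sh x l"
  then have "z [^] k = z [^] l" using z_closed by (simp add: sh_def)
  then have "z [^] (k - l) = \<one>" using z_closed by (simp add: int_pow_diff)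
  then show "k = l" using z_infinite[of "k - l"] by simp
qed simp

lemma sh_eq_self [simp]: "x \<in> carrier G \<Longrightarrow> sh x k = x \<longleftrightarrow> k = 0"
  using sh_inj[of x k 0] by simp

lemma sh_inv [simp]: "x \<in> carrier G \<Longrightarrow> inv (sh x k) = sh (inv x) (- k)"
  using inv_equality[of "sh (inv x) (- k)" "sh x k"] by simp

lemma sh_one: "sh \<one> k = z [^] k"
  using z_closed by (simp add: sh_def)

definition \<omega> :: "'a \<Rightarrow> 'a \<Rightarrow> int" where "\<omega> x y = (THE k. x \<otimes> y = sh (y \<otimes> x) k)"

lemma \<omega>_unique: "x \<in> carrier G \<Longrightarrow> y \<in> carrier G \<Longrightarrow> x \<otimes> y = sh (y \<otimes> x) k \<Longrightarrow> \<omega> x y = k"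
  unfolding \<omega>_def by (rule the_equality) auto

lemma swap: "x \<in> carrier G \<Longrightarrow> y \<in> carrier G \<Longrightarrow> x \<otimes> y = sh (y \<otimes> x) (\<omega> x y)"
  using commutes_mod_z[of x y] \<omega>_unique[of x y] by (auto simp: sh_def)

lemma \<omega>_mult_left:
  assumes "x \<in> carrier G" "y \<in> carrier G" "u \<in> carrier G"
  shows "\<omega> (x \<otimes> y) u = \<omega> x u + \<omega> y u"
proof (rule \<omega>_unique)
  have "x \<otimes> y \<otimes> u = x \<otimes> (y \<otimes> u)" using assms by (simp add: m_assoc)
  also have "\<dots> = sh (x \<otimes> u \<otimes> y) (\<omega> y u)"
    using assms by (simp add: swap[of y u] m_assoc)
  also have "\<dots> = sh (u \<otimes> (x \<otimes> y)) (\<omega> x u + \<omega> y u)"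
    using assms by (simp add: swap[of x u] m_assoc)
  finally show "x \<otimes> y \<otimes> u = sh (u \<otimes> (x \<otimes> y)) (\<omega> x u + \<omega> y u)" .
qed (use assms in auto)

lemma \<omega>_antisym: "x \<in> carrier G \<Longrightarrow> y \<in> carrier G \<Longrightarrow> \<omega> y x = - \<omega> x y"
  by (rule \<omega>_unique) (simp_all add: swap[of x y])

lemma \<omega>_mult_right:
  "x \<in> carrier G \<Longrightarrow> y \<in> carrier G \<Longrightarrow> u \<in> carrier G \<Longrightarrow> \<omega> u (x \<otimes> y) = \<omega> u x + \<omega> u y"
  using \<omega>_antisym[of u] \<omega>_antisym[of _ u] \<omega>_mult_left[of x y u] by (metis add.inverse_inverse m_closed minus_add_distrib)

lemma \<omega>_self [simp]: "x \<in> carrier G \<Longrightarrow> \<omega> x x = 0"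
  by (rule \<omega>_unique) auto

lemma \<omega>_sh_left [simp]: "x \<in> carrier G \<Longrightarrow> y \<in> carrier G \<Longrightarrow> \<omega> (sh x k) y = \<omega> x y"
  by (rule \<omega>_unique) (simp_all add: swap[of x y] add.commute)

lemma \<omega>_sh_right [simp]: "x \<in> carrier G \<Longrightarrow> y \<in> carrier G \<Longrightarrow> \<omega> x (sh y k) = \<omega> x y"
  by (rule \<omega>_unique) (simp_all add: swap[of x y] add.commute)

lemma \<omega>_one_left [simp]: "x \<in> carrier G \<Longrightarrow> \<omega> \<one> x = 0"
  by (rule \<omega>_unique) auto

lemma \<omega>_one_right [simp]: "x \<in> carrier G \<Longrightarrow> \<omega> x \<one> = 0"
  by (rule \<omega>_unique) auto

lemma \<omega>_inv_left [simp]: "x \<in> carrier G \<Longrightarrow> y \<in> carrier G \<Longrightarrow> \<omega> (inv x) y = - \<omega> x y"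
  using \<omega>_mult_left[of x "inv x" y] by simp

lemma \<omega>_inv_right [simp]: "x \<in> carrier G \<Longrightarrow> y \<in> carrier G \<Longrightarrow> \<omega> y (inv x) = - \<omega> y x"
  using \<omega>_mult_right[of x "inv x" y] by simp

end

definition (in group) int_hom_on :: "'a set \<Rightarrow> ('a \<Rightarrow> int) \<Rightarrow> bool" where
  "int_hom_on K f \<longleftrightarrow> (\<forall>x\<in>K. \<forall>y\<in>K. f (x \<otimes> y) = f x + f y)"

context group
begin

lemma int_hom_on_mult: "int_hom_on K f \<Longrightarrow> x \<in> K \<Longrightarrow> y \<in> K \<Longrightarrow> f (x \<otimes> y) = f x + f y"
  by (simp add: int_hom_on_def)

lemma int_hom_on_one: "int_hom_on K f \<Longrightarrow> subgroup K G \<Longrightarrow> f \<one> = 0"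
  using int_hom_on_mult[of K f \<one> \<one>] by (simp add: subgroup.one_closed)

lemma int_hom_on_inv:
  assumes "int_hom_on K f" "subgroup K G" "x \<in> K"
  shows "f (inv x) = - f x"
proof -
  interpret K: subgroup K G by fact
  have "f (x \<otimes> inv x) = f x + f (inv x)"
    using assms by (intro int_hom_on_mult) auto
  then show ?thesis using int_hom_on_one[OF assms(1,2)] assms(3) by simp
qed

lemma subgroup_int_pow: "subgroup K G \<Longrightarrow> x \<in> K \<Longrightarrow> x [^] (n::int) \<in> K"
  by (meson subgroup_int_pow_closed)

lemma int_hom_on_pow:
  assumes "int_hom_on K f" "subgroup K G" "x \<in> K"
  shows "f (x [^] (n::int)) = n * f x"
proof -
  interpret K: subgroup K G by fact
  have x: "x \<in> carrier G" using assms(3) by simp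
  have nat: "f (x [^] int m) = int m * f x" for m
  proof (induction m)
    case 0
    show ?case using int_hom_on_one[OF assms(1,2)] by simp
  next
    case (Suc m)
    have "x [^] int (Suc m) = x [^] int m \<otimes> x" by (simp only: int_pow_int nat_pow_Suc)
    moreover have "x [^] int m \<in> K" using assms by (intro subgroup_int_pow)
    ultimately show ?case
      using int_hom_on_mult[OF assms(1) _ assms(3)] Suc by (simp add: algebra_simps)
  qed
  show ?thesis
  proof (cases n rule: int_cases2)
    case (nonneg m)
    then show ?thesis using nat by simp
  next
    case (nonpos m)
    then have "f (x [^] n) = f (inv (x [^] int m))" using x by (simp add: int_pow_neg)
    also have "\<dots> = - f (x [^] int m)"
      using assms by (intro int_hom_on_inv subgroup_int_pow)
    finally show ?thesis using nat nonpos by simp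
  qed
qed

end

section \<open>Involutions of subgroups that fix \<open>z\<close>\<close>

context central_commutators
begin

lemma int_hom_on_\<omega>_left: "x \<in> carrier G \<Longrightarrow> int_hom_on (carrier G) (\<lambda>y. \<omega> y x)"
  by (simp add: int_hom_on_def \<omega>_mult_left)

lemma int_hom_on_\<omega>_right: "x \<in> carrier G \<Longrightarrow> int_hom_on (carrier G) (\<lambda>y. \<omega> x y)"
  by (simp add: int_hom_on_def \<omega>_mult_right)

lemma \<omega>_pow_left [simp]: "x \<in> carrier G \<Longrightarrow> y \<in> carrier G \<Longrightarrow> \<omega> (x [^] (n::int)) y = n * \<omega> x y"
  using int_hom_on_pow[OF int_hom_on_\<omega>_left subgroup_self] by blast

lemma \<omega>_pow_right [simp]: "x \<in> carrier G \<Longrightarrow> y \<in> carrier G \<Longrightarrow> \<omega> y (x [^] (n::int)) = n * \<omega> y x"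
  using int_hom_on_pow[OF int_hom_on_\<omega>_right subgroup_self] by blast

text \<open>What is kept while the automorphism grows along a chain of subgroups. The last clause
  forbids \<sigma>(x) = x z^k with k \<noteq> 0: such an x would shift the exponent of
  \<open>z\<close> beyond what \<open>\<omega>\<close> accounts for and spoil
  \<open>tclass_ab_distinct\<close>.\<close>

definition central_twist :: "'a set \<Rightarrow> ('a \<Rightarrow> 'a) \<Rightarrow> bool" where
  "central_twist K \<sigma> \<longleftrightarrow> subgroup K G \<and> z \<in> K \<and> \<sigma> \<in> K \<rightarrow> K \<and> (\<forall>x\<in>K. \<forall>y\<in>K. \<sigma> (x \<otimes> y) = \<sigma> x \<otimes> \<sigma> y) \<and>
     (\<forall>x\<in>K. \<sigma> (\<sigma> x) = x) \<and> \<sigma> z = z \<and> (\<forall>x\<in>K. \<forall>k. \<sigma> x = sh x k \<longrightarrow> k = 0)"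

lemma central_twistD:
  assumes "central_twist K \<sigma>"
  shows "subgroup K G" "z \<in> K" "x \<in> K \<Longrightarrow> \<sigma> x \<in> K"
    "x \<in> K \<Longrightarrow> y \<in> K \<Longrightarrow> \<sigma> (x \<otimes> y) = \<sigma> x \<otimes> \<sigma> y"
    "x \<in> K \<Longrightarrow> \<sigma> (\<sigma> x) = x" "\<sigma> z = z" "x \<in> K \<Longrightarrow> \<sigma> x = sh x k \<Longrightarrow> k = 0"
proof -
  note tw = assms[unfolded central_twist_def]
  show "subgroup K G" "z \<in> K" "\<sigma> z = z" using tw by simp_all
  show "x \<in> K \<Longrightarrow> \<sigma> x \<in> K" using tw by (elim conjE) (erule (1) funcset_mem)
  show "x \<in> K \<Longrightarrow> y \<in> K \<Longrightarrow> \<sigma> (x \<otimes> y) = \<sigma> x \<otimes> \<sigma> y" "x \<in> K \<Longrightarrow> \<sigma> (\<sigma> x) = x"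
    using tw by simp_all
  show "x \<in> K \<Longrightarrow> \<sigma> x = sh x k \<Longrightarrow> k = 0"
    using tw by (elim conjE) (drule (1) bspec[of K "\<lambda>x. \<forall>k. \<sigma> x = sh x k \<longrightarrow> k = 0" for K], simp)
qed

lemma sh_in_subgroup: "subgroup K G \<Longrightarrow> z \<in> K \<Longrightarrow> x \<in> K \<Longrightarrow> sh x k \<in> K"
  unfolding sh_def by (intro subgroup.m_closed subgroup_int_pow)

lemma central_twist_sh:
  assumes "central_twist K \<sigma>" "x \<in> K"
  shows "\<sigma> (sh x k) = sh (\<sigma> x) k"
proof -
  note tw = central_twistD[OF assms(1)]
  interpret K: subgroup K G by (rule tw(1))
  have zK: "z [^] k \<in> K" for k :: int using tw(1,2) by (rule subgroup_int_pow)
  have one: "\<sigma> \<one> = \<one>"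
    using tw(4)[OF K.one_closed K.one_closed] tw(3)[OF K.one_closed] by simp
  have nat: "\<sigma> (z [^] int n) = z [^] int n" for n
  proof (induction n)
    case (Suc n)
    have "z [^] int (Suc n) = z [^] int n \<otimes> z" by (simp only: int_pow_int nat_pow_Suc)
    then show ?case using tw(4)[OF zK tw(2)] Suc tw(6) by simp
  qed (simp add: one)
  have "\<sigma> (z [^] k) = z [^] k"
  proof (cases k rule: int_cases2)
    case (nonneg n)
    then show ?thesis using nat by simp
  next
    case (nonpos n)
    then have "z [^] k \<otimes> z [^] int n = \<one>" using z_closed by (simp add: int_pow_mult[symmetric])
    then have "\<sigma> (z [^] k) \<otimes> z [^] int n = z [^] k \<otimes> z [^] int n"
      using tw(4)[OF zK[of k] zK[of "int n"]] one nat by simp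
    then show ?thesis using tw(3)[OF zK[of k]] z_closed by simp
  qed
  then show ?thesis
    unfolding sh_def using tw(4)[OF assms(2) zK] by simp
qed

text \<open>As l y = 1, the elements of K' are the products k y^n with k in K, and \<tau> sends them
  to \<sigma>(k) y^(\<epsilon> n). Moving y^n past k' costs the exponent n \<omega>(y, k'); on the
  image side the cost is \<epsilon> n \<omega>(y, \<sigma>(k')), which is the same by
  \<open>orth\<close> and \<epsilon>^2 = 1. A relation \<tau>(x) = x z^m forces \<epsilon> n = n on
  comparing l, so the powers of y cancel and the last clause for K applies.\<close>

lemma central_twist_extend:
  assumes tw: "central_twist K \<sigma>" and K': "subgroup K' G" "K \<subseteq> K'"
    and y: "y \<in> K'" and l: "int_hom_on K' l" "l y = 1" "\<forall>x\<in>K'. x \<in> K \<longleftrightarrow> l x = 0"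
    and \<epsilon>: "\<epsilon> * \<epsilon> = (1::int)" and orth: "\<forall>x\<in>K. \<omega> y (\<sigma> x) = \<epsilon> * \<omega> y x"
  defines "\<tau> \<equiv> \<lambda>x. \<sigma> (x \<otimes> y [^] (- l x)) \<otimes> y [^] (\<epsilon> * l x)"
  shows "central_twist K' \<tau>"
    and "\<And>k n. k \<in> K \<Longrightarrow> \<tau> (k \<otimes> y [^] n) = \<sigma> k \<otimes> y [^] (\<epsilon> * n)"
    and "\<And>x. x \<in> K' \<Longrightarrow> \<exists>k\<in>K. x = k \<otimes> y [^] l x"
proof -
  note tw' = central_twistD[OF tw]
  interpret K: subgroup K G by (rule tw'(1))
  interpret K': subgroup K' G by (rule K'(1))
  have yc: "y \<in> carrier G" using y by simp
  have yp: "y [^] n \<in> K'" for n :: int using K'(1) y by (rule subgroup_int_pow)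
  have l_pow: "l (y [^] n) = n" for n :: int
    using int_hom_on_pow[OF l(1) K'(1) y] l(2) by simp
  have l_K: "l k = 0" if "k \<in> K" for k using l(3) K' that by auto
  have l_ky: "l (k \<otimes> y [^] n) = n" if "k \<in> K" for k n
    using int_hom_on_mult[OF l(1) _ yp] K' that l_pow l_K by (simp add: subset_iff)
  show decomp: "\<exists>k\<in>K. x = k \<otimes> y [^] l x" if x: "x \<in> K'" for x
  proof
    have "l (x \<otimes> y [^] (- l x)) = l x + - l x"
      unfolding int_hom_on_mult[OF l(1) x yp] l_pow ..
    then show "x \<otimes> y [^] (- l x) \<in> K"
      using l(3) x yp by simp
    show "x = x \<otimes> y [^] (- l x) \<otimes> y [^] l x"
      using x yc by (simp add: m_assoc int_pow_mult[symmetric])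
  qed
  have decompE: thesis if "x \<in> K'" "\<And>k n. k \<in> K \<Longrightarrow> x = k \<otimes> y [^] (n::int) \<Longrightarrow> thesis" for x thesis
    using decomp[OF that(1)] that(2) by (elim bexE)
  show \<tau>: "\<tau> (k \<otimes> y [^] n) = \<sigma> k \<otimes> y [^] (\<epsilon> * n)" if "k \<in> K" for k n
  proof -
    have "k \<otimes> y [^] n \<otimes> y [^] (- n) = k"
      using that yc by (simp add: m_assoc int_pow_mult[symmetric])
    then show ?thesis unfolding \<tau>_def l_ky[OF that] by simp
  qed
  have move: "(k \<otimes> y [^] n) \<otimes> (k' \<otimes> y [^] n') = sh (k \<otimes> k') (n * \<omega> y k') \<otimes> y [^] (n + n')"
    if "k \<in> K" "k' \<in> K" for k k' and n n' :: int
  proof -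
    have c: "k \<in> carrier G" "k' \<in> carrier G" using that by auto
    have "(k \<otimes> y [^] n) \<otimes> (k' \<otimes> y [^] n') = k \<otimes> (y [^] n \<otimes> k') \<otimes> y [^] n'"
      using c yc by (simp add: m_assoc)
    also have "\<dots> = k \<otimes> sh (k' \<otimes> y [^] n) (n * \<omega> y k') \<otimes> y [^] n'"
      using c yc by (subst swap) simp_all
    also have "\<dots> = sh (k \<otimes> k') (n * \<omega> y k') \<otimes> y [^] (n + n')"
      using c yc by (simp add: m_assoc int_pow_mult)
    finally show ?thesis .
  qed
  show "central_twist K' \<tau>"
    unfolding central_twist_def
  proof (intro conjI ballI allI impI)
    show "subgroup K' G" by fact
    show "z \<in> K'" using tw'(2) K' by auto
    show "\<tau> \<in> K' \<rightarrow> K'"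
    proof
      fix x assume "x \<in> K'"
      then obtain k n where x: "k \<in> K" "x = k \<otimes> y [^] (n::int)" by (rule decompE)
      show "\<tau> x \<in> K'" unfolding x(2) \<tau>[OF x(1)]
        using tw'(3)[OF x(1)] K'(2) yp by (intro K'.m_closed) auto
    qed
    show "\<tau> z = z" using \<tau>[OF tw'(2), of 0] tw'(6) z_closed by simp
  next
    fix x x' assume xx': "x \<in> K'" "x' \<in> K'"
    obtain k n where x: "k \<in> K" "x = k \<otimes> y [^] (n::int)" using xx'(1) by (rule decompE)
    obtain k' n' where x': "k' \<in> K" "x' = k' \<otimes> y [^] (n'::int)" using xx'(2) by (rule decompE)
    note x = x x'
    have kk: "k \<otimes> k' \<in> K" using x by simp
    have w: "n * \<omega> y k' = (\<epsilon> * n) * \<omega> y (\<sigma> k')"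
    proof -
      have "(\<epsilon> * n) * (\<epsilon> * \<omega> y k') = (\<epsilon> * \<epsilon>) * (n * \<omega> y k')" by (simp only: mult_ac)
      then show ?thesis unfolding bspec[OF orth x(3)] \<epsilon> by simp
    qed
    have "\<tau> (x \<otimes> x') = \<tau> (sh (k \<otimes> k') (n * \<omega> y k') \<otimes> y [^] (n + n'))"
      unfolding x(2,4) move[OF x(1,3)] ..
    also have "\<dots> = \<sigma> (sh (k \<otimes> k') (n * \<omega> y k')) \<otimes> y [^] (\<epsilon> * (n + n'))"
      by (rule \<tau>) (rule sh_in_subgroup[OF tw'(1,2) kk])
    also have "\<dots> = sh (\<sigma> k \<otimes> \<sigma> k') ((\<epsilon> * n) * \<omega> y (\<sigma> k')) \<otimes> y [^] (\<epsilon> * n + \<epsilon> * n')"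
      unfolding central_twist_sh[OF tw kk] tw'(4)[OF x(1,3)] w distrib_left ..
    also have "\<dots> = \<tau> x \<otimes> \<tau> x'"
      unfolding x(2,4) \<tau>[OF x(1)] \<tau>[OF x(3)] move[OF tw'(3)[OF x(1)] tw'(3)[OF x(3)]] ..
    finally show "\<tau> (x \<otimes> x') = \<tau> x \<otimes> \<tau> x'" .
  next
    fix x assume "x \<in> K'"
    then obtain k n where x: "k \<in> K" "x = k \<otimes> y [^] (n::int)" by (rule decompE)
    have "\<tau> (\<tau> x) = k \<otimes> y [^] (\<epsilon> * (\<epsilon> * n))"
      unfolding x(2) \<tau>[OF x(1)] \<tau>[OF tw'(3)[OF x(1)]] tw'(5)[OF x(1)] ..
    then show "\<tau> (\<tau> x) = x"
      unfolding x(2) mult.assoc[symmetric] \<epsilon> by simp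
  next
    fix x m assume xK: "x \<in> K'" and eq: "\<tau> x = sh x m"
    obtain k n where x: "k \<in> K" "x = k \<otimes> y [^] (n::int)" using xK by (rule decompE)
    have c: "k \<in> carrier G" "\<sigma> k \<in> carrier G" using x tw'(3) by auto
    have eq': "\<sigma> k \<otimes> y [^] (\<epsilon> * n) = sh k m \<otimes> y [^] n"
      using eq c yc unfolding x(2) \<tau>[OF x(1)] by simp
    have "\<epsilon> * n = n"
      using arg_cong[OF eq', of l]
      unfolding l_ky[OF tw'(3)[OF x(1)]] l_ky[OF sh_in_subgroup[OF tw'(1,2) x(1)]] .
    with eq' have "\<sigma> k \<otimes> y [^] n = sh k m \<otimes> y [^] n" by (simp only:)
    then have "\<sigma> k = sh k m" using c yc by (simp del: sh_mult_left)
    then show "m = 0" using tw'(7) x by blast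
  qed
qed

section \<open>Torsion modulo \<open>z\<close>\<close>

definition torsion_mod_z :: "'a set" where
  "torsion_mod_z = {x \<in> carrier G. \<exists>(n::int) (k::int). n \<noteq> 0 \<and> x [^] n = z [^] k}"

lemma \<omega>_zpow [simp]: "x \<in> carrier G \<Longrightarrow> \<omega> (z [^] (k::int)) x = 0" "x \<in> carrier G \<Longrightarrow> \<omega> x (z [^] (k::int)) = 0"
  by (simp_all flip: sh_one)

text \<open>n \<omega>(x, y) = \<omega>(z^k, y) = 0, and the integers have no torsion. Hence torsion
  modulo \<open>z\<close> is central in the whole group.\<close>

lemma torsion_mod_z_\<omega>: "x \<in> torsion_mod_z \<Longrightarrow> y \<in> carrier G \<Longrightarrow> \<omega> x y = 0"
proof -
  assume "x \<in> torsion_mod_z" "y \<in> carrier G"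
  then obtain n k :: int where "x \<in> carrier G" "n \<noteq> 0" "x [^] n = z [^] k"
    by (auto simp: torsion_mod_z_def)
  then show ?thesis using \<open>y \<in> carrier G\<close> \<omega>_pow_left[of x y n] by simp
qed

lemma commute_if_\<omega>_0: "x \<in> carrier G \<Longrightarrow> y \<in> carrier G \<Longrightarrow> \<omega> x y = 0 \<Longrightarrow> x \<otimes> y = y \<otimes> x"
  using swap[of x y] by simp

lemma torsion_mod_zI: "x \<in> carrier G \<Longrightarrow> n \<noteq> 0 \<Longrightarrow> x [^] (n::int) = z [^] (k::int) \<Longrightarrow> x \<in> torsion_mod_z"
  unfolding torsion_mod_z_def by blast

lemma torsion_mod_zE:
  assumes "x \<in> torsion_mod_z"
  obtains n k :: int where "x \<in> carrier G" "n \<noteq> 0" "x [^] n = z [^] k"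
  using assms unfolding torsion_mod_z_def by blast

lemma torsion_mod_z_subgroup: "subgroup torsion_mod_z G"
proof
  show "torsion_mod_z \<subseteq> carrier G" by (auto simp: torsion_mod_z_def)
  show "\<one> \<in> torsion_mod_z" by (rule torsion_mod_zI[of _ 1 0]) auto
next
  fix x y assume x: "x \<in> torsion_mod_z" and y: "y \<in> torsion_mod_z"
  obtain n k :: int where n: "x \<in> carrier G" "n \<noteq> 0" "x [^] n = z [^] k"
    using x by (rule torsion_mod_zE)
  obtain m l :: int where m: "y \<in> carrier G" "m \<noteq> 0" "y [^] m = z [^] l"
    using y by (rule torsion_mod_zE)
  have xy: "x \<otimes> y = y \<otimes> x" using n m torsion_mod_z_\<omega>[OF x] by (intro commute_if_\<omega>_0) auto
  have "(x \<otimes> y) [^] (n * m) = x [^] (n * m) \<otimes> y [^] (m * n)"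
    unfolding mult.commute[of m n] by (rule int_pow_mult_distrib[OF xy n(1) m(1)])
  also have "\<dots> = z [^] (k * m + l * n)"
    unfolding int_pow_pow[OF n(1), symmetric] int_pow_pow[OF m(1), symmetric] n(3) m(3)
      int_pow_pow[OF z_closed] by (rule int_pow_mult[OF z_closed, symmetric])
  finally show "x \<otimes> y \<in> torsion_mod_z"
    using n m by (intro torsion_mod_zI[of _ "n * m"]) auto
next
  fix x assume x: "x \<in> torsion_mod_z"
  obtain n k :: int where n: "x \<in> carrier G" "n \<noteq> 0" "x [^] n = z [^] k"
    using x by (rule torsion_mod_zE)
  have "inv x [^] n = z [^] (- k)"
    unfolding int_pow_inv[OF n(1)] n(3) int_pow_neg[OF z_closed] ..
  with n show "inv x \<in> torsion_mod_z"
    by (intro torsion_mod_zI[of _ n]) auto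
qed

lemma z_torsion: "z \<in> torsion_mod_z"
  using z_closed by (intro torsion_mod_zI[of _ 1 1]) auto

end

context group
begin

lemma rcoset_eq_iff:
  assumes "subgroup N G" "x \<in> carrier G" "y \<in> carrier G"
  shows "N #> x = N #> y \<longleftrightarrow> x \<otimes> inv y \<in> N"
proof
  interpret N: subgroup N G by fact
  assume "N #> x = N #> y"
  then have "x \<in> N #> y" using rcos_self[OF assms(2,1)] by simp
  then obtain h where h: "h \<in> N" "x = h \<otimes> y" by (auto simp: r_coset_def)
  then have "x \<otimes> inv y = h" using assms by (simp add: m_assoc)
  then show "x \<otimes> inv y \<in> N" using h by simp
next
  assume h: "x \<otimes> inv y \<in> N"
  have "x = (x \<otimes> inv y) \<otimes> y" using assms by (simp add: m_assoc)
  then have "x \<in> N #> y" using h by (auto simp: r_coset_def)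
  then show "N #> x = N #> y" using repr_independence assms by metis
qed

end

section \<open>Calculations modulo powers of \<open>z\<close>\<close>

context central_commutators
begin

text \<open>Equality in the abelian quotient by the powers of \<open>z\<close>, kept as a relation
  on G so that exponents which do not matter need not be named.\<close>

definition modz :: "'a \<Rightarrow> 'a \<Rightarrow> bool" where
  "modz x y \<longleftrightarrow> y \<in> carrier G \<and> (\<exists>k. x = sh y k)"

lemma modz_refl: "x \<in> carrier G \<Longrightarrow> modz x x"
  unfolding modz_def by (metis sh_0)

lemma modz_sym: "modz x y \<Longrightarrow> modz y x"
proof -
  assume "modz x y"
  then obtain k where k: "y \<in> carrier G" "x = sh y k" unfolding modz_def by blast
  then have "y = sh x (- k)" by simp
  then show "modz y x" using k unfolding modz_def by (metis sh_closed)
qed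

lemma modz_trans [trans]: "modz x y \<Longrightarrow> modz y w \<Longrightarrow> modz x w"
  unfolding modz_def by auto

lemma modz_mult: "modz x y \<Longrightarrow> modz u v \<Longrightarrow> modz (x \<otimes> u) (y \<otimes> v)"
  unfolding modz_def by auto

lemma modz_commute: "x \<in> carrier G \<Longrightarrow> y \<in> carrier G \<Longrightarrow> modz (x \<otimes> y) (y \<otimes> x)"
  unfolding modz_def using swap by blast

lemma modz_inv: "modz x y \<Longrightarrow> modz (inv x) (inv y)"
  unfolding modz_def by auto

lemma sh_pow: "x \<in> carrier G \<Longrightarrow> (sh x k) [^] (n::int) = sh (x [^] n) (n * k)"
  unfolding sh_def using z_closed
  by (subst int_pow_mult_distrib) (simp_all add: zpow_central int_pow_pow mult.commute)

lemma modz_pow: "modz x y \<Longrightarrow> modz (x [^] (n::int)) (y [^] n)"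
  unfolding modz_def using sh_pow by (metis int_pow_closed)

lemma modz_rearrange:
  assumes "x \<in> carrier G" "y \<in> carrier G" "u \<in> carrier G" "v \<in> carrier G"
  shows "modz ((x \<otimes> y) \<otimes> (u \<otimes> v)) ((x \<otimes> u) \<otimes> (y \<otimes> v))"
proof -
  have "(x \<otimes> y) \<otimes> (u \<otimes> v) = x \<otimes> (y \<otimes> u) \<otimes> v" using assms by (simp add: m_assoc)
  moreover have "modz \<dots> (x \<otimes> (u \<otimes> y) \<otimes> v)"
    using assms by (intro modz_mult modz_commute modz_refl) auto
  ultimately show ?thesis using assms by (simp add: m_assoc)
qed

lemma modz_pow_mult:
  assumes "x \<in> carrier G" "y \<in> carrier G"
  shows "modz ((x \<otimes> y) [^] (n::int)) (x [^] n \<otimes> y [^] n)"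
proof -
  have nat: "modz ((x \<otimes> y) [^] (int n)) (x [^] (int n) \<otimes> y [^] (int n))" for n
  proof (induction n)
    case (Suc n)
    have "modz ((x \<otimes> y) [^] n \<otimes> (x \<otimes> y)) ((x [^] n \<otimes> y [^] n) \<otimes> (x \<otimes> y))"
      using Suc assms by (intro modz_mult modz_refl) (auto simp: int_pow_int)
    also have "modz \<dots> ((x [^] n \<otimes> x) \<otimes> (y [^] n \<otimes> y))"
      using assms by (intro modz_rearrange) auto
    finally show ?case using assms by (simp only: int_pow_int nat_pow_Suc)
  qed (simp add: modz_refl)
  show ?thesis
  proof (cases n rule: int_cases2)
    case (nonneg m)
    then show ?thesis using nat by simp
  next
    case (nonpos m)
    have "modz (inv ((x \<otimes> y) [^] (int m))) (inv (x [^] (int m) \<otimes> y [^] (int m)))"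
      using assms by (intro modz_inv nat)
    also have "inv (x [^] (int m) \<otimes> y [^] (int m)) = inv (y [^] (int m)) \<otimes> inv (x [^] (int m))"
      using assms by (intro inv_mult_group) auto
    also have "modz \<dots> (inv (x [^] (int m)) \<otimes> inv (y [^] (int m)))"
      using assms by (intro modz_commute) auto
    finally show ?thesis using assms nonpos by (simp only: int_pow_neg m_closed)
  qed
qed

lemma FactGroup_comm_group:
  assumes "N \<lhd> G" "z \<in> N"
  shows "comm_group (G Mod N)"
proof -
  interpret N: normal N G by fact
  show ?thesis
  proof (rule group.group_comm_groupI[OF N.factorgroup_is_group])
    fix X Y assume "X \<in> carrier (G Mod N)" "Y \<in> carrier (G Mod N)"
    then obtain x y where xy: "x \<in> carrier G" "y \<in> carrier G" "X = N #> x" "Y = N #> y"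
      unfolding FactGroup_def RCOSETS_def by auto
    have "x \<otimes> y \<otimes> inv (y \<otimes> x) = sh \<one> (\<omega> x y)"
      using xy(1,2) by (simp add: swap[of x y])
    also have "\<dots> \<in> N"
      using subgroup_int_pow[OF N.subgroup_axioms assms(2)] by (simp add: sh_one)
    finally have "N #> (x \<otimes> y) = N #> (y \<otimes> x)"
      by (subst rcoset_eq_iff[OF N.subgroup_axioms]) (use xy(1,2) in auto)
    then show "X \<otimes>\<^bsub>G Mod N\<^esub> Y = Y \<otimes>\<^bsub>G Mod N\<^esub> X"
      using xy by (simp add: FactGroup_def N.rcos_sum)
  qed
qed

lemma torsion_if_modz_one: "x \<in> carrier G \<Longrightarrow> n \<noteq> 0 \<Longrightarrow> modz (x [^] (n::int)) \<one> \<Longrightarrow> x \<in> torsion_mod_z"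
  unfolding modz_def sh_one by (auto intro: torsion_mod_zI)

text \<open>The least positive value \<open>d\<close> of \<open>\<omega>\<close>, attained at \<open>(p, q)\<close>, divides every value: first the
  values \<open>\<omega>(p, _)\<close> and \<open>\<omega>(_, q)\<close>, then, after making \<open>g\<close> orthogonal to \<open>q\<close>, the residue of
  \<open>\<omega>(g, h)\<close> modulo \<open>d\<close> is again a value, namely at \<open>(p g, q\<^sup>k h)\<close> for suitable \<open>k\<close>.\<close>

lemma exists_unit_pair:
  assumes "derived G (carrier G) = range (\<lambda>k::int. z [^] k)"
  shows "\<exists>a\<in>carrier G. \<exists>b\<in>carrier G. \<omega> a b = 1"
proof -
  \<comment> \<open>If d divides all values, every commutator is a power of z^d; as \<open>z\<close>
    itself lies in the derived subgroup, d is a unit.\<close>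
  have div_all: "d dvd 1" if d: "\<And>g h. g \<in> carrier G \<Longrightarrow> h \<in> carrier G \<Longrightarrow> d dvd \<omega> g h" for d
  proof -
    define H where "H = range (\<lambda>k::int. z [^] (d * k))"
    have sub: "subgroup H G"
    proof
      show "H \<subseteq> carrier G" using z_closed by (auto simp: H_def)
      show "\<one> \<in> H" unfolding H_def by (rule range_eqI[of _ _ 0]) simp
    next
      fix x y assume "x \<in> H" "y \<in> H"
      then obtain k l where kl: "x = z [^] (d * k)" "y = z [^] (d * l)" unfolding H_def by blast
      show "x \<otimes> y \<in> H" unfolding H_def
        by (rule range_eqI[of _ _ "k + l"]) (simp add: kl distrib_left int_pow_mult z_closed)
    next
      fix x assume "x \<in> H"
      then obtain k where k: "x = z [^] (d * k)" unfolding H_def by blast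
      show "inv x \<in> H" unfolding H_def
        by (rule range_eqI[of _ _ "- k"]) (simp add: k int_pow_neg z_closed)
    qed
    have "derived_set G (carrier G) \<subseteq> H"
    proof clarify
      fix g h assume gh: "g \<in> carrier G" "h \<in> carrier G"
      obtain k where k: "\<omega> g h = d * k" using d[OF gh] by (elim dvdE)
      have "g \<otimes> h \<otimes> inv g \<otimes> inv h = sh (h \<otimes> g \<otimes> inv g \<otimes> inv h) (d * k)"
        using gh by (simp add: swap[of g h] k)
      also have "h \<otimes> g \<otimes> inv g \<otimes> inv h = \<one>" using gh by (simp add: m_assoc)
      finally show "g \<otimes> h \<otimes> inv g \<otimes> inv h \<in> H"
        unfolding sh_one H_def by blast
    qed
    then have "derived G (carrier G) \<subseteq> H"
      unfolding derived_def by (intro generate_subgroup_incl sub)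
    moreover have "z [^] (1::int) \<in> derived G (carrier G)" unfolding assms by (rule rangeI)
    ultimately obtain k where k: "z [^] (1::int) = z [^] (d * k)" unfolding H_def by blast
    have "sh \<one> 1 = sh \<one> (d * k)" unfolding sh_one by (rule k)
    then have "1 = d * k" by simp
    then show "d dvd 1" by (rule dvdI)
  qed
  have pos: "\<exists>n. n > 0 \<and> (\<exists>g\<in>carrier G. \<exists>h\<in>carrier G. \<omega> g h = int n)"
  proof (rule ccontr)
    assume neg: "\<not> ?thesis"
    have "\<omega> g h \<le> 0" if gh: "g \<in> carrier G" "h \<in> carrier G" for g h
    proof (rule ccontr)
      assume "\<not> \<omega> g h \<le> 0"
      then have "nat (\<omega> g h) > 0" "\<omega> g h = int (nat (\<omega> g h))" by auto
      with neg gh show False by blast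
    qed
    then have "\<omega> g h = 0" if "g \<in> carrier G" "h \<in> carrier G" for g h
      using that \<omega>_antisym[of g h] by (metis antisym neg_le_0_iff_le neg_0_le_iff_le)
    \<comment> \<open>A form vanishing identically would have even 0 as a common divisor of its
      values.\<close>
    then have "(0::int) dvd 1" by (intro div_all) auto
    then show False by simp
  qed
  define n where "n = (LEAST n. n > 0 \<and> (\<exists>g\<in>carrier G. \<exists>h\<in>carrier G. \<omega> g h = int n))"
  from LeastI_ex[OF pos] obtain p q where n: "n > 0" and p: "p \<in> carrier G" and q: "q \<in> carrier G"
      and pq: "\<omega> p q = int n"
    unfolding n_def by blast
  have small: "\<omega> g h = 0" if "0 \<le> \<omega> g h" "\<omega> g h < int n" "g \<in> carrier G" "h \<in> carrier G" for g h
  proof (rule ccontr)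
    assume "\<omega> g h \<noteq> 0"
    then have "nat (\<omega> g h) > 0" "\<omega> g h = int (nat (\<omega> g h))" using that(1) by auto
    then have "n \<le> nat (\<omega> g h)" unfolding n_def using that(3,4) by (intro Least_le) blast
    then have "int n \<le> \<omega> g h" using that(1) by simp
    then show False using that(2) by simp
  qed
  have p_dvd: "int n dvd \<omega> p h" if h: "h \<in> carrier G" for h
  proof -
    let ?h = "q [^] (- (\<omega> p h div int n)) \<otimes> h"
    have "\<omega> p ?h = - (\<omega> p h div int n) * int n + \<omega> p h"
      using p q h by (simp add: \<omega>_mult_right pq)
    also have "\<dots> = \<omega> p h mod int n" by (simp add: minus_div_mult_eq_mod[symmetric])
    finally have eq: "\<omega> p ?h = \<omega> p h mod int n" .
    have "\<omega> p ?h = 0" using n p q h by (intro small) (simp_all only: eq, auto)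
    then show ?thesis using eq by (simp add: dvd_eq_mod_eq_0)
  qed
  have q_dvd: "int n dvd \<omega> g q" if g: "g \<in> carrier G" for g
  proof -
    let ?g = "p [^] (- (\<omega> g q div int n)) \<otimes> g"
    have "\<omega> ?g q = - (\<omega> g q div int n) * int n + \<omega> g q"
      using p q g by (simp add: \<omega>_mult_left pq)
    also have "\<dots> = \<omega> g q mod int n" by (simp add: minus_div_mult_eq_mod[symmetric])
    finally have eq: "\<omega> ?g q = \<omega> g q mod int n" .
    have "\<omega> ?g q = 0" using n p q g by (intro small) (simp_all only: eq, auto)
    then show ?thesis using eq by (simp add: dvd_eq_mod_eq_0)
  qed
  have dvd: "int n dvd \<omega> g h" if g: "g \<in> carrier G" and h: "h \<in> carrier G" for g h
  proof -
    obtain i where i: "\<omega> g q = int n * i" using q_dvd[OF g] by (elim dvdE)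
    define g' where "g' = p [^] (- i) \<otimes> g"
    have g': "g' \<in> carrier G" "\<omega> g' q = 0" "\<omega> g' h = - i * \<omega> p h + \<omega> g h"
      using p q g h i by (simp_all add: g'_def \<omega>_mult_left pq mult.commute)
    let ?e = "\<omega> p h + \<omega> g' h"
    let ?h = "q [^] (- (?e div int n)) \<otimes> h"
    have "\<omega> (p \<otimes> g') ?h = - (?e div int n) * int n + ?e"
      using p q h g' by (simp add: \<omega>_mult_right \<omega>_mult_left pq)
    also have "\<dots> = ?e mod int n" by (simp add: minus_div_mult_eq_mod[symmetric])
    finally have eq: "\<omega> (p \<otimes> g') ?h = ?e mod int n" .
    have "0 \<le> \<omega> (p \<otimes> g') ?h" "\<omega> (p \<otimes> g') ?h < int n" unfolding eq using n by simp_all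
    then have "\<omega> (p \<otimes> g') ?h = 0" using p q h g'(1) by (intro small) auto
    then have "int n dvd ?e" using eq by (simp add: dvd_eq_mod_eq_0)
    then have "int n dvd \<omega> g' h" using p_dvd[OF h] by (simp add: dvd_add_right_iff)
    then have "int n dvd \<omega> g' h + i * \<omega> p h" using p_dvd[OF h] by (intro dvd_add dvd_mult)
    then show ?thesis unfolding g'(3) by simp
  qed
  have "int n dvd 1" by (rule div_all) (rule dvd)
  then have "int n = 1" by simp
  then show ?thesis using p q pq by auto
qed

end

section \<open>An involution fixing a hyperbolic plane\<close>

context group
begin

lemma subgroup_common_kernel:
  assumes "\<And>f. f \<in> F \<Longrightarrow> int_hom_on (carrier G) f"
  shows "subgroup {x \<in> carrier G. \<forall>f\<in>F. f x = 0} G"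
proof
  show "\<one> \<in> {x \<in> carrier G. \<forall>f\<in>F. f x = 0}"
    using int_hom_on_one[OF assms subgroup_self] by simp
next
  fix x y assume xy: "x \<in> {x \<in> carrier G. \<forall>f\<in>F. f x = 0}" "y \<in> {x \<in> carrier G. \<forall>f\<in>F. f x = 0}"
  have "f (x \<otimes> y) = 0" if f: "f \<in> F" for f
  proof -
    have "f x = 0" "f y = 0" using xy f by blast+
    then show ?thesis using int_hom_on_mult[OF assms[OF f], of x y] xy by simp
  qed
  then show "x \<otimes> y \<in> {x \<in> carrier G. \<forall>f\<in>F. f x = 0}" using xy by blast
next
  fix x assume x: "x \<in> {x \<in> carrier G. \<forall>f\<in>F. f x = 0}"
  have "f (inv x) = 0" if f: "f \<in> F" for f
  proof -
    have "f x = 0" using x f by blast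
    then show ?thesis using int_hom_on_inv[OF assms[OF f] subgroup_self, of x] x by simp
  qed
  then show "inv x \<in> {x \<in> carrier G. \<forall>f\<in>F. f x = 0}" using x by blast
qed auto

end

locale heisenberg = central_commutators +
  fixes a b
  assumes a_closed [simp]: "a \<in> carrier G" and b_closed [simp]: "b \<in> carrier G" and \<omega>_ab: "\<omega> a b = 1"
begin

text \<open>Because \<open>\<omega> a b = 1\<close>, pairing with \<open>b\<close> and with
  \<open>a\<close> reads off the exponents of a and b, whatever the factor from
  \<open>orth_ab\<close>.\<close>

definition acoord :: "'a \<Rightarrow> int" where "acoord x = \<omega> x b"
definition bcoord :: "'a \<Rightarrow> int" where "bcoord x = \<omega> a x"

definition orth_ab :: "'a set" where "orth_ab = {x \<in> carrier G. acoord x = 0 \<and> bcoord x = 0}"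

lemma acoord_hom: "int_hom_on (carrier G) acoord" and bcoord_hom: "int_hom_on (carrier G) bcoord"
  unfolding acoord_def bcoord_def by (rule int_hom_on_\<omega>_left int_hom_on_\<omega>_right; simp)+

lemma coord_ab [simp]: "acoord a = 1" "acoord b = 0" "bcoord a = 0" "bcoord b = 1"
  by (simp_all add: acoord_def bcoord_def \<omega>_ab)

lemma coord_one [simp]: "acoord \<one> = 0" "bcoord \<one> = 0"
  by (simp_all add: acoord_def bcoord_def)

lemma coord_mult [simp]:
  "x \<in> carrier G \<Longrightarrow> y \<in> carrier G \<Longrightarrow> acoord (x \<otimes> y) = acoord x + acoord y"
  "x \<in> carrier G \<Longrightarrow> y \<in> carrier G \<Longrightarrow> bcoord (x \<otimes> y) = bcoord x + bcoord y"
  by (simp_all add: acoord_def bcoord_def \<omega>_mult_left \<omega>_mult_right)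

lemma coord_pow [simp]:
  "x \<in> carrier G \<Longrightarrow> acoord (x [^] (n::int)) = n * acoord x"
  "x \<in> carrier G \<Longrightarrow> bcoord (x [^] (n::int)) = n * bcoord x"
  by (simp_all add: acoord_def bcoord_def)

lemma coord_sh [simp]:
  "x \<in> carrier G \<Longrightarrow> acoord (sh x k) = acoord x"
  "x \<in> carrier G \<Longrightarrow> bcoord (sh x k) = bcoord x"
  by (simp_all add: acoord_def bcoord_def)

lemma coord_inv [simp]:
  "x \<in> carrier G \<Longrightarrow> acoord (inv x) = - acoord x"
  "x \<in> carrier G \<Longrightarrow> bcoord (inv x) = - bcoord x"
  by (simp_all add: acoord_def bcoord_def)

lemma coord_modz: "modz x y \<Longrightarrow> acoord x = acoord y" "modz x y \<Longrightarrow> bcoord x = bcoord y"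
  unfolding modz_def by auto

text \<open>The isolator of the subgroup generated by \<open>a\<close>, \<open>b\<close> and
  \<open>z\<close>: including all roots makes the quotient torsion-free, as
  \<open>torsion_free_coordinates\<close> demands.\<close>

definition ab_isolator :: "'a set" where
  "ab_isolator = {x \<in> carrier G. \<exists>n::int. n \<noteq> 0 \<and> (\<exists>(i::int) (j::int). modz (x [^] n) (a [^] i \<otimes> b [^] j))}"

lemma ab_isolatorI:
  "x \<in> carrier G \<Longrightarrow> n \<noteq> 0 \<Longrightarrow> modz (x [^] (n::int)) (a [^] (i::int) \<otimes> b [^] (j::int)) \<Longrightarrow> x \<in> ab_isolator"
  unfolding ab_isolator_def by blast

lemma ab_isolatorE:
  assumes "x \<in> ab_isolator"
  obtains n i j :: int where "x \<in> carrier G" "n \<noteq> 0" "modz (x [^] n) (a [^] i \<otimes> b [^] j)"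
  using assms unfolding ab_isolator_def by blast

lemma modz_ab_pow: "modz ((a [^] (i::int) \<otimes> b [^] (j::int)) [^] (n::int)) (a [^] (i * n) \<otimes> b [^] (j * n))"
  using modz_pow_mult[of "a [^] i" "b [^] j" n] by (simp add: int_pow_pow)

lemma modz_ab_mult:
  "modz ((a [^] (i::int) \<otimes> b [^] (j::int)) \<otimes> (a [^] (k::int) \<otimes> b [^] (l::int))) (a [^] (i + k) \<otimes> b [^] (j + l))"
  using modz_rearrange[of "a [^] i" "b [^] j" "a [^] k" "b [^] l"] by (simp add: int_pow_mult)

lemma ab_isolator_sh: "x \<in> ab_isolator \<Longrightarrow> sh x k \<in> ab_isolator"
proof (erule ab_isolatorE)
  fix n i j :: int assume *: "x \<in> carrier G" "n \<noteq> 0" "modz (x [^] n) (a [^] i \<otimes> b [^] j)"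
  have "modz (sh x k) x" using *(1) unfolding modz_def by blast
  then have "modz ((sh x k) [^] n) (x [^] n)" by (rule modz_pow)
  also note *(3)
  finally show "sh x k \<in> ab_isolator" using * by (intro ab_isolatorI[of _ n]) auto
qed

lemma ab_isolator_subgroup: "subgroup ab_isolator G"
proof
  show "ab_isolator \<subseteq> carrier G" by (auto simp: ab_isolator_def)
  show "\<one> \<in> ab_isolator" by (rule ab_isolatorI[of _ 1 0 0]) (auto intro: modz_refl)
next
  fix x y assume x: "x \<in> ab_isolator" and y: "y \<in> ab_isolator"
  obtain n i j :: int where n: "x \<in> carrier G" "n \<noteq> 0" "modz (x [^] n) (a [^] i \<otimes> b [^] j)"
    using x by (rule ab_isolatorE)
  obtain m k l :: int where m: "y \<in> carrier G" "m \<noteq> 0" "modz (y [^] m) (a [^] k \<otimes> b [^] l)"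
    using y by (rule ab_isolatorE)
  have "modz ((x \<otimes> y) [^] (n * m)) (x [^] (n * m) \<otimes> y [^] (n * m))"
    using n m by (intro modz_pow_mult)
  also have "x [^] (n * m) \<otimes> y [^] (n * m) = (x [^] n) [^] m \<otimes> (y [^] m) [^] n"
    using n m by (simp add: int_pow_pow mult.commute)
  also have "modz \<dots> ((a [^] i \<otimes> b [^] j) [^] m \<otimes> (a [^] k \<otimes> b [^] l) [^] n)"
    by (intro modz_mult modz_pow n m)
  also have "modz \<dots> ((a [^] (i * m) \<otimes> b [^] (j * m)) \<otimes> (a [^] (k * n) \<otimes> b [^] (l * n)))"
    by (intro modz_mult modz_ab_pow)
  also have "modz \<dots> (a [^] (i * m + k * n) \<otimes> b [^] (j * m + l * n))"
    by (rule modz_ab_mult)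
  finally show "x \<otimes> y \<in> ab_isolator"
    using n m by (intro ab_isolatorI[of _ "n * m"]) auto
next
  fix x assume x: "x \<in> ab_isolator"
  obtain n i j :: int where n: "x \<in> carrier G" "n \<noteq> 0" "modz (x [^] n) (a [^] i \<otimes> b [^] j)"
    using x by (rule ab_isolatorE)
  have "(inv x) [^] n = (x [^] n) [^] (-1 :: int)"
    using n(1) by (simp add: int_pow_inv int_pow_neg)
  also have "modz \<dots> ((a [^] i \<otimes> b [^] j) [^] (-1 :: int))"
    by (rule modz_pow) (rule n)
  also have "modz \<dots> (a [^] (i * -1) \<otimes> b [^] (j * -1))"
    by (rule modz_ab_pow)
  finally show "inv x \<in> ab_isolator"
    using n by (intro ab_isolatorI[of _ n]) auto
qed

lemma ab_in_isolator: "a \<in> ab_isolator" "b \<in> ab_isolator"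
  by (rule ab_isolatorI[of _ 1 1 0], auto intro: modz_refl)
     (rule ab_isolatorI[of _ 1 0 1], auto intro: modz_refl)

lemma torsion_le_isolator: "torsion_mod_z \<subseteq> ab_isolator"
proof
  fix x assume "x \<in> torsion_mod_z"
  then obtain n k :: int where "x \<in> carrier G" "n \<noteq> 0" "x [^] n = z [^] k"
    by (rule torsion_mod_zE)
  then show "x \<in> ab_isolator"
    by (intro ab_isolatorI[of _ n 0 0]) (auto simp: modz_def sh_one)
qed

text \<open>Orthogonality passes to powers, so the exponents of a and b in a power that lies in the
  plane must vanish.\<close>

lemma orth_isolator_torsion: "x \<in> orth_ab \<Longrightarrow> x \<in> ab_isolator \<Longrightarrow> x \<in> torsion_mod_z"
proof -
  assume x: "x \<in> orth_ab" "x \<in> ab_isolator"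
  obtain n i j :: int where n: "x \<in> carrier G" "n \<noteq> 0" "modz (x [^] n) (a [^] i \<otimes> b [^] j)"
    using x(2) by (rule ab_isolatorE)
  have "i = 0" "j = 0"
    using coord_modz[OF n(3)] x(1) n(1) by (simp_all add: orth_ab_def)
  then show ?thesis using n by (intro torsion_if_modz_one[of _ n]) auto
qed

lemma ab_isolator_normal: "ab_isolator \<lhd> G"
  unfolding normal_inv_iff
proof (intro conjI ballI ab_isolator_subgroup)
  fix x h assume x: "x \<in> carrier G" and h: "h \<in> ab_isolator"
  then have hc: "h \<in> carrier G" by (auto simp: ab_isolator_def)
  have "x \<otimes> h \<otimes> inv x = sh h (\<omega> x h)"
    using x hc by (simp add: swap[OF x hc] m_assoc)
  then show "x \<otimes> h \<otimes> inv x \<in> ab_isolator" using ab_isolator_sh[OF h] by simp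
qed

text \<open>Splitting off the plane spanned by \<open>a\<close> and \<open>b\<close> together with the torsion modulo \<open>z\<close>
  leaves a free abelian group; its coordinates are extended by zero on that plane.\<close>

lemma orth_coordinates:
  assumes S: "finite S" "S \<subseteq> carrier G" "generate G S = carrier G"
  obtains I :: "'a set set" and y and l :: "'a set \<Rightarrow> 'a \<Rightarrow> int" where
    "finite I" "\<forall>i\<in>I. y i \<in> orth_ab" "\<forall>i\<in>I. int_hom_on (carrier G) (l i)"
    "\<forall>i\<in>I. \<forall>j\<in>I. l i (y j) = (if i = j then 1 else 0)"
    "\<forall>i\<in>I. \<forall>x\<in>torsion_mod_z. l i x = 0"
    "\<forall>x\<in>orth_ab. (\<forall>i\<in>I. l i x = 0) \<longrightarrow> x \<in> torsion_mod_z"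
proof -
  define Q where "Q = G Mod ab_isolator"
  define q where "q x = ab_isolator #> x" for x
  interpret N: normal ab_isolator G by (rule ab_isolator_normal)
  have Q_group: "group Q" unfolding Q_def by (rule N.factorgroup_is_group)
  have q_hom: "q \<in> hom G Q" unfolding q_def Q_def by (rule N.r_coset_hom_Mod)
  have Q_carrier: "carrier Q = q ` carrier G"
    unfolding Q_def q_def FactGroup_def RCOSETS_def by auto
  interpret q: group_hom G Q q
    using Q_group q_hom by (simp add: group_hom_def group_hom_axioms_def)
  have q_eq: "q x = q y \<longleftrightarrow> x \<otimes> inv y \<in> ab_isolator" if "x \<in> carrier G" "y \<in> carrier G" for x y
    unfolding q_def by (rule rcoset_eq_iff[OF ab_isolator_subgroup that])
  have q_one: "q x = \<one>\<^bsub>Q\<^esub> \<longleftrightarrow> x \<in> ab_isolator" if "x \<in> carrier G" for x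
    using q_eq[OF that one_closed] that by simp
  have "comm_group Q"
    unfolding Q_def using z_torsion torsion_le_isolator by (intro FactGroup_comm_group ab_isolator_normal) blast
  then interpret Q: comm_group Q .
  have gen: "generate Q (q ` S) = carrier Q"
    unfolding q.generate_img[OF S(2)] S(3) Q_carrier ..
  have tf: "\<forall>X\<in>carrier Q. \<forall>n::int. X [^]\<^bsub>Q\<^esub> n = \<one>\<^bsub>Q\<^esub> \<longrightarrow> n \<noteq> 0 \<longrightarrow> X = \<one>\<^bsub>Q\<^esub>"
  proof (intro ballI allI impI)
    fix X and n :: int assume X: "X \<in> carrier Q" "X [^]\<^bsub>Q\<^esub> n = \<one>\<^bsub>Q\<^esub>" "n \<noteq> 0"
    obtain x where x: "x \<in> carrier G" "X = q x" using X(1) unfolding Q_carrier by blast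
    have "q (x [^] n) = \<one>\<^bsub>Q\<^esub>" using X(2) x by (simp add: q.hom_int_pow)
    then have "x [^] n \<in> ab_isolator" using x q_one by simp
    then obtain m i j :: int where m: "m \<noteq> 0" "modz ((x [^] n) [^] m) (a [^] i \<otimes> b [^] j)"
      by (rule ab_isolatorE)
    then have "x \<in> ab_isolator"
      using x X(3) by (intro ab_isolatorI[of _ "n * m"]) (auto simp: int_pow_pow)
    then show "X = \<one>\<^bsub>Q\<^esub>" using x q_one by simp
  qed
  have qS: "finite (q ` S)" "q ` S \<subseteq> carrier Q" using S by auto
  obtain I Y and l' :: "'a set \<Rightarrow> 'a set \<Rightarrow> int" where I: "finite I" "Y \<in> I \<rightarrow> carrier Q"
    and l'_hom: "\<forall>i\<in>I. \<forall>X\<in>carrier Q. \<forall>Z\<in>carrier Q. l' i (X \<otimes>\<^bsub>Q\<^esub> Z) = l' i X + l' i Z"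
    and l'_Y: "\<forall>i\<in>I. \<forall>j\<in>I. l' i (Y j) = (if i = j then 1 else 0)"
    and l'_inj: "\<forall>X\<in>carrier Q. (\<forall>i\<in>I. l' i X = 0) \<longrightarrow> X = \<one>\<^bsub>Q\<^esub>"
    by (rule Q.torsion_free_coordinates[OF qS gen tf])
  define l where "l i x = l' i (q x)" for i x
  have l_hom: "int_hom_on (carrier G) (l i)" if "i \<in> I" for i
    unfolding int_hom_on_def l_def using l'_hom that by simp
  have l_isolator: "l i x = 0" if "i \<in> I" "x \<in> ab_isolator" for i x
  proof -
    have "x \<in> carrier G" using that by simp
    then have "q x = q \<one>" using that q_one by simp
    then show ?thesis
      using int_hom_on_one[OF l_hom[OF that(1)] subgroup_self] by (simp add: l_def)
  qed
  have "\<exists>u\<in>carrier G. q u = Y i" if "i \<in> I" for i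
  proof -
    have "Y i \<in> carrier Q" using I(2) that by auto
    then show ?thesis unfolding Q_carrier by auto
  qed
  then obtain u where u: "\<And>i. i \<in> I \<Longrightarrow> u i \<in> carrier G" "\<And>i. i \<in> I \<Longrightarrow> q (u i) = Y i"
    by metis
  \<comment> \<open>Any preimage becomes orthogonal to \<open>a\<close> and \<open>b\<close> after
    multiplication by powers of them; these lie in the isolator and leave the coordinates
    unchanged.\<close>
  define y where "y i = u i \<otimes> a [^] (- acoord (u i)) \<otimes> b [^] (- bcoord (u i))" for i
  have l_y: "l i (y j) = (if i = j then 1 else 0)" if "i \<in> I" "j \<in> I" for i j
  proof -
    have ab: "a [^] n \<in> ab_isolator" "b [^] n \<in> ab_isolator" for n :: int
      using subgroup_int_pow[OF ab_isolator_subgroup] ab_in_isolator by auto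
    have "l i (y j) = l i (u j)"
      unfolding y_def using u(1)[OF that(2)] ab
      by (simp add: int_hom_on_mult[OF l_hom[OF that(1)]] l_isolator[OF that(1)])
    then show ?thesis using l'_Y that u(2)[OF that(2)] by (simp add: l_def)
  qed
  show ?thesis
  proof (rule that[of I y l]; (intro ballI impI)?)
    show "finite I" by fact
    show "y i \<in> orth_ab" if "i \<in> I" for i
      using u(1)[OF that] by (simp add: y_def orth_ab_def)
    show "int_hom_on (carrier G) (l i)" if "i \<in> I" for i by (rule l_hom[OF that])
    show "l i (y j) = (if i = j then 1 else 0)" if "i \<in> I" "j \<in> I" for i j by (rule l_y[OF that])
    show "l i x = 0" if "i \<in> I" "x \<in> torsion_mod_z" for i x
      using l_isolator that torsion_le_isolator by blast
    show "x \<in> torsion_mod_z" if x: "x \<in> orth_ab" and l0: "\<forall>i\<in>I. l i x = 0" for x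
    proof -
      have xc: "x \<in> carrier G" using x by (simp add: orth_ab_def)
      have "q x = \<one>\<^bsub>Q\<^esub>" using l'_inj l0 q.hom_closed[OF xc] by (simp add: l_def)
      then show ?thesis using orth_isolator_torsion[OF x] q_one[OF xc] by simp
    qed
  qed
qed

lemma central_twist_one: "central_twist K \<sigma> \<Longrightarrow> \<sigma> \<one> = \<one>"
proof -
  assume tw: "central_twist K \<sigma>"
  note t = central_twistD[OF tw]
  interpret K: subgroup K G by (rule t(1))
  have "\<sigma> \<one> \<otimes> \<sigma> \<one> = \<sigma> \<one>" using t(4)[OF K.one_closed K.one_closed] by simp
  then show ?thesis using t(3)[OF K.one_closed] by simp
qed

text \<open>Induction over the set J of coordinates allowed to be nonzero: \<open>K {}\<close> is
  the torsion modulo \<open>z\<close>, with the identity as automorphism, and \<open>K I\<close> is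
  \<open>orth_ab\<close>. Each step adjoins some y i with \<epsilon> = -1. The sign condition of
  \<open>central_twist_extend\<close> holds because \<sigma>(x) x has all coordinates zero, hence is
  torsion modulo \<open>z\<close> and pairs to 0 with y i.\<close>

lemma central_twist_orth:
  assumes S: "finite S" "S \<subseteq> carrier G" "generate G S = carrier G"
  obtains \<sigma> where "central_twist orth_ab \<sigma>" "\<And>x. x \<in> orth_ab \<Longrightarrow> \<sigma> x \<otimes> x \<in> torsion_mod_z"
proof -
  obtain I :: "'a set set" and y and l :: "'a set \<Rightarrow> 'a \<Rightarrow> int" where
    I: "finite I" and y': "\<forall>i\<in>I. y i \<in> orth_ab" and hom': "\<forall>i\<in>I. int_hom_on (carrier G) (l i)"
    and l_y: "\<forall>i\<in>I. \<forall>j\<in>I. l i (y j) = (if i = j then 1 else 0)"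
    and l_T: "\<forall>i\<in>I. \<forall>x\<in>torsion_mod_z. l i x = 0"
    and T: "\<forall>x\<in>orth_ab. (\<forall>i\<in>I. l i x = 0) \<longrightarrow> x \<in> torsion_mod_z"
    by (rule orth_coordinates[OF S])
  note y = bspec[OF y'] and hom = bspec[OF hom']
  define K where "K J = {x \<in> carrier G. \<forall>f \<in> {acoord, bcoord} \<union> l ` (I - J). f x = 0}" for J
  have K_iff: "x \<in> K J \<longleftrightarrow> x \<in> orth_ab \<and> (\<forall>i\<in>I - J. l i x = 0)" for x J
    by (auto simp: K_def orth_ab_def)
  have K_sub: "subgroup (K J) G" for J
    unfolding K_def using hom acoord_hom bcoord_hom by (intro subgroup_common_kernel) auto
  have inverts: "\<sigma> x \<otimes> x \<in> torsion_mod_z"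
    if tw: "central_twist (K J) \<sigma>" and \<sigma>: "\<And>i x. i \<in> I \<Longrightarrow> x \<in> K J \<Longrightarrow> l i (\<sigma> x) = - l i x" and x: "x \<in> K J"
    for \<sigma> J x
  proof (rule T[rule_format])
    have x': "\<sigma> x \<in> K J" using central_twistD(3)[OF tw x] .
    then show "\<sigma> x \<otimes> x \<in> orth_ab" using x unfolding K_iff orth_ab_def by auto
    fix i assume i: "i \<in> I"
    show "l i (\<sigma> x \<otimes> x) = 0"
      using int_hom_on_mult[OF hom[OF i], of "\<sigma> x" x] \<sigma>[OF i x] x x' by (simp add: K_def)
  qed
  have "\<exists>\<sigma>. central_twist (K J) \<sigma> \<and> (\<forall>i\<in>I. \<forall>x\<in>K J. l i (\<sigma> x) = - l i x)" if "J \<subseteq> I" for J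
    using finite_subset[OF that I] that
  proof (induction J rule: finite_induct)
    case empty
    have zK: "z \<in> K {}"
    proof -
      have "sh \<one> 1 = z" using z_closed by (simp add: sh_one)
      then have "z \<in> orth_ab"
        using coord_sh[OF one_closed, of 1] z_closed by (simp add: orth_ab_def)
      then show ?thesis using l_T z_torsion by (simp add: K_iff)
    qed
    have "central_twist (K {}) (\<lambda>x. x)"
      unfolding central_twist_def
    proof (intro conjI ballI allI impI K_sub zK refl)
      fix x k assume "x \<in> K {}" "x = sh x k"
      then show "k = 0" using sh_eq_self[of x k] by (auto simp: K_def)
    qed auto
    moreover have "l i x = - l i x" if "i \<in> I" "x \<in> K {}" for i x
      using that by (simp add: K_iff)
    ultimately show ?case by blast
  next
    case (insert i J)
    then obtain \<sigma> where tw: "central_twist (K J) \<sigma>" and \<sigma>: "\<And>i x. i \<in> I \<Longrightarrow> x \<in> K J \<Longrightarrow> l i (\<sigma> x) = - l i x"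
      by blast
    have i: "i \<in> I" "i \<notin> J" using insert by auto
    have sub: "K J \<subseteq> K (insert i J)" by (auto simp: K_iff)
    have yK: "y i \<in> K (insert i J)" using i y l_y by (auto simp: K_iff)
    have yc: "y i \<in> carrier G" using yK by (simp add: K_def)
    have homK: "int_hom_on (K (insert i J)) (l i)"
      using hom[OF i(1)] unfolding int_hom_on_def by (auto simp: K_def)
    have iff: "\<forall>x\<in>K (insert i J). x \<in> K J \<longleftrightarrow> l i x = 0"
      using i by (auto simp: K_iff)
    have orth: "\<omega> (y i) (\<sigma> x) = -1 * \<omega> (y i) x" if x: "x \<in> K J" for x
    proof -
      have c: "x \<in> carrier G" "\<sigma> x \<in> carrier G"
        using x central_twistD(3)[OF tw x] by (auto simp: K_def)
      have "\<omega> (\<sigma> x \<otimes> x) (y i) = 0"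
        using inverts[OF tw \<sigma> x] yc by (rule torsion_mod_z_\<omega>)
      then show ?thesis
        using c yc \<omega>_antisym[of x "y i"] \<omega>_antisym[of "\<sigma> x" "y i"] by (simp add: \<omega>_mult_left)
    qed
    have sq: "(-1) * (-1) = (1::int)" by simp
    have orth: "\<forall>x\<in>K J. \<omega> (y i) (\<sigma> x) = -1 * \<omega> (y i) x" using orth by blast
    note ext = central_twist_extend[OF tw K_sub sub yK homK _ iff sq orth]
    define \<tau> where "\<tau> = (\<lambda>x. \<sigma> (x \<otimes> y i [^] (- l i x)) \<otimes> y i [^] (-1 * l i x))"
    have ly1: "l i (y i) = 1" using l_y i by simp
    have tw': "central_twist (K (insert i J)) \<tau>"
      unfolding \<tau>_def by (rule ext(1)[OF ly1])
    moreover have "l j (\<tau> x) = - l j x" if j: "j \<in> I" and x: "x \<in> K (insert i J)" for j x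
    proof -
      obtain k where k: "k \<in> K J" "x = k \<otimes> y i [^] l i x"
        using ext(3)[OF ly1 x] by blast
      define n where "n = l i x"
      have kx: "x = k \<otimes> y i [^] n" using k(2) by (simp only: n_def)
      have c: "k \<in> carrier G" "\<sigma> k \<in> carrier G" "y i [^] m \<in> carrier G" for m :: int
        using k(1) central_twistD(3)[OF tw k(1)] yc by (auto simp: K_def)
      have t: "\<tau> x = \<sigma> k \<otimes> y i [^] (-1 * n)"
        unfolding kx \<tau>_def by (rule ext(2)[OF ly1 k(1)])
      have pw: "l j (y i [^] m) = m * l j (y i)" for m :: int
        using int_hom_on_pow[OF hom[OF j] subgroup_self yc] .
      have "l j (\<tau> x) = l j (\<sigma> k) + - n * l j (y i)"
        unfolding t int_hom_on_mult[OF hom[OF j] c(2,3)] pw by simp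
      moreover have "l j x = l j k + n * l j (y i)"
        unfolding kx int_hom_on_mult[OF hom[OF j] c(1,3)] pw ..
      ultimately show ?thesis using \<sigma>[OF j k(1)] by simp
    qed
    ultimately show ?case by blast
  qed
  from this[of I] obtain \<sigma> where tw: "central_twist (K I) \<sigma>" "\<And>i x. i \<in> I \<Longrightarrow> x \<in> K I \<Longrightarrow> l i (\<sigma> x) = - l i x"
    by blast
  have "K I = orth_ab" by (auto simp: K_iff)
  then show ?thesis using that[of \<sigma>] tw inverts[OF tw] by simp
qed

text \<open>Two more extensions, by \<open>b\<close> and then by \<open>a\<close>, now with
  \<epsilon> = 1. Their conditions say that the pairings with \<open>b\<close> and with
  \<open>a\<close> are preserved: on \<open>orth_ab\<close> the former vanishes, and the extension
  by \<open>b\<close> keeps \<open>bcoord\<close>.\<close>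

lemma exists_plane_fixing_twist:
  assumes S: "finite S" "S \<subseteq> carrier G" "generate G S = carrier G"
  obtains \<psi> where "central_twist (carrier G) \<psi>" "\<psi> a = a" "\<psi> b = b"
    "\<And>x. x \<in> carrier G \<Longrightarrow> acoord (\<psi> x) = acoord x" "\<And>x. x \<in> carrier G \<Longrightarrow> bcoord (\<psi> x) = bcoord x"
    "\<And>x. x \<in> orth_ab \<Longrightarrow> \<psi> x \<otimes> x \<in> torsion_mod_z"
proof -
  obtain \<sigma> where tw: "central_twist orth_ab \<sigma>" and inv: "\<And>x. x \<in> orth_ab \<Longrightarrow> \<sigma> x \<otimes> x \<in> torsion_mod_z"
    using central_twist_orth[OF S] by blast
  have orth: "x \<in> orth_ab \<Longrightarrow> x \<in> carrier G \<and> acoord x = 0 \<and> bcoord x = 0" for x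
    by (simp add: orth_ab_def)
  define K where "K = {x \<in> carrier G. \<forall>f \<in> {acoord}. f x = 0}"
  have K_sub: "subgroup K G" unfolding K_def using acoord_hom by (intro subgroup_common_kernel) simp
  have sub: "orth_ab \<subseteq> K" by (auto simp: K_def orth_ab_def)
  have bK: "b \<in> K" by (simp add: K_def)
  have homK: "int_hom_on K bcoord" using bcoord_hom unfolding int_hom_on_def K_def by auto
  have iffK: "\<forall>x\<in>K. x \<in> orth_ab \<longleftrightarrow> bcoord x = 0" by (auto simp: K_def orth_ab_def)
  have sq: "1 * 1 = (1::int)" by simp
  have orthK: "\<forall>x\<in>orth_ab. \<omega> b (\<sigma> x) = 1 * \<omega> b x"
  proof
    fix x assume x: "x \<in> orth_ab"
    show "\<omega> b (\<sigma> x) = 1 * \<omega> b x"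
      using orth[OF x] orth[OF central_twistD(3)[OF tw x]] \<omega>_antisym[of x b] \<omega>_antisym[of "\<sigma> x" b]
      by (simp add: acoord_def)
  qed
  note extK = central_twist_extend[OF tw K_sub sub bK homK coord_ab(4) iffK sq orthK]
  define \<tau> where "\<tau> = (\<lambda>x. \<sigma> (x \<otimes> b [^] (- bcoord x)) \<otimes> b [^] (1 * bcoord x))"
  have tw\<tau>: "central_twist K \<tau>" unfolding \<tau>_def by (rule extK(1))
  have \<tau>: "\<tau> (k \<otimes> b [^] n) = \<sigma> k \<otimes> b [^] n" if "k \<in> orth_ab" for k and n :: int
    unfolding \<tau>_def using extK(2)[OF that, of n] by (simp only: mult_1)
  have \<tau>_orth: "\<tau> k = \<sigma> k" if "k \<in> orth_ab" for k
    using \<tau>[OF that, of 0] orth[OF that] orth[OF central_twistD(3)[OF tw that]] by simp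
  have bcoord_\<tau>: "bcoord (\<tau> x) = bcoord x" if x: "x \<in> K" for x
  proof -
    obtain k where k: "k \<in> orth_ab" "x = k \<otimes> b [^] bcoord x"
      using extK(3)[OF x] by blast
    define n where "n = bcoord x"
    have kx: "x = k \<otimes> b [^] n" using k(2) by (simp only: n_def)
    show ?thesis
      unfolding kx \<tau>[OF k(1)] using orth[OF k(1)] orth[OF central_twistD(3)[OF tw k(1)]] by simp
  qed
  have subG: "K \<subseteq> carrier G" by (auto simp: K_def)
  have iffG: "\<forall>x\<in>carrier G. x \<in> K \<longleftrightarrow> acoord x = 0" by (auto simp: K_def)
  have K_coord: "x \<in> K \<Longrightarrow> x \<in> carrier G \<and> acoord x = 0" for x by (simp add: K_def)
  have orthG: "\<forall>x\<in>K. \<omega> a (\<tau> x) = 1 * \<omega> a x"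
    using bcoord_\<tau> by (simp add: bcoord_def)
  note extG = central_twist_extend[OF tw\<tau> subgroup_self subG a_closed acoord_hom coord_ab(1) iffG sq orthG]
  define \<psi> where "\<psi> = (\<lambda>x. \<tau> (x \<otimes> a [^] (- acoord x)) \<otimes> a [^] (1 * acoord x))"
  have tw\<psi>: "central_twist (carrier G) \<psi>" unfolding \<psi>_def by (rule extG(1))
  have \<psi>: "\<psi> (k \<otimes> a [^] n) = \<tau> k \<otimes> a [^] n" if "k \<in> K" for k and n :: int
    unfolding \<psi>_def using extG(2)[OF that, of n] by (simp only: mult_1)
  have \<psi>_K: "\<psi> k = \<tau> k" if "k \<in> K" for k
    using \<psi>[OF that, of 0] K_coord[OF that] K_coord[OF central_twistD(3)[OF tw\<tau> that]] by simp
  have one_orth: "\<one> \<in> orth_ab" by (simp add: orth_ab_def)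
  have coords: "acoord (\<psi> x) = acoord x \<and> bcoord (\<psi> x) = bcoord x" if x: "x \<in> carrier G" for x
  proof -
    obtain k where k: "k \<in> K" "x = k \<otimes> a [^] acoord x"
      using extG(3)[OF x] by blast
    define n where "n = acoord x"
    have kx: "x = k \<otimes> a [^] n" using k(2) by (simp only: n_def)
    show ?thesis
      unfolding kx \<psi>[OF k(1)]
      using K_coord[OF k(1)] K_coord[OF central_twistD(3)[OF tw\<tau> k(1)]] bcoord_\<tau>[OF k(1)] by simp
  qed
  show ?thesis
  proof (rule that[of \<psi>])
    show "central_twist (carrier G) \<psi>" by fact
    show "\<psi> a = a"
      using \<psi>[of \<one> 1] \<tau>_orth[OF one_orth] central_twist_one[OF tw] sub one_orth by auto
    show "\<psi> b = b"
      using \<psi>_K[OF bK] \<tau>[OF one_orth, of 1] central_twist_one[OF tw] by simp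
    show "acoord (\<psi> x) = acoord x" "bcoord (\<psi> x) = bcoord x" if "x \<in> carrier G" for x
      using coords[OF that] by auto
    show "\<psi> x \<otimes> x \<in> torsion_mod_z" if "x \<in> orth_ab" for x
      using inv[OF that] \<psi>_K \<tau>_orth[OF that] sub that by auto
  qed
qed

end

section \<open>Word norms and twisted classes\<close>

context group
begin

definition word_prod :: "'a list \<Rightarrow> 'a" where "word_prod ws = foldr (\<lambda>x y. x \<otimes> y) ws \<one>"

definition letters :: "'a set \<Rightarrow> 'a set" where "letters S = S \<union> (\<lambda>s. inv s) ` S"

lemma letters_closed: "S \<subseteq> carrier G \<Longrightarrow> letters S \<subseteq> carrier G"
  by (auto simp: letters_def)

lemma word_prod_simps [simp]: "word_prod [] = \<one>" "word_prod (x # ws) = x \<otimes> word_prod ws"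
  by (simp_all add: word_prod_def)

lemma word_prod_closed [simp]: "set ws \<subseteq> carrier G \<Longrightarrow> word_prod ws \<in> carrier G"
  by (induction ws) auto

lemma word_prod_append:
  "set ws \<subseteq> carrier G \<Longrightarrow> set vs \<subseteq> carrier G \<Longrightarrow> word_prod (ws @ vs) = word_prod ws \<otimes> word_prod vs"
  by (induction ws) (auto simp: m_assoc)

lemma generate_word:
  assumes S: "S \<subseteq> carrier G" and x: "x \<in> generate G S"
  shows "\<exists>ws. set ws \<subseteq> letters S \<and> word_prod ws = x"
  using x
proof (induction rule: generate.induct)
  case one
  show ?case by (rule exI[of _ "[]"]) simp
next
  case (incl h)
  then show ?case using S by (intro exI[of _ "[h]"]) (auto simp: letters_def)
next
  case (inv h)
  then show ?case using S by (intro exI[of _ "[inv h]"]) (auto simp: letters_def)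
next
  case (eng g h)
  then obtain ws vs where "set ws \<subseteq> letters S" "word_prod ws = g" "set vs \<subseteq> letters S" "word_prod vs = h"
    by blast
  then show ?case
    using word_prod_append[of ws vs] letters_closed[OF S] by (intro exI[of _ "ws @ vs"]) auto
qed

lemma word_norm_alt: "word_norm G S g = (LEAST n. \<exists>ws. length ws = n \<and> set ws \<subseteq> letters S \<and> word_prod ws = g)"
  by (simp add: word_norm_def letters_def word_prod_def)

lemma word_norm_le: "set ws \<subseteq> letters S \<Longrightarrow> word_norm G S (word_prod ws) \<le> length ws"
  unfolding word_norm_alt by (intro Least_le) blast

lemma word_norm_word:
  assumes "finite_generating_set G S" "x \<in> carrier G"
  obtains ws where "length ws = word_norm G S x" "set ws \<subseteq> letters S" "word_prod ws = x"
proof -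
  have "S \<subseteq> carrier G" "x \<in> generate G S" using assms by (auto simp: finite_generating_set_def)
  then have "\<exists>n ws. length ws = n \<and> set ws \<subseteq> letters S \<and> word_prod ws = x"
    using generate_word by blast
  from LeastI_ex[OF this] show ?thesis unfolding word_norm_alt[symmetric] using that by blast
qed

lemma word_norm_one: "word_norm G S \<one> = 0"
  using word_norm_le[of "[]" S] by simp

lemma word_norm_mult:
  assumes "finite_generating_set G S" "x \<in> carrier G" "y \<in> carrier G"
  shows "word_norm G S (x \<otimes> y) \<le> word_norm G S x + word_norm G S y"
proof -
  obtain ws where ws: "length ws = word_norm G S x" "set ws \<subseteq> letters S" "word_prod ws = x"
    using assms(1,2) by (rule word_norm_word)
  obtain vs where vs: "length vs = word_norm G S y" "set vs \<subseteq> letters S" "word_prod vs = y"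
    using assms(1,3) by (rule word_norm_word)
  have "letters S \<subseteq> carrier G"
    using assms(1) by (intro letters_closed) (simp add: finite_generating_set_def)
  then have "word_prod (ws @ vs) = x \<otimes> y" using ws vs by (subst word_prod_append) auto
  then show ?thesis using word_norm_le[of "ws @ vs" S] ws vs by simp
qed

lemma word_norm_pow:
  assumes "finite_generating_set G S" "x \<in> carrier G"
  shows "word_norm G S (x [^] (n::nat)) \<le> n * word_norm G S x"
proof (induction n)
  case (Suc n)
  have "word_norm G S (x [^] Suc n) \<le> word_norm G S (x [^] n) + word_norm G S x"
    using word_norm_mult[OF assms(1) nat_pow_closed[OF assms(2)] assms(2)] by simp
  with Suc show ?case by simp
qed (simp add: word_norm_one)

lemma finite_word_ball:
  assumes "finite_generating_set G S"
  shows "finite {x \<in> carrier G. word_norm G S x \<le> n}"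
proof (rule finite_subset)
  have "finite (letters S)" using assms by (simp add: letters_def finite_generating_set_def)
  then show "finite (word_prod ` {ws. set ws \<subseteq> letters S \<and> length ws \<le> n})"
    by (intro finite_imageI finite_lists_length_le)
  show "{x \<in> carrier G. word_norm G S x \<le> n} \<subseteq> word_prod ` {ws. set ws \<subseteq> letters S \<and> length ws \<le> n}"
  proof safe
    fix x assume x: "x \<in> carrier G" "word_norm G S x \<le> n"
    obtain ws where ws: "length ws = word_norm G S x" "set ws \<subseteq> letters S" "word_prod ws = x"
      using assms x(1) by (rule word_norm_word)
    show "x \<in> word_prod ` {ws. set ws \<subseteq> letters S \<and> length ws \<le> n}"
      using x ws by (intro image_eqI[of _ _ ws]) auto
  qed
qed

lemma int_hom_on_word_bound:
  assumes "int_hom_on (carrier G) h" "S \<subseteq> carrier G" "\<And>s. s \<in> letters S \<Longrightarrow> \<bar>h s\<bar> \<le> M"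
  shows "set ws \<subseteq> letters S \<Longrightarrow> \<bar>h (word_prod ws)\<bar> \<le> M * int (length ws)"
proof (induction ws)
  case Nil
  show ?case using int_hom_on_one[OF assms(1) subgroup_self] by simp
next
  case (Cons s ws)
  have c: "s \<in> carrier G" "word_prod ws \<in> carrier G"
    using Cons.prems letters_closed[OF assms(2)] by auto
  have "\<bar>h s\<bar> \<le> M" using Cons.prems by (intro assms(3)) simp
  then show ?case
    using Cons int_hom_on_mult[OF assms(1) c] by (simp add: distrib_left)
qed

end

lemma finite_int_bound: "finite A \<Longrightarrow> \<exists>M::int. M \<ge> 0 \<and> (\<forall>s\<in>A. \<bar>h s\<bar> \<le> M)"
  by (intro exI[of _ "\<Sum>s\<in>A. \<bar>h s\<bar>"]) (auto intro: sum_nonneg member_le_sum[of _ A "\<lambda>s. \<bar>h s\<bar>"])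

text \<open>Exponents may be reduced modulo m, so finitely many combinations of the generators
  exhaust the group.\<close>

lemma (in comm_group) finite_if_finite_exponent:
  assumes S: "finite S" "S \<subseteq> carrier G" "generate G S = carrier G"
    and m: "m > 0" "\<And>x. x \<in> carrier G \<Longrightarrow> x [^] (m::int) = \<one>"
  shows "finite (carrier G)"
proof (rule finite_subset)
  have id: "(\<lambda>s. s) \<in> S \<rightarrow> carrier G" using S by auto
  show "finite (int_comb S (\<lambda>s. s) ` (S \<rightarrow>\<^sub>E {0..<m}))"
    using S(1) by (intro finite_imageI finite_PiE) auto
  show "carrier G \<subseteq> int_comb S (\<lambda>s. s) ` (S \<rightarrow>\<^sub>E {0..<m})"
  proof
    fix x assume x: "x \<in> carrier G"
    then obtain e where e: "x = int_comb S (\<lambda>s. s) e"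
      using generate_int_comb[OF S(1,2), of x] S(3) by blast
    have pow: "s [^] (e s mod m) = s [^] e s" if "s \<in> S" for s
    proof -
      have sc: "s \<in> carrier G" using that S by auto
      have "s [^] e s = s [^] (m * (e s div m) + e s mod m)" by simp
      also have "\<dots> = (s [^] m) [^] (e s div m) \<otimes> s [^] (e s mod m)"
        unfolding int_pow_mult[OF sc] int_pow_pow[OF sc] ..
      also have "\<dots> = s [^] (e s mod m)" unfolding m(2)[OF sc] using sc by simp
      finally show ?thesis ..
    qed
    have "int_comb S (\<lambda>s. s) (restrict (\<lambda>s. e s mod m) S) = int_comb S (\<lambda>s. s) e"
      unfolding int_comb_def using pow S by (intro finprod_cong') auto
    then show "x \<in> int_comb S (\<lambda>s. s) ` (S \<rightarrow>\<^sub>E {0..<m})"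
      using m(1) unfolding e by (intro image_eqI[of _ _ "restrict (\<lambda>s. e s mod m) S"]) auto
  qed
qed

lemma (in group) twisted_class_eqI:
  assumes "\<psi> \<in> hom G G" and xy: "x \<in> carrier G" "y \<in> carrier G" "twisted_conjugate G \<psi> x y"
  shows "twisted_class G \<psi> x = twisted_class G \<psi> y"
proof -
  interpret \<psi>: group_hom G G \<psi> using assms(1) by (simp add: group_hom_def group_hom_axioms_def is_group)
  have trans: "twisted_conjugate G \<psi> u w" if uv: "u \<in> carrier G" "v \<in> carrier G" "twisted_conjugate G \<psi> u v" "twisted_conjugate G \<psi> v w" for u v w
  proof -
    obtain g where g: "g \<in> carrier G" "g \<otimes> u \<otimes> inv \<psi> g = v"
      using uv(3) unfolding twisted_conjugate_def by (elim bexE)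
    obtain h where h: "h \<in> carrier G" "h \<otimes> v \<otimes> inv \<psi> h = w"
      using uv(4) unfolding twisted_conjugate_def by (elim bexE)
    have "(h \<otimes> g) \<otimes> u \<otimes> inv \<psi> (h \<otimes> g) = h \<otimes> (g \<otimes> u \<otimes> inv \<psi> g) \<otimes> inv \<psi> h"
      using g(1) h(1) uv(1) by (simp add: m_assoc inv_mult_group)
    then have "(h \<otimes> g) \<otimes> u \<otimes> inv \<psi> (h \<otimes> g) = w" using g h by simp
    then show ?thesis unfolding twisted_conjugate_def using g(1) h(1) by blast
  qed
  have sym: "twisted_conjugate G \<psi> v u" if uv: "u \<in> carrier G" "twisted_conjugate G \<psi> u v" for u v
  proof -
    obtain g where g: "g \<in> carrier G" "g \<otimes> u \<otimes> inv \<psi> g = v"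
      using uv(2) unfolding twisted_conjugate_def by (elim bexE)
    have vg: "v \<otimes> \<psi> g = g \<otimes> u" using g(1) uv(1) unfolding g(2)[symmetric] by (simp add: m_assoc)
    have "inv g \<otimes> v \<otimes> \<psi> g = inv g \<otimes> (g \<otimes> u)"
    proof -
      have "v \<in> carrier G" unfolding g(2)[symmetric] using g(1) uv(1) by simp
      then show ?thesis using g(1) uv(1) vg by (simp add: m_assoc)
    qed
    also have "\<dots> = u" using g(1) uv(1) by (simp add: m_assoc[symmetric])
    finally have "inv g \<otimes> v \<otimes> inv \<psi> (inv g) = u" using g(1) by simp
    then show ?thesis unfolding twisted_conjugate_def using g(1) by blast
  qed
  show ?thesis
    unfolding twisted_class_def using trans sym xy by blast
qed

lemma (in group) twisted_class_eqD:
  assumes "\<psi> \<in> hom G G" "y \<in> carrier G" "twisted_class G \<psi> x = twisted_class G \<psi> y"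
  shows "twisted_conjugate G \<psi> x y"
proof -
  have "\<psi> \<one> = \<one>" using hom_one[OF assms(1) is_group is_group] .
  then have "twisted_conjugate G \<psi> y y"
    unfolding twisted_conjugate_def using assms(2) by (intro bexI[of _ \<one>]) auto
  then have "y \<in> twisted_class G \<psi> y" using assms(2) by (simp add: twisted_class_def)
  then have "y \<in> twisted_class G \<psi> x" using assms(3) by simp
  then show ?thesis by (simp add: twisted_class_def)
qed

section \<open>Counting twisted classes\<close>

locale heisenberg_twist = heisenberg +
  fixes \<psi>
  assumes twist: "central_twist (carrier G) \<psi>" and \<psi>_a: "\<psi> a = a" and \<psi>_b: "\<psi> b = b"
    and acoord_\<psi> [simp]: "x \<in> carrier G \<Longrightarrow> acoord (\<psi> x) = acoord x"
    and bcoord_\<psi> [simp]: "x \<in> carrier G \<Longrightarrow> bcoord (\<psi> x) = bcoord x"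
    and \<psi>_orth: "x \<in> orth_ab \<Longrightarrow> \<psi> x \<otimes> x \<in> torsion_mod_z"
begin

lemma \<psi>_hom: "\<psi> \<in> hom G G"
  using central_twistD(3,4)[OF twist] by (auto simp: hom_def)

sublocale \<psi>: group_hom G G \<psi>
  using \<psi>_hom by (simp add: group_hom_def group_hom_axioms_def is_group)

lemma \<psi>_iso: "\<psi> \<in> iso G G"
proof -
  have "bij_betw \<psi> (carrier G) (carrier G)"
    using central_twistD(5)[OF twist] by (intro bij_betw_byWitness[of _ \<psi>]) auto
  then show ?thesis using \<psi>_hom by (simp add: iso_def)
qed

lemma \<psi>_sh [simp]: "x \<in> carrier G \<Longrightarrow> \<psi> (sh x k) = sh (\<psi> x) k"
  by (rule central_twist_sh[OF twist])

abbreviation tclass :: "'a \<Rightarrow> 'a set" where "tclass x \<equiv> twisted_class G \<psi> x"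

lemma tclass_eqI:
  assumes "x \<in> carrier G" "g \<in> carrier G" "g \<otimes> x \<otimes> inv \<psi> g = y"
  shows "tclass x = tclass y"
proof (rule twisted_class_eqI[OF \<psi>_hom])
  show "twisted_conjugate G \<psi> x y" using assms(2,3) unfolding twisted_conjugate_def by blast
  show "y \<in> carrier G" unfolding assms(3)[symmetric] using assms(1,2) by simp
qed fact

lemma tclass_eqD:
  assumes "y \<in> carrier G" "tclass x = tclass y"
  obtains g where "g \<in> carrier G" "g \<otimes> x \<otimes> inv \<psi> g = y"
  using twisted_class_eqD[OF \<psi>_hom assms] unfolding twisted_conjugate_def by blast

lemma tclass_sh:
  assumes "x \<in> carrier G" "y \<in> carrier G" "tclass x = tclass y"
  shows "tclass (sh x k) = tclass (sh y k)"
proof -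
  obtain g where g: "g \<in> carrier G" "g \<otimes> x \<otimes> inv \<psi> g = y"
    using assms(2,3) by (rule tclass_eqD)
  have "g \<otimes> sh x k \<otimes> inv \<psi> g = sh (g \<otimes> x \<otimes> inv \<psi> g) k" using g(1) assms(1) by simp
  also note g(2)
  finally show ?thesis using assms(1) g(1) by (intro tclass_eqI[of _ g]) auto
qed

section \<open>Lower bound: distinct classes over the plane\<close>

definition \<psi>_ball :: "'a set \<Rightarrow> nat \<Rightarrow> 'a set" where
  "\<psi>_ball S n = {x \<in> carrier G. word_norm G S x \<le> n}"

lemma twisted_growth_alt: "twisted_growth G \<psi> S n = card (tclass ` \<psi>_ball S n)"
  unfolding twisted_growth_def \<psi>_ball_def by (rule arg_cong[of _ _ card]) auto

text \<open>\<psi> preserves the coordinates, so i and j are invariants. With h = a^i b^j the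
  conjugation equation then reads \<psi>(g) = g z^(\<omega>(g, h) + k - k'), and the last clause of
  \<open>central_twist\<close> turns it into k' - k = \<omega>(g, h), an integer combination of i
  and j.\<close>

lemma tclass_ab_distinct:
  fixes i j i' j' k k' :: int
  assumes "tclass (sh (a [^] i \<otimes> b [^] j) k) = tclass (sh (a [^] i' \<otimes> b [^] j') k')"
  shows "i' = i \<and> j' = j \<and> gcd i j dvd k' - k"
proof -
  define h where "h = a [^] i \<otimes> b [^] j"
  define h' where "h' = a [^] i' \<otimes> b [^] j'"
  have h: "h \<in> carrier G" "acoord h = i" "bcoord h = j" "h' \<in> carrier G" "acoord h' = i'" "bcoord h' = j'"
    by (simp_all add: h_def h'_def)
  have "sh h' k' \<in> carrier G" using h by simp
  then obtain g where g: "g \<in> carrier G" "g \<otimes> sh h k \<otimes> inv \<psi> g = sh h' k'"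
    using assms unfolding h_def[symmetric] h'_def[symmetric] by (rule tclass_eqD)
  have "i' = i" "j' = j"
    using arg_cong[OF g(2), of acoord] arg_cong[OF g(2), of bcoord] g(1) h by simp_all
  then have "h' = h" by (simp add: h_def h'_def)
  have \<psi>g: "\<psi> g \<in> carrier G" using g(1) by simp
  have "g \<otimes> sh h k = g \<otimes> sh h k \<otimes> inv \<psi> g \<otimes> \<psi> g"
    using g(1) h(1) by (simp add: m_assoc)
  also have "\<dots> = sh (h \<otimes> \<psi> g) k'"
    unfolding g(2) \<open>h' = h\<close> using \<psi>g h(1) by simp
  finally have "sh (h \<otimes> g) (\<omega> g h + k) = sh (h \<otimes> \<psi> g) k'"
    using swap[OF g(1) h(1)] g(1) h(1) by simp
  then have "h \<otimes> sh g (\<omega> g h + k) = h \<otimes> sh (\<psi> g) k'"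
    using g(1) \<psi>g h(1) by simp
  then have "sh g (\<omega> g h + k) = sh (\<psi> g) k'"
    using g(1) \<psi>g h(1) by (simp del: sh_mult_right)
  from arg_cong[OF this, of "\<lambda>x. sh x (- k')"] have "\<psi> g = sh g (\<omega> g h + k - k')"
    using g(1) \<psi>g by simp
  from central_twistD(7)[OF twist g(1) this] have "k' - k = \<omega> g h" by simp
  also have "\<omega> g h = i * \<omega> g a + j * \<omega> g b"
    unfolding h_def using g(1) by (simp add: \<omega>_mult_right)
  finally show ?thesis using \<open>i' = i\<close> \<open>j' = j\<close> by simp
qed

text \<open>In the representatives a^i b^j z^k with k < gcd(i, j) and i, j \<le> m also k \<le> m,
  so writing z^k as a k-fold product is short enough: the length stays linear in m.\<close>

lemma twisted_growth_lower:
  assumes S: "finite_generating_set G S"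
  obtains K :: nat where "K > 0" "\<And>n. gcd_sum (n div K) \<le> twisted_growth G \<psi> S n"
proof
  let ?K = "word_norm G S a + word_norm G S b + word_norm G S z + 1"
  show "?K > 0" by simp
  fix n
  define m where "m = n div ?K"
  define P where "P = (SIGMA i:{1..m}. SIGMA j:{1..m}. {..<gcd i j})"
  define F where "F = (\<lambda>(i, j, k). tclass (sh (a [^] int i \<otimes> b [^] int j) (int k)))"
  have "card P = (\<Sum>i=1..m. card (SIGMA j:{1..m}. {..<gcd i j}))"
    unfolding P_def by (rule card_SigmaI) auto
  also have "\<dots> = gcd_sum m"
    unfolding gcd_sum_def by (intro sum.cong refl, subst card_SigmaI) auto
  finally have cardP: "card P = gcd_sum m" .
  have "inj_on F P"
  proof (rule inj_onI)
    fix p q assume p: "p \<in> P" "q \<in> P" "F p = F q"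
    obtain i j k where pe: "p = (i, j, k)" by (cases p)
    obtain i' j' k' where qe: "q = (i', j', k')" by (cases q)
    from p(3) have *: "int i' = int i \<and> int j' = int j \<and> gcd (int i) (int j) dvd int k' - int k"
      unfolding F_def pe qe prod.case by (rule tclass_ab_distinct)
    then have "k < gcd i j" "k' < gcd i j" using p(1,2) by (auto simp: P_def pe qe)
    moreover have "[int k' = int k] (mod int (gcd i j))"
      using * by (simp add: cong_iff_dvd_diff)
    ultimately have "k' = k" by (simp add: cong_int_iff cong_less_modulus_unique_nat)
    then show "p = q" using * by (simp add: pe qe)
  qed
  moreover have "F ` P \<subseteq> tclass ` \<psi>_ball S n"
  proof
    fix X assume "X \<in> F ` P"
    then obtain i j k where P: "(i, j, k) \<in> P" and X: "X = tclass (sh (a [^] int i \<otimes> b [^] int j) (int k))"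
      by (auto simp: F_def)
    have "gcd i j \<le> i" using P by (intro gcd_le1_nat) (auto simp: P_def)
    moreover have "i \<le> m" "j \<le> m" "k < gcd i j" using P by (auto simp: P_def)
    ultimately have le: "i \<le> m" "j \<le> m" "k \<le> m" by linarith+
    let ?x = "sh (a [^] int i \<otimes> b [^] int j) (int k)"
    have x: "?x = a [^] i \<otimes> b [^] j \<otimes> z [^] k"
      by (simp add: sh_def int_pow_int)
    have "word_norm G S ?x \<le> word_norm G S (a [^] i) + word_norm G S (b [^] j) + word_norm G S (z [^] k)"
      unfolding x using z_closed
      by (intro order_trans[OF word_norm_mult[OF S]] add_right_mono word_norm_mult[OF S]) auto
    also have "\<dots> \<le> i * word_norm G S a + j * word_norm G S b + k * word_norm G S z"
      using z_closed by (intro add_mono word_norm_pow S) auto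
    also have "\<dots> \<le> m * word_norm G S a + m * word_norm G S b + m * word_norm G S z"
      using le by (intro add_mono mult_right_mono) auto
    also have "\<dots> \<le> m * ?K" by (simp add: algebra_simps)
    also have "\<dots> \<le> n" unfolding m_def by (rule div_times_less_eq_dividend)
    finally have "?x \<in> \<psi>_ball S n" by (simp add: \<psi>_ball_def)
    then show "X \<in> tclass ` \<psi>_ball S n" unfolding X by (rule imageI)
  qed
  moreover have "finite (tclass ` \<psi>_ball S n)"
    unfolding \<psi>_ball_def by (intro finite_imageI finite_word_ball S)
  ultimately have "card P \<le> card (tclass ` \<psi>_ball S n)" by (rule card_inj_on_le)
  then show "gcd_sum (n div ?K) \<le> twisted_growth G \<psi> S n"
    by (simp add: cardP m_def twisted_growth_alt)
qed

section \<open>An invariant for the fibre over the origin\<close>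

definition ab_part :: "'a \<Rightarrow> 'a" where "ab_part x = a [^] (2 * acoord x) \<otimes> b [^] (2 * bcoord x)"

text \<open>For \<open>x\<close> orthogonal to \<open>a\<close> and \<open>b\<close> this is \<open>x \<psi>(x)\<close>, which is invariant under twisted
  conjugation because \<open>\<psi>\<close> is an involution.\<close>

definition tau :: "'a \<Rightarrow> 'a" where "tau x = x \<otimes> \<psi> x \<otimes> inv ab_part x"

lemma ab_part_closed [simp]: "ab_part x \<in> carrier G"
  by (simp add: ab_part_def)

lemma tau_closed [simp]: "x \<in> carrier G \<Longrightarrow> tau x \<in> carrier G"
  by (simp add: tau_def)

lemma tau_ab_part: "x \<in> carrier G \<Longrightarrow> x \<otimes> \<psi> x = tau x \<otimes> ab_part x"
  by (simp add: tau_def m_assoc)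

text \<open>Write x = h c with h = a^i b^j fixed by \<psi> and c orthogonal to the plane. Modulo
  \<open>z\<close>, x \<psi>(x) is h^2 times \<psi>(c) c; \<open>ab_part\<close> cancels h^2, whence
  its doubled exponents, and the rest is torsion by \<open>\<psi>_orth\<close>.\<close>

lemma tau_torsion:
  assumes x: "x \<in> carrier G"
  shows "tau x \<in> torsion_mod_z"
proof -
  define h where "h = a [^] acoord x \<otimes> b [^] bcoord x"
  define c where "c = inv h \<otimes> x"
  have h: "h \<in> carrier G" "\<psi> h = h" "acoord h = acoord x" "bcoord h = bcoord x"
    by (simp_all add: h_def \<psi>.hom_int_pow \<psi>_a \<psi>_b)
  have c: "c \<in> carrier G" "c \<in> orth_ab" "x = h \<otimes> c"
    using x h by (auto simp: c_def orth_ab_def m_assoc[symmetric])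
  have hh: "modz (h \<otimes> h) (ab_part x)"
    using modz_ab_mult[of "acoord x" "bcoord x" "acoord x" "bcoord x"]
    by (simp add: h_def ab_part_def)
  have "modz (x \<otimes> \<psi> x) ((h \<otimes> h) \<otimes> (c \<otimes> \<psi> c))"
    using modz_rearrange[of h c h "\<psi> c"] c h by simp
  also have "modz \<dots> ((c \<otimes> \<psi> c) \<otimes> (h \<otimes> h))"
    using c h by (intro modz_commute) auto
  also have "modz \<dots> ((\<psi> c \<otimes> c) \<otimes> ab_part x)"
    using c by (intro modz_mult modz_commute hh) auto
  finally have "modz (tau x) ((\<psi> c \<otimes> c) \<otimes> ab_part x \<otimes> inv ab_part x)"
    unfolding tau_def by (rule modz_mult) (simp add: modz_refl)
  then have "modz (tau x) (\<psi> c \<otimes> c)" using c by (simp add: m_assoc)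
  then obtain k where "tau x = sh (\<psi> c \<otimes> c) k" unfolding modz_def by blast
  then show ?thesis
    using sh_in_subgroup[OF torsion_mod_z_subgroup z_torsion \<psi>_orth[OF c(2)]] by simp
qed

lemma tau_central: "x \<in> carrier G \<Longrightarrow> y \<in> carrier G \<Longrightarrow> tau x \<otimes> y = y \<otimes> tau x"
  using torsion_mod_z_\<omega>[OF tau_torsion] by (intro commute_if_\<omega>_0) auto

text \<open>A homomorphism up to a bilinear exponent: \<omega>(y, \<psi>(x)) comes from exchanging y
  and \<psi>(x), and the coefficient 4 from moving b^(2 bcoord x) past a^(2 acoord y). The values of
  \<open>tau\<close> are central and pass freely.\<close>

lemma tau_mult:
  assumes "x \<in> carrier G" "y \<in> carrier G"
  shows "tau (x \<otimes> y) = sh (tau x \<otimes> tau y) (\<omega> y (\<psi> x) - 4 * bcoord x * acoord y)"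
proof -
  have ab: "ab_part x \<otimes> ab_part y = sh (ab_part (x \<otimes> y)) (- 4 * bcoord x * acoord y)"
  proof -
    let ?i = "2 * acoord x" and ?j = "2 * bcoord x" and ?k = "2 * acoord y" and ?l = "2 * bcoord y"
    have "\<omega> b a = -1" using \<omega>_antisym[of a b] \<omega>_ab by simp
    have "ab_part x \<otimes> ab_part y = a [^] ?i \<otimes> (b [^] ?j \<otimes> a [^] ?k) \<otimes> b [^] ?l"
      by (simp add: ab_part_def m_assoc)
    also have "\<dots> = sh (a [^] ?i \<otimes> (a [^] ?k \<otimes> b [^] ?j) \<otimes> b [^] ?l) (- (?j * ?k))"
      using \<open>\<omega> b a = -1\<close> by (subst swap[of "b [^] ?j" "a [^] ?k"]) simp_all
    also have "a [^] ?i \<otimes> (a [^] ?k \<otimes> b [^] ?j) \<otimes> b [^] ?l = a [^] (?i + ?k) \<otimes> b [^] (?j + ?l)"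
      by (simp add: int_pow_mult m_assoc)
    finally show ?thesis using assms by (simp add: ab_part_def distrib_left)
  qed
  have c: "\<psi> x \<in> carrier G" "\<psi> y \<in> carrier G" "tau x \<in> carrier G" "tau y \<in> carrier G"
    using assms by auto
  have "(x \<otimes> y) \<otimes> \<psi> (x \<otimes> y) = x \<otimes> (y \<otimes> \<psi> x) \<otimes> \<psi> y"
    using assms c by (simp add: m_assoc)
  also have "\<dots> = sh ((x \<otimes> \<psi> x) \<otimes> (y \<otimes> \<psi> y)) (\<omega> y (\<psi> x))"
    using assms c by (subst swap[of y "\<psi> x"]) (simp_all add: m_assoc)
  also have "(x \<otimes> \<psi> x) \<otimes> (y \<otimes> \<psi> y) = tau x \<otimes> (ab_part x \<otimes> tau y) \<otimes> ab_part y"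
    unfolding tau_ab_part[OF assms(1)] tau_ab_part[OF assms(2)] using c by (simp add: m_assoc)
  also have "ab_part x \<otimes> tau y = tau y \<otimes> ab_part x"
    by (rule tau_central[symmetric]) (use assms in auto)
  also have "tau x \<otimes> (tau y \<otimes> ab_part x) \<otimes> ab_part y = tau x \<otimes> tau y \<otimes> (ab_part x \<otimes> ab_part y)"
    using c by (simp add: m_assoc)
  finally have "(x \<otimes> y) \<otimes> \<psi> (x \<otimes> y)
      = sh (tau x \<otimes> tau y \<otimes> ab_part (x \<otimes> y)) (\<omega> y (\<psi> x) - 4 * bcoord x * acoord y)"
    unfolding ab using c by (simp add: add.commute)
  then have "tau (x \<otimes> y) = sh (tau x \<otimes> tau y \<otimes> ab_part (x \<otimes> y)) (\<omega> y (\<psi> x) - 4 * bcoord x * acoord y)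
      \<otimes> inv ab_part (x \<otimes> y)"
    unfolding tau_def by (simp only:)
  also have "\<dots> = sh (tau x \<otimes> tau y) (\<omega> y (\<psi> x) - 4 * bcoord x * acoord y)"
    using c by (simp add: m_assoc)
  finally show ?thesis .
qed

lemma tau_modz_mult: "x \<in> carrier G \<Longrightarrow> y \<in> carrier G \<Longrightarrow> modz (tau (x \<otimes> y)) (tau x \<otimes> tau y)"
  unfolding modz_def tau_mult by auto

lemma tau_sh: "x \<in> carrier G \<Longrightarrow> tau (sh x k) = sh (tau x) (2 * k)"
  by (simp add: tau_def ab_part_def)

lemma tau_orth: "x \<in> orth_ab \<Longrightarrow> tau x = x \<otimes> \<psi> x"
  by (simp add: tau_def ab_part_def orth_ab_def)

lemma tau_tclass:
  assumes x: "x \<in> orth_ab" and y: "y \<in> orth_ab" and "tclass x = tclass y"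
  shows "tau x = tau y"
proof -
  have c: "x \<in> carrier G" "y \<in> carrier G" using x y by (auto simp: orth_ab_def)
  obtain g where g: "g \<in> carrier G" "g \<otimes> x \<otimes> inv \<psi> g = y"
    using c(2) assms(3) by (rule tclass_eqD)
  have \<psi>\<psi>: "\<psi> (\<psi> g) = g" using central_twistD(5)[OF twist g(1)] .
  have "\<psi> y = \<psi> g \<otimes> \<psi> x \<otimes> inv g"
    unfolding g(2)[symmetric] using g(1) c(1) \<psi>\<psi> by simp
  then have "tau y = (g \<otimes> x \<otimes> inv \<psi> g) \<otimes> (\<psi> g \<otimes> \<psi> x \<otimes> inv g)"
    by (simp only: tau_orth[OF y] g(2))
  also have "\<dots> = g \<otimes> (x \<otimes> \<psi> x) \<otimes> inv g"
  proof -
    have "inv \<psi> g \<otimes> (\<psi> g \<otimes> r) = r" if "r \<in> carrier G" for r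
      using that g(1) by (simp add: m_assoc[symmetric])
    then show ?thesis using g(1) c by (simp add: m_assoc)
  qed
  also have "\<dots> = g \<otimes> tau x \<otimes> inv g"
    unfolding tau_orth[OF x] ..
  also have "\<dots> = tau x \<otimes> g \<otimes> inv g" unfolding tau_central[OF c(1) g(1)] ..
  also have "\<dots> = tau x" using g(1) c by (simp add: m_assoc)
  finally show ?thesis ..
qed

end

section \<open>Sums of gcds over a symmetric box\<close>

lemma sum_symmetric_interval_le:
  fixes h :: "nat \<Rightarrow> nat"
  shows "(\<Sum>i\<in>{- int m..int m}. h (nat \<bar>i\<bar>)) \<le> 2 * (\<Sum>k=0..m. h k)"
proof (induction m)
  case (Suc m)
  have "{- int (Suc m)..int (Suc m)} = insert (- int (Suc m)) (insert (int (Suc m)) {- int m..int m})"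
    by auto
  then have "(\<Sum>i\<in>{- int (Suc m)..int (Suc m)}. h (nat \<bar>i\<bar>))
      = h (Suc m) + (h (Suc m) + (\<Sum>i\<in>{- int m..int m}. h (nat \<bar>i\<bar>)))"
    by (simp add: nat_add_distrib)
  also have "\<dots> \<le> 2 * (\<Sum>k=0..Suc m. h k)"
    using Suc by simp
  finally show ?case .
qed simp

text \<open>The signs cost a factor 4, and 8 m^2 pays for the axes, where gcd(k, 0) = k: they
  contribute at most 4 * 2 * (1 + ... + m).\<close>

lemma sum_gcd_symmetric_le:
  "(\<Sum>i\<in>{- int m..int m}. \<Sum>j\<in>{- int m..int m}. nat (gcd i j)) \<le> 4 * gcd_sum m + 8 * m ^ 2"
proof -
  have "(\<Sum>i\<in>{- int m..int m}. \<Sum>j\<in>{- int m..int m}. nat (gcd i j))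
      = (\<Sum>i\<in>{- int m..int m}. \<Sum>j\<in>{- int m..int m}. gcd (nat \<bar>i\<bar>) (nat \<bar>j\<bar>))"
    unfolding gcd_int_def by simp
  also have "\<dots> \<le> (\<Sum>i\<in>{- int m..int m}. 2 * (\<Sum>l=0..m. gcd (nat \<bar>i\<bar>) l))"
    by (intro sum_mono sum_symmetric_interval_le)
  also have "\<dots> \<le> 2 * (\<Sum>k=0..m. 2 * (\<Sum>l=0..m. gcd k l))"
    by (rule sum_symmetric_interval_le)
  also have "\<dots> = 4 * (\<Sum>k=0..m. \<Sum>l=0..m. gcd k l)"
    by (simp add: sum_distrib_left)
  also have "(\<Sum>k=0..m. \<Sum>l=0..m. gcd k l) = gcd_sum m + 2 * (\<Sum>k=1..m. k)"
  proof -
    have split: "(\<Sum>k=0..m. g k) = g 0 + (\<Sum>k=1..m. g k)" for g :: "nat \<Rightarrow> nat"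
      by (subst sum.atLeast_Suc_atMost) simp_all
    show ?thesis
      unfolding split by (simp add: gcd_sum_def sum.distrib)
  qed
  also have "(\<Sum>k=1..m. k) \<le> (\<Sum>k=1..m. m)" by (intro sum_mono) auto
  then have "4 * (gcd_sum m + 2 * (\<Sum>k=1..m. k)) \<le> 4 * gcd_sum m + 8 * m ^ 2"
    by (simp add: power2_eq_square)
  finally show ?thesis .
qed

context heisenberg_twist
begin

lemma tau_one [simp]: "tau \<one> = \<one>"
  by (simp add: tau_def ab_part_def)

lemma tau_exponent_of:
  assumes "x \<in> carrier G"
  obtains n :: int where "n > 0" "modz (tau x [^] n) \<one>"
proof -
  obtain n k :: int where n: "n \<noteq> 0" "tau x [^] n = z [^] k"
    using tau_torsion[OF assms] by (rule torsion_mod_zE)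
  then have m: "modz (tau x [^] n) \<one>" by (auto simp: modz_def sh_one)
  show ?thesis
  proof (cases "n > 0")
    case True
    then show ?thesis using that m by blast
  next
    case False
    have "modz (tau x [^] (- n)) \<one>"
      using modz_inv[OF m] assms by (simp add: int_pow_neg)
    then show ?thesis using that[of "- n"] False n(1) by simp
  qed
qed

text \<open>Modulo \<open>z\<close>, \<open>tau\<close> is a homomorphism into an abelian torsion
  group, so the product of exponents for finitely many generators serves all elements.\<close>

lemma tau_exponent:
  assumes S: "finite_generating_set G S"
  obtains N :: int where "N > 0" "\<And>x. x \<in> carrier G \<Longrightarrow> modz (tau x [^] N) \<one>"
proof -
  have S': "finite S" "S \<subseteq> carrier G" "generate G S = carrier G"
    using S by (auto simp: finite_generating_set_def)
  have "\<exists>N::int. N > 0 \<and> (\<forall>s\<in>S. modz (tau s [^] N) \<one>)"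
    using S'(1,2)
  proof (induction S rule: finite_induct)
    case empty
    show ?case by (intro exI[of _ 1]) simp
  next
    case (insert s S)
    then obtain N :: int where N: "N > 0" "\<And>s. s \<in> S \<Longrightarrow> modz (tau s [^] N) \<one>" by auto
    have s: "s \<in> carrier G" using insert by simp
    then obtain n :: int where n: "n > 0" "modz (tau s [^] n) \<one>" by (rule tau_exponent_of)
    have "modz (tau s [^] (n * N)) \<one>"
      using modz_pow[OF n(2), of N] s by (simp add: int_pow_pow)
    moreover have "modz (tau t [^] (n * N)) \<one>" if t: "t \<in> S" for t
      using modz_pow[OF N(2)[OF t], of n] t insert.prems by (simp add: int_pow_pow mult.commute subset_iff)
    ultimately show ?case using N(1) n(1) by (intro exI[of _ "n * N"]) auto
  qed
  then obtain N :: int where N: "N > 0" "\<And>s. s \<in> S \<Longrightarrow> modz (tau s [^] N) \<one>" by blast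
  have "modz (tau x [^] N) \<one>" if "x \<in> generate G S" for x
    using that
  proof (induction rule: generate.induct)
    case one
    show ?case by (simp add: modz_refl)
  next
    case (incl h)
    then show ?case by (rule N(2))
  next
    case (inv h)
    have h: "h \<in> carrier G" using inv S' by auto
    have "modz (inv tau h \<otimes> (tau h \<otimes> tau (inv h))) (inv tau h \<otimes> tau \<one>)"
      using h tau_modz_mult[of h "inv h"] by (intro modz_mult modz_refl) (auto intro: modz_sym)
    then have "modz (tau (inv h)) (inv tau h)"
      using h by (simp add: m_assoc[symmetric])
    then have "modz (tau (inv h) [^] N) (inv tau h [^] N)" by (rule modz_pow)
    also have "inv tau h [^] N = inv (tau h [^] N)" using h by (simp add: int_pow_inv)
    also have "modz \<dots> (inv \<one>)" by (intro modz_inv N inv)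
    finally show ?case by simp
  next
    case (eng g h)
    have c: "g \<in> carrier G" "h \<in> carrier G"
      using eng S' generate_in_carrier by auto
    have "modz (tau (g \<otimes> h) [^] N) ((tau g \<otimes> tau h) [^] N)"
      using c by (intro modz_pow tau_modz_mult)
    also have "modz \<dots> (tau g [^] N \<otimes> tau h [^] N)"
      using c by (intro modz_pow_mult) auto
    also have "modz \<dots> (\<one> \<otimes> \<one>)" by (intro modz_mult eng)
    finally show ?case by simp
  qed
  then show ?thesis using that N(1) S'(3) by blast
qed

text \<open>Adding a letter to a word changes \<open>tau\<close> by a constant and by commutators that are
  linear in the length, hence the quadratic bound.\<close>

lemma tau_coordinate:
  assumes S: "finite_generating_set G S"
    and N: "N > 0" "\<And>x. x \<in> carrier G \<Longrightarrow> modz (tau x [^] (N::int)) \<one>"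
  obtains f :: "'a \<Rightarrow> int" and K :: int where "K \<ge> 0" "\<And>x. x \<in> carrier G \<Longrightarrow> tau x [^] N = sh \<one> (f x)"
    "\<And>ws. set ws \<subseteq> letters S \<Longrightarrow> \<bar>f (word_prod ws)\<bar> \<le> K * int (length ws) ^ 2"
proof -
  have S': "finite S" "S \<subseteq> carrier G" using S by (auto simp: finite_generating_set_def)
  have "\<forall>x\<in>carrier G. \<exists>k. tau x [^] N = sh \<one> k" using N(2) by (auto simp: modz_def)
  then obtain f where f: "\<And>x. x \<in> carrier G \<Longrightarrow> tau x [^] N = sh \<one> (f x)" by metis
  have f_one: "f \<one> = 0" using f[of \<one>] by (simp add: eq_commute[of \<one>])
  \<comment> \<open>The values of \<open>tau\<close> commute, so taking N-th powers just multiplies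
    the bilinear exponent of \<open>tau_mult\<close> by N.\<close>
  have f_mult: "f (x \<otimes> y) = f x + f y + N * (\<omega> y (\<psi> x) - 4 * bcoord x * acoord y)"
    if c: "x \<in> carrier G" "y \<in> carrier G" for x y
  proof -
    let ?e = "\<omega> y (\<psi> x) - 4 * bcoord x * acoord y"
    have "sh \<one> (f (x \<otimes> y)) = (sh (tau x \<otimes> tau y) ?e) [^] N"
      using f[of "x \<otimes> y"] c by (simp add: tau_mult)
    also have "\<dots> = sh ((tau x \<otimes> tau y) [^] N) (N * ?e)"
      using c by (intro sh_pow) auto
    also have "(tau x \<otimes> tau y) [^] N = tau x [^] N \<otimes> tau y [^] N"
      using c by (intro int_pow_mult_distrib tau_central) auto
    also have "\<dots> = sh \<one> (f x + f y)"
      using c by (simp add: f add.commute)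
    finally show ?thesis by simp
  qed
  define A where "A = letters S"
  have A: "finite A" "A \<subseteq> carrier G"
    using S' letters_closed[OF S'(2)] by (auto simp: A_def letters_def)
  obtain F where F: "F \<ge> 0" "\<And>s. s \<in> A \<Longrightarrow> \<bar>f s\<bar> \<le> F"
    using finite_int_bound[OF A(1), of f] by auto
  obtain M1 where M1: "M1 \<ge> 0" "\<And>s. s \<in> A \<Longrightarrow> \<bar>acoord s\<bar> \<le> M1"
    using finite_int_bound[OF A(1), of acoord] by auto
  obtain M2 where M2: "M2 \<ge> 0" "\<And>s. s \<in> A \<Longrightarrow> \<bar>bcoord s\<bar> \<le> M2"
    using finite_int_bound[OF A(1), of bcoord] by auto
  obtain M3 where M3: "M3 \<ge> 0" "\<And>u s. u \<in> A \<Longrightarrow> s \<in> A \<Longrightarrow> \<bar>\<omega> u (\<psi> s)\<bar> \<le> M3"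
    using finite_int_bound[of "A \<times> A" "\<lambda>(u, s). \<omega> u (\<psi> s)"] A(1) by auto
  \<comment> \<open>\<open>F\<close> bounds the value at the new letter; the other summand bounds N
    times the bilinear exponent per unit of length.\<close>
  define K where "K = F + N * (M3 + 4 * M2 * M1)"
  have K: "K \<ge> F" "K \<ge> N * (M3 + 4 * M2 * M1)"
    using F M1 M2 M3 N(1) by (auto simp: K_def)
  have bound: "\<bar>f (word_prod ws)\<bar> \<le> K * int (length ws) ^ 2" if "set ws \<subseteq> A" for ws
    using that
  proof (induction ws)
    case Nil
    then show ?case by (simp add: f_one)
  next
    case (Cons s ws)
    let ?y = "word_prod ws" and ?n = "int (length ws)"
    have s: "s \<in> A" "s \<in> carrier G" and ws: "set ws \<subseteq> A" "set ws \<subseteq> letters S" and y: "?y \<in> carrier G"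
      using Cons.prems A by (auto simp: A_def)
    have \<psi>s: "\<psi> s \<in> carrier G" using s by simp
    have "\<bar>\<omega> ?y (\<psi> s)\<bar> \<le> M3 * ?n"
      by (rule int_hom_on_word_bound[OF int_hom_on_\<omega>_left[OF \<psi>s] S'(2) _ ws(2)])
        (use M3(2)[OF _ s(1)] in \<open>simp add: A_def\<close>)
    moreover have "\<bar>acoord ?y\<bar> \<le> M1 * ?n"
      by (rule int_hom_on_word_bound[OF acoord_hom S'(2) _ ws(2)]) (use M1(2) in \<open>simp add: A_def\<close>)
    then have "\<bar>bcoord s\<bar> * \<bar>acoord ?y\<bar> \<le> M2 * (M1 * ?n)"
      using M2 s by (intro mult_mono) auto
    ultimately have "\<bar>\<omega> ?y (\<psi> s) - 4 * bcoord s * acoord ?y\<bar> \<le> (M3 + 4 * M2 * M1) * ?n"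
      using abs_triangle_ineq4[of "\<omega> ?y (\<psi> s)" "4 * bcoord s * acoord ?y"]
      by (simp add: abs_mult algebra_simps)
    then have "N * \<bar>\<omega> ?y (\<psi> s) - 4 * bcoord s * acoord ?y\<bar> \<le> N * ((M3 + 4 * M2 * M1) * ?n)"
      using N(1) by (intro mult_left_mono) auto
    also have "\<dots> \<le> K * ?n"
      using K(2) by (simp add: mult_right_mono flip: mult.assoc)
    finally have e: "\<bar>N * (\<omega> ?y (\<psi> s) - 4 * bcoord s * acoord ?y)\<bar> \<le> K * ?n"
      using N(1) by (simp add: abs_mult)
    have "\<bar>f (s \<otimes> ?y)\<bar> \<le> \<bar>f s\<bar> + \<bar>f ?y\<bar> + \<bar>N * (\<omega> ?y (\<psi> s) - 4 * bcoord s * acoord ?y)\<bar>"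
      unfolding f_mult[OF s(2) y] by linarith
    also have "\<dots> \<le> F + K * ?n ^ 2 + K * ?n"
      using F(2)[OF s(1)] Cons.IH[OF ws(1)] e by linarith
    also have "\<dots> \<le> K * (?n + 1) ^ 2"
    proof -
      have "K * (?n + 1) ^ 2 = K * ?n ^ 2 + K * ?n + (K * ?n + K)"
        by (simp add: power2_eq_square algebra_simps)
      moreover have "0 \<le> K * ?n" using K(1) F(1) by simp
      ultimately show ?thesis using K(1) by linarith
    qed
    finally show ?case by (simp add: add.commute)
  qed
  have "K \<ge> 0" using K(1) F(1) by linarith
  show ?thesis
    by (rule that[OF \<open>K \<ge> 0\<close> f bound]) (auto simp: A_def)
qed

section \<open>Upper bound: finitely many labels\<close>

definition mod_powers :: "int \<Rightarrow> 'a set" where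
  "mod_powers m = {x \<in> carrier G. \<exists>w\<in>carrier G. modz x (w [^] m)}"

lemma mod_powersI: "x \<in> carrier G \<Longrightarrow> w \<in> carrier G \<Longrightarrow> modz x (w [^] m) \<Longrightarrow> x \<in> mod_powers m"
  unfolding mod_powers_def by blast

lemma mod_powersE:
  assumes "x \<in> mod_powers m"
  obtains w where "x \<in> carrier G" "w \<in> carrier G" "modz x (w [^] m)"
  using assms unfolding mod_powers_def by blast

lemma mod_powers_normal: "mod_powers m \<lhd> G"
  unfolding normal_inv_iff
proof (intro conjI ballI)
  show "subgroup (mod_powers m) G"
  proof
    show "mod_powers m \<subseteq> carrier G" by (auto simp: mod_powers_def)
    show "\<one> \<in> mod_powers m" by (rule mod_powersI[of _ \<one>]) (auto intro: modz_refl)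
  next
    fix x y assume x: "x \<in> mod_powers m" and y: "y \<in> mod_powers m"
    obtain w where w: "x \<in> carrier G" "w \<in> carrier G" "modz x (w [^] m)" using x by (rule mod_powersE)
    obtain v where v: "y \<in> carrier G" "v \<in> carrier G" "modz y (v [^] m)" using y by (rule mod_powersE)
    have "modz (x \<otimes> y) (w [^] m \<otimes> v [^] m)" using w(3) v(3) by (rule modz_mult)
    also have "modz \<dots> ((w \<otimes> v) [^] m)" using w(2) v(2) by (intro modz_sym[OF modz_pow_mult])
    finally show "x \<otimes> y \<in> mod_powers m" using w v by (intro mod_powersI[of _ "w \<otimes> v"]) auto
  next
    fix x assume x: "x \<in> mod_powers m"
    obtain w where w: "x \<in> carrier G" "w \<in> carrier G" "modz x (w [^] m)" using x by (rule mod_powersE)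
    have "modz (inv x) (inv w [^] m)" using modz_inv[OF w(3)] w by (simp add: int_pow_inv)
    then show "inv x \<in> mod_powers m" using w by (intro mod_powersI[of _ "inv w"]) auto
  qed
next
  fix x h assume x: "x \<in> carrier G" and h: "h \<in> mod_powers m"
  obtain w where w: "h \<in> carrier G" "w \<in> carrier G" "modz h (w [^] m)" using h by (rule mod_powersE)
  have "x \<otimes> h \<otimes> inv x = sh h (\<omega> x h)"
    using x w by (simp add: swap[OF x w(1)] m_assoc)
  then have "modz (x \<otimes> h \<otimes> inv x) h" using w(1) unfolding modz_def by blast
  also note w(3)
  finally show "x \<otimes> h \<otimes> inv x \<in> mod_powers m" using x w by (intro mod_powersI[of _ w]) auto
qed

text \<open>The quotient is a finitely generated abelian group in which m-th powers are trivial.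
  With m = 2 N its elements are the finitely many labels in the count of classes.\<close>

lemma finite_mod_powers_quotient:
  assumes S: "finite_generating_set G S" and m: "m > 0"
  shows "finite (carrier (G Mod mod_powers m))"
proof -
  have S': "finite S" "S \<subseteq> carrier G" "generate G S = carrier G"
    using S by (auto simp: finite_generating_set_def)
  define q where "q x = mod_powers m #> x" for x
  interpret N: normal "mod_powers m" G by (rule mod_powers_normal)
  have "modz z \<one>" unfolding modz_def using z_closed by (auto simp: sh_one intro!: exI[of _ 1])
  then have "z \<in> mod_powers m" using z_closed by (intro mod_powersI[of _ \<one>]) auto
  then interpret Q: comm_group "G Mod mod_powers m"
    by (rule FactGroup_comm_group[OF mod_powers_normal])
  interpret q: group_hom G "G Mod mod_powers m" q
    using N.r_coset_hom_Mod Q.is_group by (simp add: group_hom_def group_hom_axioms_def q_def[abs_def])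
  have carr: "carrier (G Mod mod_powers m) = q ` carrier G"
    unfolding q_def FactGroup_def RCOSETS_def by auto
  show ?thesis
  proof (rule Q.finite_if_finite_exponent)
    show "finite (q ` S)" "q ` S \<subseteq> carrier (G Mod mod_powers m)" using S' by auto
    show "generate (G Mod mod_powers m) (q ` S) = carrier (G Mod mod_powers m)"
      unfolding q.generate_img[OF S'(2)] S'(3) carr ..
    show "m > 0" by fact
    fix X assume "X \<in> carrier (G Mod mod_powers m)"
    then obtain x where x: "x \<in> carrier G" "X = q x" unfolding carr by blast
    have "x [^] m \<in> mod_powers m" using x by (intro mod_powersI[of _ x]) (auto intro: modz_refl)
    then have "q (x [^] m) = mod_powers m"
      unfolding q_def using x by (intro coset_join2 N.subgroup_axioms) auto
    then show "X [^]\<^bsub>G Mod mod_powers m\<^esub> m = \<one>\<^bsub>G Mod mod_powers m\<^esub>"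
      using x by (simp add: q.hom_int_pow FactGroup_def)
  qed
qed

text \<open>Modulo \<open>z\<close>, y is w^(2 N) x for some w, which lies in \<open>orth_ab\<close>
  because x and y have equal coordinates. As (w \<psi>(w))^N is trivial modulo \<open>z\<close>, the
  element u = w^N satisfies \<psi>(u)^-1 = u modulo \<open>z\<close>, so twisted conjugation by u
  multiplies x by u^2 = w^(2 N). Thus N removes the torsion, and the 2 comes from u
  \<psi>(u)^-1.\<close>

lemma same_label_shift:
  assumes N: "N > 0" "\<And>x. x \<in> carrier G \<Longrightarrow> modz (tau x [^] (N::int)) \<one>"
    and c: "x \<in> carrier G" "y \<in> carrier G" and "acoord x = acoord y" "bcoord x = bcoord y"
    and "mod_powers (2 * N) #> x = mod_powers (2 * N) #> y"
  shows "\<exists>k. tclass y = tclass (sh x k)"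
proof -
  have "y \<otimes> inv x \<in> mod_powers (2 * N)"
    using rcoset_eq_iff[OF normal_imp_subgroup[OF mod_powers_normal[of "2 * N"]] c(2,1)] assms(7) by simp
  then obtain w where w: "w \<in> carrier G" "modz (y \<otimes> inv x) (w [^] (2 * N))"
    by (rule mod_powersE)
  have "modz (y \<otimes> inv x \<otimes> x) (w [^] (2 * N) \<otimes> x)"
    using w c by (intro modz_mult modz_refl)
  then have y: "modz y (w [^] (2 * N) \<otimes> x)" using c by (simp add: m_assoc)
  have "acoord w = 0" "bcoord w = 0"
    using coord_modz[OF w(2)] w(1) c N(1) assms(5,6) by simp_all
  then have "tau w = w \<otimes> \<psi> w" using w(1) by (intro tau_orth) (simp add: orth_ab_def)
  then have "modz ((w \<otimes> \<psi> w) [^] N) \<one>" using N(2)[OF w(1)] by simp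
  then have "modz \<one> ((w \<otimes> \<psi> w) [^] N)" by (rule modz_sym)
  also have "modz \<dots> (w [^] N \<otimes> \<psi> w [^] N)" using w(1) by (intro modz_pow_mult) auto
  finally have one: "modz \<one> (w [^] N \<otimes> \<psi> w [^] N)" .
  define u where "u = w [^] N"
  have u: "u \<in> carrier G" "\<psi> u = \<psi> w [^] N" "w [^] (2 * N) = u \<otimes> u"
    using w(1) by (simp_all add: u_def \<psi>.hom_int_pow flip: int_pow_mult)
  have "modz \<one> (u \<otimes> \<psi> u)" using one by (simp only: u(2)) (simp only: u_def)
  then have "modz (\<one> \<otimes> inv \<psi> u) (u \<otimes> \<psi> u \<otimes> inv \<psi> u)"
    by (rule modz_mult) (use u(1) in \<open>simp add: modz_refl\<close>)
  then have inv: "modz (inv \<psi> u) u" using u(1) by (simp add: m_assoc)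
  have "modz (u \<otimes> x \<otimes> inv \<psi> u) (u \<otimes> x \<otimes> u)"
    using u(1) c inv by (intro modz_mult modz_refl) auto
  also have "u \<otimes> x \<otimes> u = u \<otimes> (x \<otimes> u)" using u(1) c by (simp add: m_assoc)
  also have "modz \<dots> (u \<otimes> (u \<otimes> x))" using u(1) c by (intro modz_mult modz_commute modz_refl)
  also have "u \<otimes> (u \<otimes> x) = w [^] (2 * N) \<otimes> x" using u c by (simp add: m_assoc)
  also have "modz \<dots> y" by (rule modz_sym) (rule y)
  finally obtain k where k: "u \<otimes> x \<otimes> inv \<psi> u = sh y k" unfolding modz_def by blast
  have "tclass x = tclass (sh y k)" using c u(1) k by (intro tclass_eqI[of _ u]) auto
  then have "tclass (sh x (- k)) = tclass (sh (sh y k) (- k))" using c by (intro tclass_sh) auto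
  then show ?thesis using c by (intro exI[of _ "- k"]) simp
qed

text \<open>Conjugation by an element of the plane that \<psi> fixes shifts the exponent of
  \<open>z\<close> by a combination of the two coordinates, and Bezout coefficients give every
  multiple of the gcd. If both coordinates are 0, nothing is reduced, since k mod 0 = k.\<close>

lemma tclass_sh_gcd:
  assumes x: "x \<in> carrier G"
  shows "tclass (sh x k) = tclass (sh x (k mod gcd (acoord x) (bcoord x)))"
proof -
  let ?d = "gcd (acoord x) (bcoord x)"
  obtain u v where uv: "u * acoord x + v * bcoord x = ?d"
    using bezout_int by blast
  define t where "t = k div ?d"
  define g where "g = a [^] (v * - t) \<otimes> b [^] (u * t)"
  have g: "g \<in> carrier G" "\<psi> g = g" by (simp_all add: g_def \<psi>.hom_int_pow \<psi>_a \<psi>_b)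
  have "\<omega> b x = - acoord x" using \<omega>_antisym[of x b] x by (simp add: acoord_def)
  then have "\<omega> g x = - (t * (u * acoord x + v * bcoord x))"
    unfolding g_def using x by (simp add: \<omega>_mult_left bcoord_def algebra_simps)
  also have "\<dots> = (k mod ?d) - k"
    unfolding uv t_def by (simp add: minus_mult_div_eq_mod[symmetric] mult.commute)
  finally have \<omega>g: "\<omega> g x = (k mod ?d) - k" .
  have "g \<otimes> sh x k \<otimes> inv \<psi> g = sh x (k mod ?d)"
    using g x by (simp add: swap[of g x] \<omega>g m_assoc)
  then show ?thesis using g x by (intro tclass_eqI[of _ g]) auto
qed

text \<open>By \<open>same_label_shift\<close> all classes of the fibre are shifts of one
  representative, and the shifts matter only modulo the gcd.\<close>

lemma card_fibre_nonzero:
  assumes N: "N > 0" "\<And>x. x \<in> carrier G \<Longrightarrow> modz (tau x [^] (N::int)) \<one>"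
    and X: "X \<subseteq> {x \<in> carrier G. acoord x = i \<and> bcoord x = j \<and> mod_powers (2 * N) #> x = L}"
    and ij: "i \<noteq> 0 \<or> j \<noteq> 0"
  shows "card (tclass ` X) \<le> nat (gcd i j)"
proof (cases "X = {}")
  case False
  then obtain x where x: "x \<in> X" by blast
  then have xc: "x \<in> carrier G" "acoord x = i" "bcoord x = j" "mod_powers (2 * N) #> x = L" using X by auto
  have pos: "gcd i j > 0" using ij by simp
  have "tclass ` X \<subseteq> (\<lambda>k. tclass (sh x k)) ` {0..<gcd i j}"
  proof
    fix Y assume "Y \<in> tclass ` X"
    then obtain y where y: "y \<in> X" "Y = tclass y" by blast
    then have yc: "y \<in> carrier G" "acoord y = i" "bcoord y = j" "mod_powers (2 * N) #> y = L" using X by auto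
    have "acoord x = acoord y" "bcoord x = bcoord y" "mod_powers (2 * N) #> x = mod_powers (2 * N) #> y"
      using xc yc by simp_all
    from same_label_shift[OF N xc(1) yc(1) this] obtain k where "tclass y = tclass (sh x k)" ..
    then have "Y = tclass (sh x (k mod gcd i j))"
      using tclass_sh_gcd[OF xc(1), of k] xc y by simp
    then show "Y \<in> (\<lambda>k. tclass (sh x k)) ` {0..<gcd i j}" using pos by simp
  qed
  then have "card (tclass ` X) \<le> card {0..<gcd i j}" by (rule surj_card_le[rotated]) simp
  then show ?thesis by simp
qed simp

text \<open>Over the origin the gcd gives no bound, so classes are counted by the values of
  \<open>f\<close>: a shift by k adds 2 k N to \<open>f\<close>, hence equal values force k =
  0.\<close>

lemma card_fibre_zero:
  assumes N: "N > 0" "\<And>x. x \<in> carrier G \<Longrightarrow> modz (tau x [^] (N::int)) \<one>"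
    and f: "\<And>x. x \<in> carrier G \<Longrightarrow> tau x [^] N = sh \<one> (f x)"
    and X: "X \<subseteq> {x \<in> carrier G. acoord x = 0 \<and> bcoord x = 0 \<and> mod_powers (2 * N) #> x = L}"
    and B: "\<And>x. x \<in> X \<Longrightarrow> \<bar>f x\<bar> \<le> B"
  shows "card (tclass ` X) \<le> nat (2 * B + 1)"
proof -
  have eq: "tclass x = tclass y" if xy: "x \<in> X" "y \<in> X" "f x = f y" for x y
  proof -
    have c: "x \<in> carrier G" "x \<in> orth_ab" "y \<in> carrier G" "y \<in> orth_ab"
      using xy X by (auto simp: orth_ab_def)
    have "acoord x = acoord y" "bcoord x = bcoord y" "mod_powers (2 * N) #> x = mod_powers (2 * N) #> y"
      using subsetD[OF X xy(1)] subsetD[OF X xy(2)] by simp_all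
    from same_label_shift[OF N c(1,3) this] obtain k where k: "tclass y = tclass (sh x k)" ..
    have "sh x k \<in> orth_ab" using c by (simp add: orth_ab_def)
    then have "tau y = tau (sh x k)" using c k by (intro tau_tclass)
    then have "tau y [^] N = (sh (tau x) (2 * k)) [^] N" using c by (simp add: tau_sh)
    also have "\<dots> = sh (tau x [^] N) (N * (2 * k))" using c by (intro sh_pow) auto
    finally have "sh \<one> (f y) = sh \<one> (f x + N * (2 * k))" using f c by simp
    then have "N * (2 * k) = 0" using xy by simp
    then show ?thesis using k N(1) c by simp
  qed
  \<comment> \<open>At values not attained on \<open>X\<close> the choice is arbitrary; this can
    only enlarge the set that has to contain the image.\<close>
  define r where "r v = (SOME x. x \<in> X \<and> f x = v)" for v
  have "tclass ` X \<subseteq> (\<lambda>v. tclass (r v)) ` {-B..B}"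
  proof
    fix Y assume "Y \<in> tclass ` X"
    then obtain y where y: "y \<in> X" "Y = tclass y" by blast
    have "r (f y) \<in> X \<and> f (r (f y)) = f y" unfolding r_def by (rule someI[of _ y]) (use y in simp)
    then have "Y = tclass (r (f y))" using eq y by metis
    moreover have "f y \<in> {-B..B}" using B[OF y(1)] by auto
    ultimately show "Y \<in> (\<lambda>v. tclass (r v)) ` {-B..B}" by blast
  qed
  then have "card (tclass ` X) \<le> card {-B..B}" by (rule surj_card_le[rotated]) simp
  then show ?thesis by (simp add: algebra_simps)
qed

text \<open>The ball is split by the two coordinates, which are O(n), and by the finitely many
  labels; the bounds for the fibres are then summed.\<close>

lemma twisted_growth_upper:
  assumes S: "finite_generating_set G S"
  obtains q M K :: nat where "\<And>n. twisted_growth G \<psi> S n \<le> q * (4 * gcd_sum (M * n) + 8 * (M * n)\<^sup>2 + (2 * K * n\<^sup>2 + 1))"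
proof -
  obtain N where N: "N > 0" "\<And>x. x \<in> carrier G \<Longrightarrow> modz (tau x [^] (N::int)) \<one>"
    using tau_exponent[OF S] by blast
  obtain f and K :: int where K: "K \<ge> 0" and f: "\<And>x. x \<in> carrier G \<Longrightarrow> tau x [^] N = sh \<one> (f x)"
    and f_bound: "\<And>ws. set ws \<subseteq> letters S \<Longrightarrow> \<bar>f (word_prod ws)\<bar> \<le> K * int (length ws) ^ 2"
    using tau_coordinate[OF S N] by metis
  have S': "finite S" "S \<subseteq> carrier G" using S by (auto simp: finite_generating_set_def)
  then have A: "finite (letters S)" by (simp add: letters_def)
  obtain M1 where M1: "M1 \<ge> 0" "\<And>s. s \<in> letters S \<Longrightarrow> \<bar>acoord s\<bar> \<le> M1"
    using finite_int_bound[OF A, of acoord] by auto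
  obtain M2 where M2: "M2 \<ge> 0" "\<And>s. s \<in> letters S \<Longrightarrow> \<bar>bcoord s\<bar> \<le> M2"
    using finite_int_bound[OF A, of bcoord] by auto
  define M where "M = nat (max M1 M2)"
  define Q where "Q = carrier (G Mod mod_powers (2 * N))"
  have Q: "finite Q" unfolding Q_def using N(1) by (intro finite_mod_powers_quotient[OF S]) simp
  have ball: "\<bar>acoord x\<bar> \<le> int (M * n) \<and> \<bar>bcoord x\<bar> \<le> int (M * n) \<and> \<bar>f x\<bar> \<le> K * int n ^ 2"
    if x: "x \<in> \<psi>_ball S n" for x n
  proof -
    have xc: "x \<in> carrier G" "word_norm G S x \<le> n" using x by (auto simp: \<psi>_ball_def)
    obtain ws where ws: "length ws = word_norm G S x" "set ws \<subseteq> letters S" "word_prod ws = x"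
      using S xc(1) by (rule word_norm_word)
    have len: "int (length ws) \<le> int n" using ws(1) xc(2) by simp
    have "\<bar>acoord x\<bar> \<le> M1 * int (length ws)"
      using int_hom_on_word_bound[OF acoord_hom S'(2) M1(2) ws(2)] ws(3) by simp
    also have "\<dots> \<le> max M1 M2 * int n" using len M1(1) by (intro mult_mono) auto
    finally have 1: "\<bar>acoord x\<bar> \<le> max M1 M2 * int n" .
    have "\<bar>bcoord x\<bar> \<le> M2 * int (length ws)"
      using int_hom_on_word_bound[OF bcoord_hom S'(2) M2(2) ws(2)] ws(3) by simp
    also have "\<dots> \<le> max M1 M2 * int n" using len M2(1) by (intro mult_mono) auto
    finally have 2: "\<bar>bcoord x\<bar> \<le> max M1 M2 * int n" .
    have "\<bar>f x\<bar> \<le> K * int (length ws) ^ 2" using f_bound[OF ws(2)] ws(3) by simp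
    also have "\<dots> \<le> K * int n ^ 2" using len K by (intro mult_left_mono power_mono) auto
    finally have 3: "\<bar>f x\<bar> \<le> K * int n ^ 2" .
    have "int (M * n) = max M1 M2 * int n" using M1(1) by (simp add: M_def)
    then show ?thesis using 1 2 3 by (simp only:)
  qed
  have "twisted_growth G \<psi> S n \<le> card Q * (4 * gcd_sum (M * n) + 8 * (M * n)\<^sup>2 + (2 * nat K * n\<^sup>2 + 1))" for n
  proof -
    define D where "D = {- int (M * n)..int (M * n)}"
    define X where "X = (\<lambda>(i, j, L). {x \<in> \<psi>_ball S n. acoord x = i \<and> bcoord x = j \<and> mod_powers (2 * N) #> x = L})"
    \<comment> \<open>As gcd(0, 0) = 0, the fibre over the origin needs a term of its own.\<close>
    define \<beta> where "\<beta> i j = nat (gcd i j) + (if i = 0 \<and> j = 0 then 2 * nat K * n\<^sup>2 + 1 else 0)" for i j :: int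
    have "tclass ` \<psi>_ball S n \<subseteq> (\<Union>p\<in>D \<times> D \<times> Q. tclass ` X p)"
    proof
      fix Y assume "Y \<in> tclass ` \<psi>_ball S n"
      then obtain x where x: "x \<in> \<psi>_ball S n" "Y = tclass x" by blast
      then have xc: "x \<in> carrier G" by (simp add: \<psi>_ball_def)
      have "(acoord x, bcoord x, mod_powers (2 * N) #> x) \<in> D \<times> D \<times> Q"
        using ball[OF x(1)] xc by (auto simp: D_def Q_def FactGroup_def RCOSETS_def)
      moreover have "Y \<in> tclass ` X (acoord x, bcoord x, mod_powers (2 * N) #> x)"
        unfolding X_def x(2) using x(1) by simp
      ultimately show "Y \<in> (\<Union>p\<in>D \<times> D \<times> Q. tclass ` X p)" by blast
    qed
    moreover have fin: "finite (tclass ` X p)" for p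
    proof -
      have "X p \<subseteq> \<psi>_ball S n" by (auto simp: X_def split: prod.split)
      then show ?thesis using finite_word_ball[OF S, of n] unfolding \<psi>_ball_def
        by (intro finite_imageI) (rule finite_subset)
    qed
    moreover have finD: "finite (D \<times> D \<times> Q)" using Q by (simp add: D_def)
    ultimately have "card (tclass ` \<psi>_ball S n) \<le> card (\<Union>p\<in>D \<times> D \<times> Q. tclass ` X p)"
      by (intro card_mono) auto
    also have "\<dots> \<le> (\<Sum>p\<in>D \<times> D \<times> Q. card (tclass ` X p))"
      by (rule card_UN_le[OF finD])
    also have "\<dots> \<le> (\<Sum>(i, j, L)\<in>D \<times> D \<times> Q. \<beta> i j)"
    proof (rule sum_mono)
      fix p assume "p \<in> D \<times> D \<times> Q"
      obtain i j L where p: "p = (i, j, L)" by (cases p)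
      have sub: "X p \<subseteq> {x \<in> carrier G. acoord x = i \<and> bcoord x = j \<and> mod_powers (2 * N) #> x = L}"
        by (auto simp: X_def p \<psi>_ball_def)
      have "card (tclass ` X p) \<le> \<beta> i j"
      proof (cases "i = 0 \<and> j = 0")
        case True
        have "card (tclass ` X p) \<le> nat (2 * (K * int n ^ 2) + 1)"
        proof (rule card_fibre_zero[OF N f])
          show "X p \<subseteq> {x \<in> carrier G. acoord x = 0 \<and> bcoord x = 0 \<and> mod_powers (2 * N) #> x = L}"
            using sub True by simp
          show "\<bar>f x\<bar> \<le> K * int n ^ 2" if "x \<in> X p" for x
            using ball[of x n] that by (simp add: X_def p)
        qed
        also have "\<dots> = 2 * nat K * n\<^sup>2 + 1"
          using K by (simp add: nat_add_distrib nat_mult_distrib nat_power_eq)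
        finally show ?thesis using True by (simp add: \<beta>_def)
      next
        case False
        have "card (tclass ` X p) \<le> nat (gcd i j)"
          using False by (intro card_fibre_nonzero[OF N sub]) auto
        then show ?thesis using False by (auto simp: \<beta>_def)
      qed
      then show "card (tclass ` X p) \<le> (case p of (i, j, L) \<Rightarrow> \<beta> i j)" by (simp add: p)
    qed
    also have "\<dots> = (\<Sum>i\<in>D. \<Sum>(j, L)\<in>D \<times> Q. \<beta> i j)"
      by (rule sum.cartesian_product[symmetric])
    also have "\<dots> = (\<Sum>i\<in>D. \<Sum>j\<in>D. \<Sum>L\<in>Q. \<beta> i j)"
      by (intro sum.cong refl sum.cartesian_product[symmetric])
    also have "\<dots> = card Q * (\<Sum>i\<in>D. \<Sum>j\<in>D. \<beta> i j)"
      by (simp add: sum_distrib_left)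
    also have "(\<Sum>i\<in>D. \<Sum>j\<in>D. \<beta> i j) = (\<Sum>i\<in>D. \<Sum>j\<in>D. nat (gcd i j)) + (2 * nat K * n\<^sup>2 + 1)"
    proof -
      have z: "finite D" "0 \<in> D" by (auto simp: D_def)
      have "(\<Sum>i\<in>D. \<Sum>j\<in>D. if i = 0 \<and> j = 0 then c else 0) = c" for c :: nat
      proof -
        have "(\<Sum>j\<in>D. if i = 0 \<and> j = 0 then c else 0) = (if i = 0 then c else 0)" for i :: int
          using z by (cases "i = 0") simp_all
        then show ?thesis using z by simp
      qed
      then show ?thesis by (simp add: \<beta>_def sum.distrib)
    qed
    also have "card Q * \<dots> \<le> card Q * (4 * gcd_sum (M * n) + 8 * (M * n)\<^sup>2 + (2 * nat K * n\<^sup>2 + 1))"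
      unfolding D_def by (intro mult_left_mono add_right_mono sum_gcd_symmetric_le) simp
    finally show ?thesis unfolding twisted_growth_alt .
  qed
  then show ?thesis by (rule that)
qed

end

section \<open>Transcendence of the growth series\<close>

text \<open>The harmonic factor in \<open>gcd_sum_ge_harm\<close> diverges, so it beats any
  constant; dividing the radius by \<open>K\<close> only rescales that constant.\<close>

lemma growth_lower_bound_criterion:
  fixes f :: "nat \<Rightarrow> nat"
  assumes K: "K > 0" and f: "\<And>n. gcd_sum (n div K) \<le> f n"
  shows "\<exists>M'. \<forall>n. M * real ((n + 2) choose 2) - M' \<le> real (f n)"
proof -
  \<comment> \<open>72 = 8 * 9: the 8 is from \<open>gcd_sum_ge_harm\<close>, the 9 from squaring n
    + 2 \<le> 3 K m.\<close>
  obtain m0 where m0: "\<And>m. m \<ge> m0 \<Longrightarrow> harm m \<ge> 72 * real K ^ 2 * \<bar>M\<bar>"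
    using filterlim_at_top[THEN iffD1, OF harm_at_top] by (auto simp: eventually_sequentially)
  \<comment> \<open>The successor ensures m \<ge> 1, on which n + 2 \<le> 3 K m rests.\<close>
  define n0 where "n0 = K * Suc m0"
  have choose_le: "real ((n + 2) choose 2) \<le> (real n + 2) ^ 2" for n
    unfolding real_choose_2 by (simp add: power2_eq_square field_simps)
  have large: "M * real ((n + 2) choose 2) \<le> real (f n)" if "n \<ge> n0" for n
  proof -
    define m where "m = n div K"
    have m: "m \<ge> Suc m0"
      using that K unfolding n0_def m_def by (simp add: less_eq_div_iff_mult_less_eq mult.commute)
    then have "K \<le> K * m" by simp
    moreover have "n < K + m * K" unfolding m_def using dividend_less_div_times[OF K] by (simp add: add.commute)
    ultimately have "n + 2 \<le> 3 * (K * m)" using K unfolding mult.commute[of m K] by linarith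
    then have "real (n + 2) \<le> real (3 * (K * m))" by (rule of_nat_mono)
    then have "real n + 2 \<le> 3 * (real K * real m)" by simp
    then have "(real n + 2) ^ 2 \<le> (3 * (real K * real m)) ^ 2" by (intro power_mono) auto
    also have "\<dots> = 9 * real K ^ 2 * real m ^ 2" by (simp add: power_mult_distrib)
    finally have "real ((n + 2) choose 2) \<le> 9 * real K ^ 2 * real m ^ 2"
      using choose_le[of n] by linarith
    then have "M * real ((n + 2) choose 2) \<le> \<bar>M\<bar> * (9 * real K ^ 2 * real m ^ 2)"
      by (intro mult_mono) auto
    also have "\<dots> = real m ^ 2 * (72 * real K ^ 2 * \<bar>M\<bar>) / 8" by simp
    also have "\<dots> \<le> real m ^ 2 * harm m / 8"
      using m by (intro divide_right_mono mult_left_mono m0) auto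
    also have "\<dots> \<le> real (gcd_sum m)" by (rule gcd_sum_ge_harm)
    also have "\<dots> \<le> real (f n)" using f[of n] by (simp add: m_def)
    finally show ?thesis .
  qed
  show ?thesis
  \<comment> \<open>This constant absorbs the finitely many n below \<open>n0\<close>.\<close>
  proof (intro exI[of _ "\<bar>M\<bar> * (real n0 + 2) ^ 2"] allI)
    fix n
    show "M * real ((n + 2) choose 2) - \<bar>M\<bar> * (real n0 + 2) ^ 2 \<le> real (f n)"
    proof (cases "n \<ge> n0")
      case True
      have "0 \<le> \<bar>M\<bar> * (real n0 + 2) ^ 2" by simp
      then show ?thesis using large[OF True] by linarith
    next
      case False
      have "real ((n + 2) choose 2) \<le> (real n + 2) ^ 2" by (rule choose_le)
      also have "\<dots> \<le> (real n0 + 2) ^ 2" using False by (intro power_mono) auto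
      finally have "M * real ((n + 2) choose 2) \<le> \<bar>M\<bar> * (real n0 + 2) ^ 2"
        by (intro mult_mono) auto
      then show ?thesis by (smt (verit) of_nat_0_le_iff)
    qed
  qed
qed

lemma growth_upper_bound_criterion:
  fixes f :: "nat \<Rightarrow> nat"
  assumes f: "\<And>n. f n \<le> q * (4 * gcd_sum (M * n) + 8 * (M * n)\<^sup>2 + (2 * K * n\<^sup>2 + 1))"
  shows "\<exists>C. \<forall>n. real (f n) \<le> C * (real n + 1) ^ 2 * (1 + ln (real n + 1))"
proof -
  define c where "c = 1 + ln (real M + 1)"
  have c: "c \<ge> 1" by (simp add: c_def)
  define C where "C = real q * (4 * (real M ^ 2 * c) + 8 * real M ^ 2 + (2 * real K + 1))"
  have "real (f n) \<le> C * (real n + 1) ^ 2 * (1 + ln (real n + 1))" for n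
  proof -
    define l where "l = 1 + ln (real n + 1)"
    have l: "l \<ge> 1" by (simp add: l_def)
    have sq: "real n ^ 2 \<le> (real n + 1) ^ 2 * l"
    proof -
      have "real n ^ 2 \<le> (real n + 1) ^ 2" by (intro power_mono) auto
      also have "\<dots> * 1 \<le> (real n + 1) ^ 2 * l" using l by (intro mult_left_mono) auto
      finally show ?thesis by simp
    qed
    have one: "1 \<le> (real n + 1) ^ 2 * l"
      using mult_mono[of 1 "(real n + 1) ^ 2" 1 l] l by (simp add: one_le_power)
    have "ln (real (M * n) + 1) \<le> ln ((real M + 1) * (real n + 1))"
      by (intro ln_mono) (auto simp: algebra_simps intro: add_pos_nonneg)
    also have "\<dots> = ln (real M + 1) + ln (real n + 1)"
      by (intro ln_mult_pos) auto
    finally have "1 + ln (real (M * n) + 1) \<le> c + (l - 1)" by (simp add: c_def l_def)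
    \<comment> \<open>This is (c - 1) (l - 1) \<ge> 0; it turns the summand from the logarithm of
      the constant \<open>M\<close> into a factor.\<close>
    also have "\<dots> \<le> c * l"
      using mult_nonneg_nonneg[of "c - 1" "l - 1"] c l by (simp add: algebra_simps)
    finally have ln_le: "1 + ln (real (M * n) + 1) \<le> c * l" .
    have "real (gcd_sum (M * n)) \<le> real (M * n) ^ 2 * harm (M * n)"
      by (rule gcd_sum_le_harm)
    also have "\<dots> \<le> real (M * n) ^ 2 * (c * l)"
      using order_trans[OF harm_le_ln ln_le] by (intro mult_left_mono) auto
    also have "\<dots> = (real M ^ 2 * c) * (real n ^ 2 * l)"
      by (simp add: power_mult_distrib)
    also have "\<dots> \<le> (real M ^ 2 * c) * ((real n + 1) ^ 2 * l)"
      using c l by (intro mult_left_mono mult_right_mono power_mono) auto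
    finally have gcd: "real (gcd_sum (M * n)) \<le> (real M ^ 2 * c) * ((real n + 1) ^ 2 * l)" .
    have "real (f n) \<le> real (q * (4 * gcd_sum (M * n) + 8 * (M * n)\<^sup>2 + (2 * K * n\<^sup>2 + 1)))"
      using f[of n] by (rule of_nat_mono)
    also have "\<dots> = real q * (4 * real (gcd_sum (M * n)) + 8 * real M ^ 2 * real n ^ 2 + (2 * real K * real n ^ 2 + 1))"
      by (simp add: power_mult_distrib algebra_simps)
    also have "\<dots> \<le> real q * (4 * ((real M ^ 2 * c) * ((real n + 1) ^ 2 * l))
        + 8 * real M ^ 2 * ((real n + 1) ^ 2 * l) + (2 * real K * ((real n + 1) ^ 2 * l) + (real n + 1) ^ 2 * l))"
      by (intro mult_left_mono add_mono gcd sq one) auto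
    also have "\<dots> = C * (real n + 1) ^ 2 * l"
      by (simp add: C_def algebra_simps)
    finally show ?thesis by (simp add: l_def)
  qed
  then show ?thesis by blast
qed

lemma generalised_Heisenberg_group_heisenberg:
  fixes G (structure)
  assumes "generalised_Heisenberg_group G"
  obtains z a b where "heisenberg G z a b"
proof -
  interpret group G using assms by (simp add: generalised_Heisenberg_group_def)
  define D where "D = derived G (carrier G)"
  have center: "D \<subseteq> group_center G" and cyc: "cyclic_group (G\<lparr>carrier := D\<rparr>)" and inf: "infinite D"
    using assms by (simp_all add: generalised_Heisenberg_group_def D_def)
  have sub: "subgroup D G" unfolding D_def by (rule derived_is_subgroup) simp
  interpret D: group "G\<lparr>carrier := D\<rparr>" by (rule subgroup_imp_group[OF sub])
  obtain z where z: "z \<in> D" "D = range (\<lambda>n::int. z [^]\<^bsub>G\<lparr>carrier := D\<rparr>\<^esub> n)"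
    using cyc unfolding D.cyclic_group by auto
  have D: "D = range (\<lambda>n::int. z [^] n)"
    using z int_pow_consistent[OF sub z(1)] by simp
  have zc: "z \<in> carrier G" using subgroup.mem_carrier[OF sub z(1)] .
  have "central_commutators G z"
  proof
    show "z \<in> carrier G" by fact
    show "z \<otimes> x = x \<otimes> z" if "x \<in> carrier G" for x
      using center z(1) that by (auto simp: group_center_def)
    show "k = 0" if k: "z [^] (k::int) = \<one>" for k
    proof (rule ccontr)
      assume "k \<noteq> 0"
      \<comment> \<open>A trivial power of \<open>z\<close> would allow exponents to be reduced
        modulo |k|, making the derived subgroup finite.\<close>
      have "D \<subseteq> (\<lambda>n. z [^] n) ` {0..<\<bar>k\<bar>}"
      proof
        fix x assume "x \<in> D"
        then obtain n :: int where n: "x = z [^] n" using D by blast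
        have "z [^] (\<bar>k\<bar>) = \<one>" using k zc by (cases "k \<ge> 0") (simp_all add: int_pow_neg)
        then have "z [^] (\<bar>k\<bar> * (n div \<bar>k\<bar>)) = \<one>" using zc by (simp add: int_pow_pow[symmetric])
        moreover have "z [^] n = z [^] (\<bar>k\<bar> * (n div \<bar>k\<bar>)) \<otimes> z [^] (n mod \<bar>k\<bar>)"
          using int_pow_mult[OF zc, of "\<bar>k\<bar> * (n div \<bar>k\<bar>)" "n mod \<bar>k\<bar>"] by simp
        ultimately have "x = z [^] (n mod \<bar>k\<bar>)" using n zc by simp
        then show "x \<in> (\<lambda>n. z [^] n) ` {0..<\<bar>k\<bar>}" using \<open>k \<noteq> 0\<close> by simp
      qed
      then show False using inf finite_subset by blast
    qed
    show "\<exists>k::int. x \<otimes> y = y \<otimes> x \<otimes> z [^] k" if xy: "x \<in> carrier G" "y \<in> carrier G" for x y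
    proof -
      \<comment> \<open>The commutator of the inverses is taken because x y = y x [x^-1, y^-1] puts
        the power of \<open>z\<close> on the right.\<close>
      have "inv x \<otimes> inv y \<otimes> inv (inv x) \<otimes> inv (inv y) \<in> derived_set G (carrier G)"
        using xy by blast
      then have "inv x \<otimes> inv y \<otimes> x \<otimes> y \<in> D"
        using xy unfolding D_def derived_def by (intro generate.incl) simp
      then obtain k :: int where k: "inv x \<otimes> inv y \<otimes> x \<otimes> y = z [^] k" unfolding D by blast
      have "y \<otimes> x \<otimes> z [^] k = (y \<otimes> x) \<otimes> inv (y \<otimes> x) \<otimes> (x \<otimes> y)"
        unfolding k[symmetric] using xy by (simp add: m_assoc inv_mult_group)
      also have "\<dots> = x \<otimes> y" using xy by simp
      finally show ?thesis by (intro exI[of _ k]) simp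
    qed
  qed
  then interpret central_commutators G z .
  obtain a b where "a \<in> carrier G" "b \<in> carrier G" "\<omega> a b = 1"
    using exists_unit_pair D unfolding D_def by blast
  then have "heisenberg G z a b" by unfold_locales
  then show ?thesis by (rule that)
qed

theorem corollary2:
  fixes G :: "('a, 'b) monoid_scheme"
  assumes "generalised_Heisenberg_group G"
  shows "\<exists>\<psi> \<in> iso G G. \<forall>S. finite_generating_set G S \<longrightarrow>
           transcendental_series (twisted_growth_series G \<psi> S)"
proof -
  obtain z a b where "heisenberg G z a b"
    using assms by (rule generalised_Heisenberg_group_heisenberg)
  then interpret heisenberg G z a b .
  \<comment> \<open>A generating set fixed in advance: it serves to construct \<psi>, which must not
    depend on the set \<open>S\<close> quantified afterwards.\<close>
  obtain S0 where "finite_generating_set G S0"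
    using assms unfolding generalised_Heisenberg_group_def by blast
  then have S0: "finite S0" "S0 \<subseteq> carrier G" "generate G S0 = carrier G"
    by (simp_all add: finite_generating_set_def)
  obtain \<psi> where "central_twist (carrier G) \<psi>" "\<psi> a = a" "\<psi> b = b"
    "\<And>x. x \<in> carrier G \<Longrightarrow> acoord (\<psi> x) = acoord x" "\<And>x. x \<in> carrier G \<Longrightarrow> bcoord (\<psi> x) = bcoord x"
    "\<And>x. x \<in> orth_ab \<Longrightarrow> \<psi> x \<otimes>\<^bsub>G\<^esub> x \<in> torsion_mod_z"
    using exists_plane_fixing_twist[OF S0] by metis
  then interpret heisenberg_twist G z a b \<psi> by unfold_locales
  have "transcendental_series (twisted_growth_series G \<psi> S)" if S: "finite_generating_set G S" for S
  proof -
    obtain K where "K > 0" "\<And>n. gcd_sum (n div K) \<le> twisted_growth G \<psi> S n"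
      using twisted_growth_lower[OF S] by blast
    note lower = growth_lower_bound_criterion[OF this]
    obtain q M K' :: nat where "\<And>n. twisted_growth G \<psi> S n \<le> q * (4 * gcd_sum (M * n) + 8 * (M * n)\<^sup>2 + (2 * K' * n\<^sup>2 + 1))"
      using twisted_growth_upper[OF S] by blast
    from growth_upper_bound_criterion[OF this] obtain C where
      upper: "\<And>n. real (twisted_growth G \<psi> S n) \<le> C * (real n + 1) ^ 2 * (1 + ln (real n + 1))"
      by blast
    show ?thesis
      unfolding twisted_growth_series_def by (rule transcendental_series_criterion[OF lower upper])
  qed
  then show ?thesis using \<psi>_iso by blast
qed

end
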